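(* Let $\mathcal{E}(0)=\{E_{n,0}: n=0,\dots,N\}$ be a finite partition of $\partial\overline{\mathcal{G}}$ into nonempty clopen sets and let $\delta>0$ be such that the neighborhoods $N_\delta(E_{n,0})$, $n=0,\dots,N$, are pairwise disjoint and $N_\delta(E_{n,0})$ has finite volume for $n=1,\dots,N$. For $n=1,\dots,N$ let $h_n$ be a function defined and harmonic on $N_\delta(E_{n,0})\cap\mathcal{G}$ with $h_n\in L^2(N_\delta(E_{n,0})\cap\mathcal{G})$, and put $h_0\equiv 0$. Let $\mathcal{E}(0),\mathcal{E}(1),\mathcal{E}(2),\dots$ be a sequence of partitions with attached functions constructed from this data as described in the context, and let $\mathcal{D}_j$, $S_j$ and $S_U$ be the corresponding domains and operators. Then the operators $S_j$ ($j=0,1,2,\dots$) and $S_U$ are symmetric operators on $L^2(\mathcal{G})$, and each of them has a self-adjoint extension.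
   Context: $\mathcal{G}$ is a connected, locally finite metric graph with countable vertex set and countable edge set. Each edge $e$ has a length $l_e>0$ and is identified with an interval $[a_e,b_e]$ of length $l_e$. $\mathcal{G}$ carries the geodesic distance $d$ (infimum of lengths of paths), and $\overline{\mathcal{G}}$ denotes its metric completion. A designated set of vertices, containing all vertices of degree $1$, forms the boundary vertices. The interior $\mathcal{G}_{int}$ is $\mathcal{G}$ with the boundary vertices removed, and $\partial\overline{\mathcal{G}}=\overline{\mathcal{G}}\setminus\mathcal{G}_{int}$. Standing assumptions: $\overline{\mathcal{G}}$ is compact and $\partial\overline{\mathcal{G}}$ is totally disconnected. A set is clopen if it is both open and closed in $\partial\overline{\mathcal{G}}$. For $E\subset\overline{\mathcal{G}}$ and $\epsilon>0$, $N_\epsilon(E)$ is the union of the open balls of radius $\epsilon$ about points of $E$. The volume of a set is the Lebesgue measure of its intersection with the edges of $\mathcal{G}$. $L^2(\mathcal{G})=\bigoplus_e L^2[a_e,b_e]$ consists of real-valued functions with $\langle f,g\rangle_2=\sum_e\int_{a_e}^{b_e}f_eg_e$. For an edge $e$ incident on a vertex $v$ (written $e\sim v$), $\partial_\nu f_e(v)$ is the derivative of the restriction $f_e$ at $v$ computed in the coordinate identifying $v$ with $a_e$, i.e. in the direction pointing from $v$ into $e$. $\mathcal{D}_{max}$ is the set of continuous real-valued functions $f$ on $\mathcal{G}$ such that: - $f$ has absolutely continuous derivative on each edge; - $f,f''\in L^2(\mathcal{G})$; - $\sum_{e\sim v}\partial_\nu f_e(v)=0$ at every interior vertex $v$. A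 function defined on a union of edge pieces is harmonic there if it is continuous, linear on each edge piece, and satisfies $\sum_{e\sim v}\partial_\nu f_e(v)=0$ at each interior vertex of that set. Construction. Each set of $\mathcal{E}(0)$ is attached a function: $E_{n,0}$ is attached $h_n$. Given a finite partition $\mathcal{E}(j)$ of $\partial\overline{\mathcal{G}}$ into nonempty clopen sets with attached functions, $\mathcal{E}(j+1)$ is formed as follows. Each set of $\mathcal{E}(j)$ that can be written as a union of two nonempty disjoint clopen sets is replaced by two such sets, each inheriting the function attached to the parent set. Sets that cannot be so split are kept unchanged with their function. Thus every set $F\in\mathcal{E}(j)$ lies in some $E_{n,0}$ and is attached $h_n$. $\mathcal{D}_j$ is the set of $\phi\in\mathcal{D}_{max}$ for which there exist $\epsilon\in(0,\delta)$ and constants $c_F$ (one for each $F\in\mathcal{E}(j)$) with $\phi=c_F h_n$ on $N_\epsilon(F)\cap\mathcal{G}$ for each $F\in\mathcal{E}(j)$, where $h_n$ is the function attached to $F$. In particular $\phi=0$ near the pieces of $E_{0,0}$. The domains increase with $j$. $S_j$ is the operator $-D^2$ (minus the edgewise second derivative) on $L^2(\mathcal{G})$ with domain $\mathcal{D}_j$, and $S_U$ is $-D^2$ with domain $\bigcup_j\mathcal{D}_j$. *)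

theory Defs
  imports "HOL-Analysis.Analysis"
begin

text \<open>A graph with vertex type 'v and edge type 'e. Edge e goes from src e to tgt e and is
  identified with the interval [0, len e] (so a_e = 0 corresponds to src e and b_e = len e
  to tgt e). bdry is the designated set of boundary vertices.\<close>

record ('v, 'e) mgraph =
  src :: "'e \<Rightarrow> 'v"
  tgt :: "'e \<Rightarrow> 'v"
  len :: "'e \<Rightarrow> real"
  bdry :: "'v set"

datatype ('v, 'e) gpoint = Vx 'v | Ed 'e real

definition gpoints :: "('v, 'e, 'z) mgraph_scheme \<Rightarrow> ('v, 'e) gpoint set" where
  "gpoints G = range Vx \<union> {Ed e t | e t. 0 < t \<and> t < len G e}"

definition gpt :: "('v, 'e, 'z) mgraph_scheme \<Rightarrow> 'e \<Rightarrow> real \<Rightarrow> ('v, 'e) gpoint" where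
  "gpt G e t = (if t = 0 then Vx (src G e) else if t = len G e then Vx (tgt G e) else Ed e t)"

inductive walk :: "('v, 'e, 'z) mgraph_scheme \<Rightarrow> 'v \<Rightarrow> 'v \<Rightarrow> real \<Rightarrow> bool" for G where
  nil: "walk G u u 0"
| fwd: "src G e = u \<Longrightarrow> walk G (tgt G e) w L \<Longrightarrow> walk G u w (len G e + L)"
| bwd: "tgt G e = u \<Longrightarrow> walk G (src G e) w L \<Longrightarrow> walk G u w (len G e + L)"

definition vdist :: "('v, 'e, 'z) mgraph_scheme \<Rightarrow> 'v \<Rightarrow> 'v \<Rightarrow> real" where
  "vdist G u w = Inf {L. walk G u w L}"

fun anchors :: "('v, 'e, 'z) mgraph_scheme \<Rightarrow> ('v, 'e) gpoint \<Rightarrow> ('v \<times> real) set" where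
  "anchors G (Vx v) = {(v, 0)}"
| "anchors G (Ed e t) = {(src G e, t), (tgt G e, len G e - t)}"

fun direct :: "('v, 'e) gpoint \<Rightarrow> ('v, 'e) gpoint \<Rightarrow> real set" where
  "direct (Ed e t) (Ed e' s) = (if e = e' then {\<bar>t - s\<bar>} else {})"
| "direct _ _ = {}"

text \<open>Geodesic distance: infimum of lengths of paths (a path either stays inside one edge,
  or leaves the edge of x through an endpoint, follows an edge walk and enters the edge of y).\<close>
definition gdist :: "('v, 'e, 'z) mgraph_scheme \<Rightarrow> ('v, 'e) gpoint \<Rightarrow> ('v, 'e) gpoint \<Rightarrow> real" where
  "gdist G x y = Inf ({a + vdist G u w + b | u a w b. (u, a) \<in> anchors G x \<and> (w, b) \<in> anchors G y}
                     \<union> direct x y)"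

definition degree :: "('v, 'e, 'z) mgraph_scheme \<Rightarrow> 'v \<Rightarrow> nat" where
  "degree G v = card {e. src G e = v} + card {e. tgt G e = v}"

definition metric_graph :: "('v, 'e, 'z) mgraph_scheme \<Rightarrow> bool" where
  "metric_graph G \<longleftrightarrow> (\<forall>e. 0 < len G e)
     \<and> (\<forall>v. finite {e. src G e = v \<or> tgt G e = v})
     \<and> (\<forall>u w. \<exists>L. walk G u w L)
     \<and> {v. degree G v = 1} \<subseteq> bdry G"

definition is_completion :: "('v, 'e, 'z) mgraph_scheme \<Rightarrow> (('v, 'e) gpoint \<Rightarrow> 'm::metric_space) \<Rightarrow> bool" where
  "is_completion G \<iota> \<longleftrightarrow> (\<forall>x\<in>gpoints G. \<forall>y\<in>gpoints G. dist (\<iota> x) (\<iota> y) = gdist G x y)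
     \<and> closure (\<iota> ` gpoints G) = UNIV \<and> complete (UNIV :: 'm set)"

definition gint :: "('v, 'e, 'z) mgraph_scheme \<Rightarrow> ('v, 'e) gpoint set" where
  "gint G = gpoints G - Vx ` bdry G"

definition bnd :: "('v, 'e, 'z) mgraph_scheme \<Rightarrow> (('v, 'e) gpoint \<Rightarrow> 'm) \<Rightarrow> 'm set" where
  "bnd G \<iota> = UNIV - \<iota> ` gint G"

definition totally_disconnected :: "'a::topological_space set \<Rightarrow> bool" where
  "totally_disconnected S \<longleftrightarrow> (\<forall>C. C \<subseteq> S \<and> connected C \<longrightarrow> (\<exists>x. C \<subseteq> {x}))"

definition clopen_in :: "'a::topological_space set \<Rightarrow> 'a set \<Rightarrow> bool" where
  "clopen_in S A \<longleftrightarrow> openin (top_of_set S) A \<and> closedin (top_of_set S) A"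

definition Nbh :: "real \<Rightarrow> 'm::metric_space set \<Rightarrow> 'm set" where
  "Nbh \<epsilon> S = (\<Union>x\<in>S. ball x \<epsilon>)"

definition Gpart :: "('v, 'e, 'z) mgraph_scheme \<Rightarrow> (('v, 'e) gpoint \<Rightarrow> 'm) \<Rightarrow> 'm set \<Rightarrow> ('v, 'e) gpoint set" where
  "Gpart G \<iota> S = {p \<in> gpoints G. \<iota> p \<in> S}"

definition volume :: "('v, 'e, 'z) mgraph_scheme \<Rightarrow> (('v, 'e) gpoint \<Rightarrow> 'm) \<Rightarrow> 'm set \<Rightarrow> ennreal" where
  "volume G \<iota> S = (\<integral>\<^sup>+ e. emeasure lborel {t \<in> {0..len G e}. \<iota> (gpt G e t) \<in> S} \<partial>count_space UNIV)"

definition gcont_on :: "('v, 'e, 'z) mgraph_scheme \<Rightarrow> ('v, 'e) gpoint set \<Rightarrow> (('v, 'e) gpoint \<Rightarrow> real) \<Rightarrow> bool" where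
  "gcont_on G U f \<longleftrightarrow> (\<forall>p\<in>U. \<forall>\<epsilon>>0. \<exists>\<eta>>0. \<forall>q\<in>U. gdist G p q < \<eta> \<longrightarrow> \<bar>f q - f p\<bar> < \<epsilon>)"

definition rep :: "('v, 'e, 'z) mgraph_scheme \<Rightarrow> (('v, 'e) gpoint \<Rightarrow> real) \<Rightarrow> 'e \<Rightarrow> real \<Rightarrow> real" where
  "rep G f = (\<lambda>e t. f (gpt G e t))"

definition d1 :: "('v, 'e, 'z) mgraph_scheme \<Rightarrow> ('e \<Rightarrow> real \<Rightarrow> real) \<Rightarrow> 'e \<Rightarrow> real \<Rightarrow> real" where
  "d1 G u e t = vector_derivative (u e) (at t within {0..len G e})"

definition d2 :: "('v, 'e, 'z) mgraph_scheme \<Rightarrow> ('e \<Rightarrow> real \<Rightarrow> real) \<Rightarrow> 'e \<Rightarrow> real \<Rightarrow> real" where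
  "d2 G u = d1 G (d1 G u)"

definition negD2 :: "('v, 'e, 'z) mgraph_scheme \<Rightarrow> ('e \<Rightarrow> real \<Rightarrow> real) \<Rightarrow> 'e \<Rightarrow> real \<Rightarrow> real" where
  "negD2 G u = (\<lambda>e t. - d2 G u e t)"

text \<open>Sum of outward-into-edge derivatives at v: at the src end the derivative is f_e'(0),
  at the tgt end (coordinate reversed) it is - f_e'(len e).\<close>
definition kirch :: "('v, 'e, 'z) mgraph_scheme \<Rightarrow> ('e \<Rightarrow> real \<Rightarrow> real) \<Rightarrow> 'v \<Rightarrow> real" where
  "kirch G u v = (\<Sum>e\<in>{e. src G e = v}. d1 G u e 0) - (\<Sum>e\<in>{e. tgt G e = v}. d1 G u e (len G e))"

definition abs_continuous_on :: "real set \<Rightarrow> (real \<Rightarrow> real) \<Rightarrow> bool" where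
  "abs_continuous_on S f \<longleftrightarrow> (\<forall>\<epsilon>>0. \<exists>\<delta>>0. \<forall>(n::nat) (a::nat \<Rightarrow> real) b.
      (\<forall>k<n. a k \<le> b k \<and> {a k..b k} \<subseteq> S)
      \<and> (\<forall>i<n. \<forall>j<n. i \<noteq> j \<longrightarrow> b i \<le> a j \<or> b j \<le> a i)
      \<and> (\<Sum>k<n. b k - a k) < \<delta>
      \<longrightarrow> (\<Sum>k<n. \<bar>f (b k) - f (a k)\<bar>) < \<epsilon>)"

definition L2 :: "('v, 'e, 'z) mgraph_scheme \<Rightarrow> ('e \<Rightarrow> real \<Rightarrow> real) \<Rightarrow> bool" where
  "L2 G u \<longleftrightarrow> (\<forall>e. set_borel_measurable lborel {0..len G e} (u e))
     \<and> (\<integral>\<^sup>+ e. (\<integral>\<^sup>+ t. indicator {0..len G e} t * ennreal ((u e t)\<^sup>2) \<partial>lborel) \<partial>count_space UNIV) < \<infinity>"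

definition L2on :: "('v, 'e, 'z) mgraph_scheme \<Rightarrow> ('v, 'e) gpoint set \<Rightarrow> (('v, 'e) gpoint \<Rightarrow> real) \<Rightarrow> bool" where
  "L2on G U f \<longleftrightarrow> (\<forall>e. set_borel_measurable lborel {t \<in> {0..len G e}. gpt G e t \<in> U} (\<lambda>t. f (gpt G e t)))
     \<and> (\<integral>\<^sup>+ e. (\<integral>\<^sup>+ t. indicator {t \<in> {0..len G e}. gpt G e t \<in> U} t * ennreal ((f (gpt G e t))\<^sup>2) \<partial>lborel)
          \<partial>count_space UNIV) < \<infinity>"

definition l2inner :: "('v, 'e, 'z) mgraph_scheme \<Rightarrow> ('e \<Rightarrow> real \<Rightarrow> real) \<Rightarrow> ('e \<Rightarrow> real \<Rightarrow> real) \<Rightarrow> real" where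
  "l2inner G u v = (\<Sum>\<^sub>\<infinity>e. (LINT t:{0..len G e}|lborel. u e t * v e t))"

definition ae_eq :: "('v, 'e, 'z) mgraph_scheme \<Rightarrow> ('e \<Rightarrow> real \<Rightarrow> real) \<Rightarrow> ('e \<Rightarrow> real \<Rightarrow> real) \<Rightarrow> bool" where
  "ae_eq G u v \<longleftrightarrow> (\<forall>e. AE t in lborel. t \<in> {0..len G e} \<longrightarrow> u e t = v e t)"

definition dense_L2 :: "('v, 'e, 'z) mgraph_scheme \<Rightarrow> ('e \<Rightarrow> real \<Rightarrow> real) set \<Rightarrow> bool" where
  "dense_L2 G D \<longleftrightarrow> (\<forall>u. L2 G u \<longrightarrow> (\<forall>\<epsilon>>0. \<exists>v\<in>D.
       l2inner G (\<lambda>e t. u e t - v e t) (\<lambda>e t. u e t - v e t) < \<epsilon>))"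

definition symmetric_op :: "('v, 'e, 'z) mgraph_scheme \<Rightarrow> ('e \<Rightarrow> real \<Rightarrow> real) set
    \<Rightarrow> (('e \<Rightarrow> real \<Rightarrow> real) \<Rightarrow> ('e \<Rightarrow> real \<Rightarrow> real)) \<Rightarrow> bool" where
  "symmetric_op G D A \<longleftrightarrow> (\<forall>u\<in>D. L2 G u \<and> L2 G (A u))
     \<and> (\<forall>u\<in>D. \<forall>v\<in>D. \<forall>a b::real. (\<lambda>e t. a * u e t + b * v e t) \<in> D
          \<and> ae_eq G (A (\<lambda>e t. a * u e t + b * v e t)) (\<lambda>e t. a * A u e t + b * A v e t))
     \<and> dense_L2 G D
     \<and> (\<forall>u\<in>D. \<forall>v\<in>D. l2inner G (A u) v = l2inner G u (A v))"

definition self_adjoint_op :: "('v, 'e, 'z) mgraph_scheme \<Rightarrow> ('e \<Rightarrow> real \<Rightarrow> real) set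
    \<Rightarrow> (('e \<Rightarrow> real \<Rightarrow> real) \<Rightarrow> ('e \<Rightarrow> real \<Rightarrow> real)) \<Rightarrow> bool" where
  "self_adjoint_op G D A \<longleftrightarrow> symmetric_op G D A
     \<and> (\<forall>g. L2 G g \<and> (\<exists>h. L2 G h \<and> (\<forall>f\<in>D. l2inner G (A f) g = l2inner G f h)) \<longrightarrow> g \<in> D)"

definition has_self_adjoint_ext :: "('v, 'e, 'z) mgraph_scheme \<Rightarrow> ('e \<Rightarrow> real \<Rightarrow> real) set
    \<Rightarrow> (('e \<Rightarrow> real \<Rightarrow> real) \<Rightarrow> ('e \<Rightarrow> real \<Rightarrow> real)) \<Rightarrow> bool" where
  "has_self_adjoint_ext G D A \<longleftrightarrow> (\<exists>D' A'. D \<subseteq> D' \<and> (\<forall>u\<in>D. ae_eq G (A' u) (A u))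
       \<and> self_adjoint_op G D' A')"

definition Dmax :: "('v, 'e, 'z) mgraph_scheme \<Rightarrow> (('v, 'e) gpoint \<Rightarrow> real) set" where
  "Dmax G = {f. gcont_on G (gpoints G) f
     \<and> (\<forall>e. \<forall>t\<in>{0..len G e}. rep G f e differentiable (at t within {0..len G e}))
     \<and> (\<forall>e. abs_continuous_on {0..len G e} (d1 G (rep G f) e))
     \<and> L2 G (rep G f) \<and> L2 G (d2 G (rep G f))
     \<and> (\<forall>v. v \<notin> bdry G \<longrightarrow> kirch G (rep G f) v = 0)}"

definition harmonic_on :: "('v, 'e, 'z) mgraph_scheme \<Rightarrow> ('v, 'e) gpoint set \<Rightarrow> (('v, 'e) gpoint \<Rightarrow> real) \<Rightarrow> bool" where
  "harmonic_on G U f \<longleftrightarrow> gcont_on G U f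
     \<and> (\<forall>e a b. 0 \<le> a \<and> a \<le> b \<and> b \<le> len G e \<and> gpt G e ` {a..b} \<subseteq> U
          \<longrightarrow> (\<exists>\<alpha> \<beta>. \<forall>t\<in>{a..b}. f (gpt G e t) = \<alpha> + \<beta> * t))
     \<and> (\<forall>v. v \<notin> bdry G \<and> Vx v \<in> U \<longrightarrow> kirch G (rep G f) v = 0)"

definition splittable :: "'a::topological_space set \<Rightarrow> 'a set \<Rightarrow> bool" where
  "splittable S F \<longleftrightarrow> (\<exists>A B. A \<noteq> {} \<and> B \<noteq> {} \<and> A \<inter> B = {} \<and> A \<union> B = F
      \<and> clopen_in S A \<and> clopen_in S B)"

definition refine_step :: "'a::topological_space set \<Rightarrow> 'a set set \<Rightarrow> 'a set set \<Rightarrow> bool" where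
  "refine_step S P Q \<longleftrightarrow> (\<exists>\<sigma>. Q = \<Union>(\<sigma> ` P) \<and> (\<forall>F\<in>P.
      if splittable S F
      then (\<exists>A B. \<sigma> F = {A, B} \<and> A \<noteq> {} \<and> B \<noteq> {} \<and> A \<inter> B = {} \<and> A \<union> B = F
                 \<and> clopen_in S A \<and> clopen_in S B)
      else \<sigma> F = {F}))"

text \<open>The domain D_j attached to the partition P = E(j); a set F in P contained in E n is
  attached the function h n.\<close>
definition Dpart :: "('v, 'e, 'z) mgraph_scheme \<Rightarrow> (('v, 'e) gpoint \<Rightarrow> 'm::metric_space) \<Rightarrow> real
    \<Rightarrow> nat \<Rightarrow> (nat \<Rightarrow> 'm set) \<Rightarrow> (nat \<Rightarrow> ('v, 'e) gpoint \<Rightarrow> real) \<Rightarrow> 'm set set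
    \<Rightarrow> (('v, 'e) gpoint \<Rightarrow> real) set" where
  "Dpart G \<iota> \<delta> N E h P = {\<phi> \<in> Dmax G. \<exists>\<epsilon>. 0 < \<epsilon> \<and> \<epsilon> < \<delta> \<and> (\<exists>c. \<forall>F\<in>P. \<forall>n\<le>N. F \<subseteq> E n \<longrightarrow>
       (\<forall>p\<in>Gpart G \<iota> (Nbh \<epsilon> F). \<phi> p = c F * h n p))}"

end

theory Submission
  imports Defs
begin

text \<open>A symmetric operator on a real Hilbert space always has a self-adjoint extension: the skew
  boundary form on the domain of the adjoint vanishes on the diagonal, so a maximal isotropic
  subspace containing the given domain, found by Zorn's lemma, equals its own complement. It
  remains to see that \<open>-D\<^sup>2\<close> is symmetric and densely defined. Density holds because the domains
  contain all smooth functions supported inside one edge. For symmetry, two functions of the domain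
  are near the boundary locally multiples of one and the same linear function, so their Wronskian
  vanishes there; by compactness only finitely many edges leave this neighbourhood, and their
  boundary terms cancel by the Kirchhoff conditions. Since second derivatives exist only almost
  everywhere, this rests on Lebesgue's theorem for absolutely continuous functions: their
  differentiability is obtained from two nested Vitali coverings of a set where the derivates are
  separated, absolute continuity making the increments over the gaps negligible, and the
  fundamental theorem of calculus from a suitable Henstock gauge.\<close>

section \<open>Absolutely continuous functions\<close>

text \<open>Real scalars are what makes an extension exist without any condition: a real inner
  product is symmetric, so the boundary form of a function with itself cancels, while over complex
  scalars it need not.

  Elements of L2 are functions here, not classes. The adjoint is therefore determined only up to
  \<open>ae_eq\<close> and must be chosen, and it is linear only in this sense.

  The other obstacle is \<open>d2\<close>, an iterated \<open>vector_derivative\<close>, which takes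
  a default value wherever the derivative does not exist. Membership of \<open>d2\<close> in L2
  includes Borel measurability at every point, the exceptional ones included. For this reason the
  set of nondifferentiability is described exactly, as a Borel set, and not merely enclosed in a
  null set. Differentiability is proved with finite families of intervals, because absolute
  continuity is a statement about just these.\<close>

lemma abs_continuous_onE:
  fixes f :: "real \<Rightarrow> real"
  assumes "abs_continuous_on S f" "\<epsilon> > 0"
  obtains \<delta> where "\<delta> > 0" and
    "\<forall>(I::'i set) u v. finite I \<longrightarrow> (\<forall>i\<in>I. u i \<le> v i \<and> {u i..v i} \<subseteq> S) \<longrightarrow>
       (\<forall>i\<in>I. \<forall>j\<in>I. i \<noteq> j \<longrightarrow> v i \<le> u j \<or> v j \<le> u i) \<longrightarrow>
       (\<Sum>i\<in>I. v i - u i) < \<delta> \<longrightarrow> (\<Sum>i\<in>I. \<bar>f (v i) - f (u i)\<bar>) < \<epsilon>"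
proof -
  from assms(1)[unfolded abs_continuous_on_def, THEN spec, THEN mp, OF assms(2)]
  obtain \<delta> where \<delta>: "\<delta> > 0" and ac: "\<forall>(n::nat) a b.
      (\<forall>k<n. a k \<le> b k \<and> {a k..b k} \<subseteq> S) \<and> (\<forall>i<n. \<forall>j<n. i \<noteq> j \<longrightarrow> b i \<le> a j \<or> b j \<le> a i)
      \<and> (\<Sum>k<n. b k - a k) < \<delta> \<longrightarrow> (\<Sum>k<n. \<bar>f (b k) - f (a k)\<bar>) < \<epsilon>"
    by (elim exE conjE)
  show thesis
  proof (rule that[OF \<delta>], intro allI impI)
    fix I :: "'i set" and u v :: "'i \<Rightarrow> real"
    assume fin: "finite I" and sub: "\<forall>i\<in>I. u i \<le> v i \<and> {u i..v i} \<subseteq> S"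
      and dis: "\<forall>i\<in>I. \<forall>j\<in>I. i \<noteq> j \<longrightarrow> v i \<le> u j \<or> v j \<le> u i"
      and len: "(\<Sum>i\<in>I. v i - u i) < \<delta>"
    obtain \<beta> where \<beta>: "bij_betw \<beta> {..<card I} I"
      using ex_bij_betw_nat_finite[OF fin] by (auto simp: atLeast0LessThan)
    then have in_I: "\<beta> k \<in> I" if "k < card I" for k
      using that bij_betwE by blast
    have inj: "\<beta> i \<noteq> \<beta> j" if "i < card I" "j < card I" "i \<noteq> j" for i j
      using \<beta> that unfolding bij_betw_def inj_on_def by blast
    have "(\<Sum>k<card I. v (\<beta> k) - u (\<beta> k)) < \<delta>"
      using len sum.reindex_bij_betw[OF \<beta>, of "\<lambda>i. v i - u i"] by simp
    then have "(\<Sum>k<card I. \<bar>f (v (\<beta> k)) - f (u (\<beta> k))\<bar>) < \<epsilon>"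
      using ac[THEN spec, THEN spec, THEN spec, of "card I" "u \<circ> \<beta>" "v \<circ> \<beta>"] sub in_I dis inj by auto
    then show "(\<Sum>i\<in>I. \<bar>f (v i) - f (u i)\<bar>) < \<epsilon>"
      using sum.reindex_bij_betw[OF \<beta>, of "\<lambda>i. \<bar>f (v i) - f (u i)\<bar>"] by simp
  qed
qed

lemma abs_continuous_on_lipschitz:
  assumes "\<And>x y. x \<in> S \<Longrightarrow> y \<in> S \<Longrightarrow> \<bar>f x - f y\<bar> \<le> L * \<bar>x - y\<bar>" "L \<ge> 0"
  shows "abs_continuous_on S f"
  unfolding abs_continuous_on_def
proof (intro allI impI)
  fix \<epsilon> :: real assume \<epsilon>: "\<epsilon> > 0"
  \<comment> \<open>Dividing by \<open>L + 1\<close> instead of \<open>L\<close> keeps the modulus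
    defined and positive when \<open>L = 0\<close>.\<close>
  have "(\<Sum>k<n. \<bar>f (b k) - f (a k)\<bar>) < \<epsilon>"
    if "\<forall>k<n. a k \<le> b k \<and> {a k..b k} \<subseteq> S" "(\<Sum>k<n. b k - a k) < \<epsilon> / (L + 1)" for n :: nat and a b
  proof -
    have "(\<Sum>k<n. \<bar>f (b k) - f (a k)\<bar>) \<le> (\<Sum>k<n. (L + 1) * (b k - a k))"
    proof (rule sum_mono)
      fix k assume "k \<in> {..<n}"
      then have "a k \<le> b k" "{a k..b k} \<subseteq> S" using that(1) by auto
      then have "a k \<in> S" "b k \<in> S" by auto
      then have "\<bar>f (b k) - f (a k)\<bar> \<le> L * (b k - a k)" using assms(1)[of "b k" "a k"] \<open>a k \<le> b k\<close> by auto
      also have "\<dots> \<le> (L + 1) * (b k - a k)" using \<open>a k \<le> b k\<close> by (intro mult_right_mono) auto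
      finally show "\<bar>f (b k) - f (a k)\<bar> \<le> (L + 1) * (b k - a k)" .
    qed
    also have "\<dots> = (L + 1) * (\<Sum>k<n. b k - a k)" by (simp add: sum_distrib_left)
    also have "\<dots> < (L + 1) * (\<epsilon> / (L + 1))"
      using that(2) assms(2) by (intro mult_strict_left_mono) auto
    also have "\<dots> = \<epsilon>" using assms(2) by simp
    finally show ?thesis .
  qed
  moreover have "\<epsilon> / (L + 1) > 0" using \<epsilon> assms(2) by simp
  ultimately show "\<exists>\<delta>>0. \<forall>(n::nat) a b. (\<forall>k<n. a k \<le> b k \<and> {a k..b k} \<subseteq> S) \<and>
      (\<forall>i<n. \<forall>j<n. i \<noteq> j \<longrightarrow> b i \<le> a j \<or> b j \<le> a i) \<and> (\<Sum>k<n. b k - a k) < \<delta> \<longrightarrow>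
      (\<Sum>k<n. \<bar>f (b k) - f (a k)\<bar>) < \<epsilon>"
    by (intro exI[of _ "\<epsilon> / (L + 1)"] conjI allI impI) (assumption, elim conjE)
qed

text \<open>Linear combinations, products and pointwise equal functions inherit absolute continuity
  by one estimate: their increments are bounded by multiples of the increments of \<open>f\<close>
  and \<open>g\<close>, and such bounds pass to sums over families of intervals.\<close>

lemma abs_continuous_on_dominated:
  assumes f: "abs_continuous_on S f" and g: "abs_continuous_on S g" and "A \<ge> 0" "B \<ge> 0"
    and le: "\<And>x y. x \<in> S \<Longrightarrow> y \<in> S \<Longrightarrow> \<bar>w x - w y\<bar> \<le> A * \<bar>f x - f y\<bar> + B * \<bar>g x - g y\<bar>"
  shows "abs_continuous_on S w"
  unfolding abs_continuous_on_def
proof (intro allI impI)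
  fix \<epsilon> :: real assume \<epsilon>: "\<epsilon> > 0"
  define e where "e = \<epsilon> / (A + B + 1)"
  have e: "e > 0" unfolding e_def using \<epsilon> assms by (intro divide_pos_pos) auto
  obtain d1 where d1: "d1 > 0" "\<forall>(I::nat set) u v. finite I \<longrightarrow> (\<forall>i\<in>I. u i \<le> v i \<and> {u i..v i} \<subseteq> S) \<longrightarrow>
       (\<forall>i\<in>I. \<forall>j\<in>I. i \<noteq> j \<longrightarrow> v i \<le> u j \<or> v j \<le> u i) \<longrightarrow>
       (\<Sum>i\<in>I. v i - u i) < d1 \<longrightarrow> (\<Sum>i\<in>I. \<bar>f (v i) - f (u i)\<bar>) < e"
    by (rule abs_continuous_onE[OF f e]) (rule that)
  obtain d2 where d2: "d2 > 0" "\<forall>(I::nat set) u v. finite I \<longrightarrow> (\<forall>i\<in>I. u i \<le> v i \<and> {u i..v i} \<subseteq> S) \<longrightarrow>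
       (\<forall>i\<in>I. \<forall>j\<in>I. i \<noteq> j \<longrightarrow> v i \<le> u j \<or> v j \<le> u i) \<longrightarrow>
       (\<Sum>i\<in>I. v i - u i) < d2 \<longrightarrow> (\<Sum>i\<in>I. \<bar>g (v i) - g (u i)\<bar>) < e"
    by (rule abs_continuous_onE[OF g e]) (rule that)
  have "(\<Sum>k<n. \<bar>w (b k) - w (a k)\<bar>) < \<epsilon>"
    if "\<forall>k<n. a k \<le> b k \<and> {a k..b k} \<subseteq> S" "\<forall>i<n. \<forall>j<n. i \<noteq> j \<longrightarrow> b i \<le> a j \<or> b j \<le> a i"
      "(\<Sum>k<n. b k - a k) < min d1 d2" for n :: nat and a b
  proof -
    have "(\<Sum>k<n. \<bar>w (b k) - w (a k)\<bar>) \<le> (\<Sum>k<n. A * \<bar>f (b k) - f (a k)\<bar> + B * \<bar>g (b k) - g (a k)\<bar>)"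
    proof (intro sum_mono le)
      fix k assume "k \<in> {..<n}"
      then have "a k \<le> b k" "{a k..b k} \<subseteq> S" using that(1) by auto
      then show "b k \<in> S" "a k \<in> S" by auto
    qed
    also have "\<dots> = A * (\<Sum>k<n. \<bar>f (b k) - f (a k)\<bar>) + B * (\<Sum>k<n. \<bar>g (b k) - g (a k)\<bar>)"
      by (simp add: sum.distrib sum_distrib_left)
    also have "\<dots> \<le> A * e + B * e"
      using d1(2)[rule_format, of "{..<n}" a b] d2(2)[rule_format, of "{..<n}" a b] that assms
      by (intro add_mono mult_left_mono) auto
    also have "\<dots> < (A + B + 1) * e" using e by (simp add: algebra_simps)
    also have "\<dots> = \<epsilon>" unfolding e_def using assms by simp
    finally show ?thesis .
  qed
  moreover have "min d1 d2 > 0" using d1 d2 by simp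
  ultimately show "\<exists>\<delta>>0. \<forall>(n::nat) a b. (\<forall>k<n. a k \<le> b k \<and> {a k..b k} \<subseteq> S) \<and>
      (\<forall>i<n. \<forall>j<n. i \<noteq> j \<longrightarrow> b i \<le> a j \<or> b j \<le> a i) \<and> (\<Sum>k<n. b k - a k) < \<delta> \<longrightarrow>
      (\<Sum>k<n. \<bar>w (b k) - w (a k)\<bar>) < \<epsilon>"
    by (intro exI[of _ "min d1 d2"] conjI allI impI) (assumption, elim conjE)
qed

lemma abs_continuous_on_lincomb:
  assumes "abs_continuous_on S f" "abs_continuous_on S g"
  shows "abs_continuous_on S (\<lambda>x. a * f x + b * g x)"
proof (rule abs_continuous_on_dominated[OF assms, of "\<bar>a\<bar>" "\<bar>b\<bar>"])
  fix x y
  have "a * f x + b * g x - (a * f y + b * g y) = a * (f x - f y) + b * (g x - g y)"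
    by (simp add: algebra_simps)
  then show "\<bar>a * f x + b * g x - (a * f y + b * g y)\<bar> \<le> \<bar>a\<bar> * \<bar>f x - f y\<bar> + \<bar>b\<bar> * \<bar>g x - g y\<bar>"
    by (metis abs_mult abs_triangle_ineq)
qed auto

lemma abs_continuous_on_cong:
  assumes "abs_continuous_on S f" "\<And>x. x \<in> S \<Longrightarrow> f x = g x"
  shows "abs_continuous_on S g"
  using abs_continuous_on_dominated[OF assms(1,1), of 1 0 g] assms(2) by auto

lemma abs_continuous_on_imp_continuous_on:
  assumes "abs_continuous_on {a..b} f"
  shows "continuous_on {a..b} f"
proof -
  have "\<exists>d>0. \<forall>y\<in>{a..b}. dist y x < d \<longrightarrow> dist (f y) (f x) < e" if x: "x \<in> {a..b}" and "e > 0" for x e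
  proof -
    obtain d where d: "d > 0" and ac: "\<forall>(I::nat set) u v. finite I \<longrightarrow> (\<forall>i\<in>I. u i \<le> v i \<and> {u i..v i} \<subseteq> {a..b}) \<longrightarrow>
       (\<forall>i\<in>I. \<forall>j\<in>I. i \<noteq> j \<longrightarrow> v i \<le> u j \<or> v j \<le> u i) \<longrightarrow>
       (\<Sum>i\<in>I. v i - u i) < d \<longrightarrow> (\<Sum>i\<in>I. \<bar>f (v i) - f (u i)\<bar>) < e"
      by (rule abs_continuous_onE[OF assms \<open>e > 0\<close>]) (rule that)
    have "dist (f y) (f x) < e" if "y \<in> {a..b}" "dist y x < d" for y
      using ac[rule_format, of "{0}" "\<lambda>_. x" "\<lambda>_. y"] ac[rule_format, of "{0}" "\<lambda>_. y" "\<lambda>_. x"] that x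
      by (cases "x \<le> y") (auto simp: dist_real_def abs_minus_commute)
    then show ?thesis using d by blast
  qed
  then show ?thesis unfolding continuous_on_iff by blast
qed

lemma abs_continuous_on_mult:
  assumes f: "abs_continuous_on {a..b} f" and g: "abs_continuous_on {a..b} g"
  shows "abs_continuous_on {a..b} (\<lambda>x. f x * g x)"
proof -
  \<comment> \<open>The increments of a product are controlled by those of the factors once the
    factors are bounded; continuity on a compact interval gives the bounds.\<close>
  have "\<exists>B. \<forall>x\<in>{a..b}. \<bar>h x\<bar> \<le> B" if "abs_continuous_on {a..b} h" for h
    using compact_imp_bounded[OF compact_continuous_image[OF
        abs_continuous_on_imp_continuous_on[OF that] compact_Icc]]
    unfolding bounded_iff by auto
  then obtain A B where A: "\<And>x. x \<in> {a..b} \<Longrightarrow> \<bar>f x\<bar> \<le> A" and B: "\<And>x. x \<in> {a..b} \<Longrightarrow> \<bar>g x\<bar> \<le> B"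
    using f g by metis
  show ?thesis
  proof (rule abs_continuous_on_dominated[OF f g, of "\<bar>B\<bar>" "\<bar>A\<bar>"])
    fix x y assume x: "x \<in> {a..b}" and y: "y \<in> {a..b}"
    have "f x * g x - f y * g y = g x * (f x - f y) + f y * (g x - g y)"
      by (simp add: algebra_simps)
    then have "\<bar>f x * g x - f y * g y\<bar> \<le> \<bar>g x\<bar> * \<bar>f x - f y\<bar> + \<bar>f y\<bar> * \<bar>g x - g y\<bar>"
      by (metis abs_mult abs_triangle_ineq)
    also have "\<dots> \<le> \<bar>B\<bar> * \<bar>f x - f y\<bar> + \<bar>A\<bar> * \<bar>g x - g y\<bar>"
      using A[OF y] B[OF x] by (intro add_mono mult_right_mono) auto
    finally show "\<bar>f x * g x - f y * g y\<bar> \<le> \<bar>B\<bar> * \<bar>f x - f y\<bar> + \<bar>A\<bar> * \<bar>g x - g y\<bar>" .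
  qed auto
qed

section \<open>Finite families of intervals and their gaps\<close>

definition nonoverlapping :: "(real \<times> real) set \<Rightarrow> bool" where
  "nonoverlapping D \<longleftrightarrow> (\<forall>I\<in>D. fst I < snd I) \<and> pairwise (\<lambda>I J. snd I \<le> fst J \<or> snd J \<le> fst I) D"

definition increment :: "(real \<Rightarrow> real) \<Rightarrow> (real \<times> real) set \<Rightarrow> real" where
  "increment F D = (\<Sum>I\<in>D. F (snd I) - F (fst I))"

text \<open>\<open>G\<close> collects the gaps that \<open>D\<close> leaves in
  \<open>{u..v}\<close>, and the final equation is a telescoping sum. It is stated for all
  \<open>F\<close> at once because the same gaps serve twice: the identity function compares
  lengths, the given function compares increments.\<close>

lemma exists_gaps:
  assumes "finite D" "nonoverlapping D" "u \<le> v" "\<forall>I\<in>D. u \<le> fst I \<and> snd I \<le> v"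
  shows "\<exists>G. finite G \<and> nonoverlapping G \<and> nonoverlapping (D \<union> G) \<and> D \<inter> G = {}
     \<and> (\<forall>I\<in>G. u \<le> fst I \<and> snd I \<le> v)
     \<and> (\<forall>F. F v - F u = increment F D + increment F G)"
  using assms
proof (induction "card D" arbitrary: D v)
  case 0
  have D: "D = {}" using 0(1) 0(2) by (metis card_0_eq)
  show ?case
  proof (cases "u = v")
    case True
    then show ?thesis unfolding D by (intro exI[of _ "{}"]) (auto simp: nonoverlapping_def increment_def)
  next
    case False
    then show ?thesis unfolding D using \<open>u \<le> v\<close>
      by (intro exI[of _ "{(u, v)}"]) (auto simp: nonoverlapping_def increment_def)
  qed
next
  case (Suc n)
  have "D \<noteq> {}" using Suc.hyps(2) by (metis card.empty nat.distinct(1))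
  \<comment> \<open>Removing the rightmost interval \<open>(x, y)\<close> leaves a family inside
    \<open>{u..x}\<close>, to which the induction hypothesis applies; a last gap
    \<open>(y, v)\<close> is present only if \<open>y < v\<close>.\<close>
  define y where "y = Max (snd ` D)"
  have "y \<in> snd ` D" unfolding y_def using Suc.prems(1) \<open>D \<noteq> {}\<close> by (intro Max_in) auto
  then obtain x where xy: "(x, y) \<in> D" by auto
  have ymax: "snd I \<le> y" if "I \<in> D" for I unfolding y_def using Suc.prems(1) that by (intro Max_ge) auto
  define D' where "D' = D - {(x, y)}"
  have D: "D = insert (x, y) D'" and notin: "(x, y) \<notin> D'" unfolding D'_def using xy by auto
  have "x < y" "u \<le> x" "y \<le> v" using Suc.prems(2) bspec[OF Suc.prems(4) xy] xy unfolding nonoverlapping_def by auto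
  have left: "snd I \<le> x" if "I \<in> D'" for I
  proof -
    have "I \<in> D" "I \<noteq> (x, y)" using that unfolding D'_def by auto
    then have "snd I \<le> x \<or> y \<le> fst I" "fst I < snd I"
      using Suc.prems(2) xy unfolding nonoverlapping_def pairwise_def by (metis fst_conv snd_conv)+
    then show ?thesis using ymax[OF \<open>I \<in> D\<close>] by auto
  qed
  have no': "nonoverlapping D'" using Suc.prems(2) unfolding nonoverlapping_def D'_def pairwise_def by auto
  have "\<exists>G. finite G \<and> nonoverlapping G \<and> nonoverlapping (D' \<union> G) \<and> D' \<inter> G = {}
     \<and> (\<forall>I\<in>G. u \<le> fst I \<and> snd I \<le> x)
     \<and> (\<forall>F. F x - F u = increment F D' + increment F G)"
    using Suc.hyps(2) Suc.prems(1,4) no' left \<open>u \<le> x\<close> xy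
    by (intro Suc.hyps(1)) (auto simp: D'_def)
  then obtain G where G: "finite G" "nonoverlapping G" "nonoverlapping (D' \<union> G)" "D' \<inter> G = {}"
     "\<And>I. I \<in> G \<Longrightarrow> u \<le> fst I \<and> snd I \<le> x"
     "\<And>F. F x - F u = increment F D' + increment F G" by blast
  have fin: "finite D'" unfolding D'_def using Suc.prems(1) by auto
  have low: "fst I < snd I" "snd I \<le> x" if "I \<in> D' \<union> G" for I
    using that left[of I] G(3) G(5)[of I] unfolding nonoverlapping_def by auto
  have xyG: "(x, y) \<notin> G" using G(5) \<open>x < y\<close> by fastforce
  have no2: "nonoverlapping (D \<union> G)"
  proof -
    have "nonoverlapping (insert (x, y) (D' \<union> G))"
      unfolding nonoverlapping_def
    proof
      show "\<forall>I\<in>insert (x, y) (D' \<union> G). fst I < snd I"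
        using low(1) \<open>x < y\<close> by auto
      show "pairwise (\<lambda>I J. snd I \<le> fst J \<or> snd J \<le> fst I) (insert (x, y) (D' \<union> G))"
        using G(3) low(2) unfolding nonoverlapping_def pairwise_insert by auto
    qed
    then show ?thesis unfolding D by simp
  qed
  have low': "snd I \<le> y" if "I \<in> D \<union> G" for I
    using that low(2) \<open>x < y\<close> unfolding D by fastforce
  show ?case
  proof (cases "y = v")
    case True
    show ?thesis
      by (rule exI[of _ G])
        (use True G no2 notin fin xyG low' \<open>u \<le> x\<close> in \<open>auto simp: D increment_def algebra_simps\<close>)
  next
    case False
    then have "y < v" using \<open>y \<le> v\<close> by simp
    have yvG: "(y, v) \<notin> D' \<union> G" using low \<open>x < y\<close> \<open>y < v\<close> by fastforce
    have no3: "nonoverlapping (insert (y, v) G)"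
      unfolding nonoverlapping_def
    proof
      show "\<forall>I\<in>insert (y, v) G. fst I < snd I"
        using low(1) \<open>y < v\<close> by auto
      show "pairwise (\<lambda>I J. snd I \<le> fst J \<or> snd J \<le> fst I) (insert (y, v) G)"
        using G(2) low' unfolding nonoverlapping_def pairwise_insert by auto
    qed
    have no4: "nonoverlapping (insert (y, v) (D \<union> G))"
      unfolding nonoverlapping_def
    proof
      show "\<forall>I\<in>insert (y, v) (D \<union> G). fst I < snd I"
        using no2 \<open>y < v\<close> unfolding nonoverlapping_def by auto
      show "pairwise (\<lambda>I J. snd I \<le> fst J \<or> snd J \<le> fst I) (insert (y, v) (D \<union> G))"
        using no2 low' unfolding nonoverlapping_def pairwise_insert by auto
    qed
    have inc: "F v - F u = increment F D + increment F (insert (y, v) G)" for F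
      using G(6)[of F] G(1) fin notin yvG by (simp add: D increment_def algebra_simps)
    show ?thesis
    proof (intro exI[of _ "insert (y, v) G"] conjI allI inc)
      show "nonoverlapping (D \<union> insert (y, v) G)" using no4 by simp
      show "D \<inter> insert (y, v) G = {}"
        using G(4) yvG xyG \<open>x < y\<close> unfolding D by auto
      show "\<forall>I\<in>insert (y, v) G. u \<le> fst I \<and> snd I \<le> v"
        using G(5) \<open>u \<le> x\<close> \<open>x < y\<close> \<open>y < v\<close> by fastforce
    qed (use no3 G(1) in auto)
  qed
qed

section \<open>Almost everywhere differentiability\<close>

text \<open>Vitali's theorem gives countably many disjoint intervals that exhaust \<open>S\<close>
  up to a null set. Continuity of measure from above trades the null set for a remainder below
  \<eta> and the countable family for a finite one, over which increments can be summed.\<close>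

lemma vitali_finite_intervals:
  fixes S U :: "real set"
  assumes S: "S \<in> lmeasurable" and U: "open U" "S \<subseteq> U" and \<eta>: "\<eta> > 0"
    and cover: "\<And>x d. x \<in> S \<Longrightarrow> d > 0 \<Longrightarrow> \<exists>u v. (u, v) \<in> Q \<and> u < x \<and> x < v \<and> v - u < d"
  obtains D where "finite D" "D \<subseteq> Q" "nonoverlapping D" "\<forall>I\<in>D. {fst I..snd I} \<subseteq> U"
    "measure lebesgue (S - (\<Union>I\<in>D. {fst I..snd I})) < \<eta>"
proof -
  \<comment> \<open>Discarding the intervals that leave \<open>U\<close> is harmless, since
    \<open>U\<close> is open and the cover is fine at every point of \<open>S\<close>. Centres and
    radii recast the intervals as the closed balls of the covering theorem.\<close>
  define K where "K = {I \<in> Q. fst I < snd I \<and> {fst I..snd I} \<subseteq> U}"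
  define a :: "real \<times> real \<Rightarrow> real" where "a I = (fst I + snd I) / 2" for I
  define r :: "real \<times> real \<Rightarrow> real" where "r I = (snd I - fst I) / 2" for I
  have ball: "cball (a I) (r I) = {fst I..snd I}" for I
    unfolding a_def r_def cball_eq_atLeastAtMost by (simp add: field_simps)
  have r_pos: "0 < r I" if "I \<in> K" for I using that unfolding K_def r_def by simp
  have "\<exists>I. I \<in> K \<and> x \<in> cball (a I) (r I) \<and> r I < d" if x: "x \<in> S" and d: "0 < d" for x d
  proof -
    obtain e where e: "e > 0" "ball x e \<subseteq> U" using U x open_contains_ball by blast
    obtain u v where uv: "(u, v) \<in> Q" "u < x" "x < v" "v - u < min d e"
      using cover[OF x, of "min d e"] d e by auto
    have "{u..v} \<subseteq> ball x e" using uv by (auto simp: dist_real_def)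
    then have "(u, v) \<in> K" using uv e unfolding K_def by auto
    moreover have "x \<in> cball (a (u, v)) (r (u, v))" unfolding ball using uv by simp
    moreover have "r (u, v) < d" unfolding r_def using uv by simp
    ultimately show ?thesis by blast
  qed
  from Vitali_covering_theorem_cballs[of K r S a, OF r_pos this]
  obtain C where C: "countable C" "C \<subseteq> K"
     "pairwise (\<lambda>i j. disjnt (cball (a i) (r i)) (cball (a j) (r j))) C"
     "negligible (S - (\<Union>i\<in>C. cball (a i) (r i)))"
    by blast
  \<comment> \<open>The members with number below \<open>n\<close> in an enumeration of
    \<open>C\<close>; the uncovered sets \<open>A n\<close> then decrease to the null set.\<close>
  define D where "D n = C \<inter> {I. to_nat_on C I < n}" for n
  have fin: "finite (D n)" for n
  proof -
    have "inj_on (to_nat_on C) (D n)" using C(1) unfolding D_def by (meson inj_on_subset inj_on_to_nat_on Int_lower1)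
    moreover have "to_nat_on C ` D n \<subseteq> {..<n}" unfolding D_def by auto
    ultimately show ?thesis using finite_imageD finite_subset by blast
  qed
  define A where "A n = S - (\<Union>I\<in>D n. {fst I..snd I})" for n
  have A_meas: "A n \<in> lmeasurable" for n
    unfolding A_def using S fin by (intro fmeasurable.Diff fmeasurable.finite_UN) auto
  have "(\<lambda>n. measure lebesgue (A n)) \<longlonglongrightarrow> measure lebesgue (\<Inter>n. A n)"
  proof (rule Lim_measure_decseq)
    show "range A \<subseteq> sets lebesgue" using A_meas by auto
    show "decseq A" unfolding A_def D_def decseq_def by fastforce
    show "emeasure lebesgue (A n) \<noteq> \<infinity>" for n
      using fmeasurableD2[OF A_meas[of n]] by simp
  qed
  moreover have "(\<Inter>n. A n) = S - (\<Union>i\<in>C. cball (a i) (r i))"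
    unfolding A_def D_def ball by auto
  ultimately have "(\<lambda>n. measure lebesgue (A n)) \<longlonglongrightarrow> 0"
    using C(4) negligible_imp_measure0 by metis
  then have "\<forall>\<^sub>F n in sequentially. measure lebesgue (A n) < \<eta>"
    using \<eta> by (rule order_tendstoD)
  then obtain n where n: "measure lebesgue (A n) < \<eta>"
    by (meson eventually_sequentially order_refl)
  show thesis
  proof (rule that[of "D n"])
    show "D n \<subseteq> Q" "\<forall>I\<in>D n. {fst I..snd I} \<subseteq> U"
      using C(2) unfolding D_def K_def by auto
    show "nonoverlapping (D n)"
      unfolding nonoverlapping_def
    proof
      show "\<forall>I\<in>D n. fst I < snd I" using C(2) unfolding D_def K_def by auto
      show "pairwise (\<lambda>I J. snd I \<le> fst J \<or> snd J \<le> fst I) (D n)"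
        unfolding pairwise_def
      proof (intro ballI impI)
        fix I J assume IJ: "I \<in> D n" "J \<in> D n" "I \<noteq> J"
        then have "disjnt {fst I..snd I} {fst J..snd J}" "fst I < snd I" "fst J < snd J"
          using C(2,3) unfolding D_def K_def ball pairwise_def by auto
        then show "snd I \<le> fst J \<or> snd J \<le> fst I"
          unfolding disjnt_def
          by (smt (verit, best) IntI atLeastAtMost_iff empty_iff)
      qed
    qed
  qed (use fin n in \<open>auto simp: A_def\<close>)
qed

text \<open>Two of the intervals share at most endpoints, so their lengths add. The index set is
  arbitrary because tagged intervals will also be used as indices.\<close>

lemma measure_UN_intervals:
  fixes u v :: "'i \<Rightarrow> real"
  assumes "finite I" "\<forall>i\<in>I. u i \<le> v i"
    "\<forall>i\<in>I. \<forall>j\<in>I. i \<noteq> j \<longrightarrow> v i \<le> u j \<or> v j \<le> u i"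
  shows "measure lebesgue (\<Union>i\<in>I. {u i..v i}) = (\<Sum>i\<in>I. v i - u i)"
proof -
  have "measure lebesgue (\<Union>i\<in>I. {u i..v i}) = (\<Sum>i\<in>I. measure lebesgue {u i..v i})"
  proof (rule measure_negligible_finite_Union_image)
    show "pairwise (\<lambda>i j. negligible ({u i..v i} \<inter> {u j..v j})) I"
      unfolding pairwise_def
    proof (intro ballI impI)
      fix i j assume "i \<in> I" "j \<in> I" "i \<noteq> j"
      then have "v i \<le> u j \<or> v j \<le> u i" using assms(3) by blast
      then have "{u i..v i} \<inter> {u j..v j} \<subseteq> {u i, u j}" by auto
      then show "negligible ({u i..v i} \<inter> {u j..v j})"
        by (meson finite.intros negligible_finite negligible_subset)
    qed
  qed (use assms(1) in auto)
  also have "\<dots> = (\<Sum>i\<in>I. v i - u i)"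
    using assms(2) by (intro sum.cong) auto
  finally show ?thesis .
qed

lemma measure_intervals_eq:
  assumes "finite D" "nonoverlapping D"
  shows "measure lebesgue (\<Union>I\<in>D. {fst I..snd I}) = (\<Sum>I\<in>D. snd I - fst I)"
  using assms(2) unfolding nonoverlapping_def pairwise_def
  by (intro measure_UN_intervals[OF assms(1)]) (auto intro: less_imp_le)

text \<open>The points of \<open>{a<..<b}\<close> at which the lower derivate of \<open>f\<close> is (roughly) at most \<open>r\<close>.
  Difference quotients are taken over intervals having the point in their interior, which makes
  this a \<open>G\<^sub>\<delta>\<close> set for every \<open>f\<close>.\<close>
definition low_slope :: "(real \<Rightarrow> real) \<Rightarrow> real \<Rightarrow> real \<Rightarrow> real \<Rightarrow> real set" where
  "low_slope f a b r = {x. \<forall>d>0. \<exists>u v. a \<le> u \<and> u < x \<and> x < v \<and> v \<le> b \<and> v - u < d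
      \<and> f v - f u < r * (v - u)}"

lemma low_slope_subset: "low_slope f a b r \<subseteq> {a<..<b}"
  unfolding low_slope_def by (auto dest!: spec[of _ 1])

lemma low_slope_borel: "low_slope f a b r \<in> sets borel"
proof -
  let ?A = "\<lambda>n::nat. \<Union>(u, v)\<in>{(u, v). a \<le> u \<and> v \<le> b \<and> v - u < inverse (Suc n) \<and> f v - f u < r * (v - u)}. {u<..<v}"
  have "low_slope f a b r = (\<Inter>n. ?A n)"
  proof (intro equalityI subsetI)
    fix x assume "x \<in> low_slope f a b r"
    then have "\<exists>u v. a \<le> u \<and> u < x \<and> x < v \<and> v \<le> b \<and> v - u < inverse (real (Suc n))
      \<and> f v - f u < r * (v - u)" for n
      unfolding low_slope_def by auto
    then show "x \<in> (\<Inter>n. ?A n)" by fastforce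
  next
    fix x assume x: "x \<in> (\<Inter>n. ?A n)"
    show "x \<in> low_slope f a b r"
      unfolding low_slope_def
    proof (intro CollectI allI impI)
      fix d :: real assume "d > 0"
      then obtain n where n: "inverse (real (Suc n)) < d" using reals_Archimedean by blast
      have "x \<in> ?A n" using x by blast
      then show "\<exists>u v. a \<le> u \<and> u < x \<and> x < v \<and> v \<le> b \<and> v - u < d \<and> f v - f u < r * (v - u)"
        using n by fastforce
    qed
  qed
  moreover have "open (?A n)" for n by auto
  ultimately show ?thesis by (auto intro!: sets.countable_INT borel_open)
qed

lemma low_slope_lmeasurable: "low_slope f a b r \<in> lmeasurable"
proof (rule bounded_set_imp_lmeasurable)
  show "bounded (low_slope f a b r)"
    using low_slope_subset by (rule bounded_subset[rotated]) simp
  show "low_slope f a b r \<in> sets lebesgue" using low_slope_borel by simp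
qed

lemma low_slope_cover:
  assumes "x \<in> low_slope f a b r" "d > 0"
  shows "\<exists>u v. (u, v) \<in> {(u, v). a \<le> u \<and> v \<le> b \<and> f v - f u < r * (v - u)} \<and> u < x \<and> x < v \<and> v - u < d"
  using assms unfolding low_slope_def by fast

lemma measure_le_intervals:
  assumes "S \<in> lmeasurable" "finite D" "nonoverlapping D"
    and "measure lebesgue (S - (\<Union>I\<in>D. {fst I..snd I})) < \<eta>"
  shows "measure lebesgue S < (\<Sum>I\<in>D. snd I - fst I) + \<eta>"
proof -
  let ?D = "\<Union>I\<in>D. {fst I..snd I}"
  have D: "?D \<in> lmeasurable" using assms(2) by (intro fmeasurable.finite_UN) auto
  have "measure lebesgue S \<le> measure lebesgue (?D \<union> (S - ?D))"
    using assms(1) D by (intro measure_mono_fmeasurable) (auto intro: fmeasurable.Un fmeasurable.Diff)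
  also have "\<dots> \<le> measure lebesgue ?D + measure lebesgue (S - ?D)"
    using assms(1) D by (intro measure_Un_le) auto
  finally show ?thesis using assms measure_intervals_eq[of D] by simp
qed

lemma AC_intervals:
  assumes "abs_continuous_on {a..b} f" "\<epsilon> > 0"
  obtains \<delta> where "\<delta> > 0" "\<forall>D. finite D \<longrightarrow> nonoverlapping D \<longrightarrow> (\<forall>I\<in>D. a \<le> fst I \<and> snd I \<le> b) \<longrightarrow>
      (\<Sum>I\<in>D. snd I - fst I) < \<delta> \<longrightarrow> \<bar>increment f D\<bar> < \<epsilon>"
proof -
  obtain \<delta> where \<delta>: "\<delta> > 0" and ac: "\<forall>(D::(real \<times> real) set) u v. finite D \<longrightarrow> (\<forall>i\<in>D. u i \<le> v i \<and> {u i..v i} \<subseteq> {a..b}) \<longrightarrow>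
       (\<forall>i\<in>D. \<forall>j\<in>D. i \<noteq> j \<longrightarrow> v i \<le> u j \<or> v j \<le> u i) \<longrightarrow>
       (\<Sum>i\<in>D. v i - u i) < \<delta> \<longrightarrow> (\<Sum>i\<in>D. \<bar>f (v i) - f (u i)\<bar>) < \<epsilon>"
    by (rule abs_continuous_onE[OF assms]) (rule that)
  show thesis
  proof (rule that[OF \<delta>], intro allI impI)
    fix D assume D: "finite D" "nonoverlapping D" "\<forall>I\<in>D. a \<le> fst I \<and> snd I \<le> b"
      "(\<Sum>I\<in>D. snd I - fst I) < \<delta>"
    have "(\<Sum>I\<in>D. \<bar>f (snd I) - f (fst I)\<bar>) < \<epsilon>"
    proof (rule ac[rule_format, of D fst snd])
      show "fst I \<le> snd I \<and> {fst I..snd I} \<subseteq> {a..b}" if "I \<in> D" for I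
        using that D(2,3) unfolding nonoverlapping_def by fastforce
      show "snd I \<le> fst J \<or> snd J \<le> fst I" if "I \<in> D" "J \<in> D" "I \<noteq> J" for I J
        using that D(2) unfolding nonoverlapping_def pairwise_def by blast
    qed (use D in auto)
    then show "\<bar>increment f D\<bar> < \<epsilon>"
      unfolding increment_def using sum_abs[of "\<lambda>I. f (snd I) - f (fst I)" D] by linarith
  qed
qed

text \<open>Suppose the set has measure \<open>m > 0\<close>. Intervals of slope below
  \<open>r\<close> nearly cover it, and intervals of slope above \<open>s\<close> inside these
  nearly cover it again; the second kind enters through \<open>- f\<close> and \<open>- s\<close>.
  Both families have total length close to \<open>m\<close>, and their increments differ only by
  those over short gaps, so nearly \<open>s * m \<le> r * m\<close>, against
  \<open>r < s\<close>.\<close>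

lemma AC_slope_gap_null:
  assumes ac: "abs_continuous_on {a..b} f" and "r < s"
  shows "measure lebesgue (low_slope f a b r \<inter> low_slope (\<lambda>x. - f x) a b (- s)) = 0"
proof (rule ccontr)
  define S where "S = low_slope f a b r \<inter> low_slope (\<lambda>x. - f x) a b (- s)"
  define m where "m = measure lebesgue S"
  assume "measure lebesgue (low_slope f a b r \<inter> low_slope (\<lambda>x. - f x) a b (- s)) \<noteq> 0"
  then have m: "m > 0" unfolding m_def S_def using zero_less_measure_iff by blast
  have S: "S \<in> lmeasurable" unfolding S_def by (intro fmeasurable.Int low_slope_lmeasurable)
  have Sab: "S \<subseteq> {a<..<b}" unfolding S_def using low_slope_subset by blast
  have "a \<le> b" using m Sab unfolding m_def by (cases "a \<le> b") auto
  define \<epsilon> where "\<epsilon> = (s - r) * m / 4"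
  have \<epsilon>: "\<epsilon> > 0" unfolding \<epsilon>_def using m assms by simp
  obtain \<delta> where \<delta>: "\<delta> > 0" and incr: "\<forall>D. finite D \<longrightarrow> nonoverlapping D \<longrightarrow> (\<forall>I\<in>D. a \<le> fst I \<and> snd I \<le> b) \<longrightarrow>
      (\<Sum>I\<in>D. snd I - fst I) < \<delta> \<longrightarrow> \<bar>increment f D\<bar> < \<epsilon>"
    by (rule AC_intervals[OF ac \<epsilon>]) (rule that)
  \<comment> \<open>\<open>D1\<close> will have length below \<open>m + \<eta>\<close> and
    \<open>D2\<close> above \<open>m - 2 * \<eta>\<close>, so what lies between has length below
    \<open>3 * \<eta>\<close>. The three bounds make this less than \<delta>, keep \<open>D2\<close>
    above \<open>3 / 4 * m\<close>, and keep the loss \<open>\<bar>r\<bar> * (3 * \<eta>)\<close> at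
    most \<open>3 / 16 * (s - r) * m\<close>.\<close>
  define \<eta> where "\<eta> = min (\<delta> / 4) (min (m / 8) ((s - r) * m / (16 * (\<bar>r\<bar> + 1))))"
  have \<eta>: "\<eta> > 0" unfolding \<eta>_def using \<delta> m assms by simp
  have \<eta>1: "\<eta> \<le> \<delta> / 4" and \<eta>2: "\<eta> \<le> m / 8" and \<eta>3': "\<eta> \<le> (s - r) * m / (16 * (\<bar>r\<bar> + 1))"
    unfolding \<eta>_def by (simp_all only: min.cobounded1 min.coboundedI2 min.cobounded2)
  have \<eta>3: "\<eta> * (16 * (\<bar>r\<bar> + 1)) \<le> (s - r) * m"
    using \<eta>3' by (simp add: pos_le_divide_eq)
  obtain U0 where U0: "open U0" "S \<subseteq> U0" "U0 - S \<in> lmeasurable" "measure lebesgue (U0 - S) < \<eta>"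
  proof -
    obtain T where T: "open T" "S \<subseteq> T" "T - S \<in> lmeasurable" "emeasure lebesgue (T - S) < ennreal \<eta>"
      using sets_lebesgue_outer_open[OF fmeasurableD[OF S] \<eta>] by blast
    then have "measure lebesgue (T - S) < \<eta>"
      using \<eta> by (simp add: emeasure_eq_measure2 ennreal_less_iff)
    then show ?thesis using that T by blast
  qed
  define U where "U = U0 \<inter> {a<..<b}"
  have U: "open U" "S \<subseteq> U" unfolding U_def using U0 Sab by auto
  define Q1 where "Q1 = {(u, v). a \<le> u \<and> v \<le> b \<and> f v - f u < r * (v - u)}"
  obtain D1 where D1: "finite D1" "D1 \<subseteq> Q1" "nonoverlapping D1" "\<forall>I\<in>D1. {fst I..snd I} \<subseteq> U"
    "measure lebesgue (S - (\<Union>I\<in>D1. {fst I..snd I})) < \<eta>"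
  proof -
    have "\<exists>u v. (u, v) \<in> Q1 \<and> u < x \<and> x < v \<and> v - u < d" if "x \<in> S" "d > 0" for x d
      using low_slope_cover[of x f a b r d] that unfolding Q1_def S_def by blast
    from vitali_finite_intervals[OF S U \<eta> this] show ?thesis using that by blast
  qed
  \<comment> \<open>Open interiors, because the second covering must be confined to an open set;
    only the finitely many endpoints of \<open>D1\<close> are lost, a null set.\<close>
  define V where "V = (\<Union>I\<in>D1. {fst I<..<snd I})"
  define S1 where "S1 = S \<inter> V"
  have V: "open V" unfolding V_def by auto
  have S1: "S1 \<in> lmeasurable" unfolding S1_def
    using S V by (intro fmeasurable_Int_fmeasurable) auto
  define Q2 where "Q2 = {(u, v). a \<le> u \<and> v \<le> b \<and> - f v - (- f u) < (- s) * (v - u)}"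
  obtain D2 where D2: "finite D2" "D2 \<subseteq> Q2" "nonoverlapping D2" "\<forall>I\<in>D2. {fst I..snd I} \<subseteq> V"
    "measure lebesgue (S1 - (\<Union>I\<in>D2. {fst I..snd I})) < \<eta>"
  proof -
    have "\<exists>u v. (u, v) \<in> Q2 \<and> u < x \<and> x < v \<and> v - u < d" if "x \<in> S1" "d > 0" for x d
      using low_slope_cover[of x "\<lambda>x. - f x" a b "- s" d] that unfolding Q2_def S1_def S_def by blast
    moreover have "S1 \<subseteq> V" unfolding S1_def by blast
    ultimately show ?thesis using vitali_finite_intervals[OF S1 V _ \<eta>, of Q2] that by blast
  qed
  let ?l1 = "\<Sum>I\<in>D1. snd I - fst I" and ?l2 = "\<Sum>I\<in>D2. snd I - fst I"
  have U0_meas: "U0 \<in> lmeasurable"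
    using fmeasurable.Un[OF S U0(3)] U0(2) by (simp add: Un_absorb1)
  have l1: "?l1 < m + \<eta>"
  proof -
    have "?l1 = measure lebesgue (\<Union>I\<in>D1. {fst I..snd I})"
      using measure_intervals_eq D1 by simp
    also have "\<dots> \<le> measure lebesgue (S \<union> (U0 - S))"
      using D1(1,4) S U0 unfolding U_def by (intro measure_mono_fmeasurable) (use U0_meas in \<open>auto simp: Un_absorb1\<close>)
    also have "\<dots> \<le> m + measure lebesgue (U0 - S)"
      unfolding m_def using S U0 by (intro measure_Un_le) auto
    finally show ?thesis using U0 by simp
  qed
  have l2: "m < ?l2 + 2 * \<eta>"
  proof -
    have "m = measure lebesgue ((S \<inter> (\<Union>I\<in>D1. {fst I..snd I})) \<union> (S - (\<Union>I\<in>D1. {fst I..snd I})))"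
      unfolding m_def by (rule arg_cong[where f="measure lebesgue"]) auto
    also have "\<dots> \<le> measure lebesgue (S \<inter> (\<Union>I\<in>D1. {fst I..snd I})) + measure lebesgue (S - (\<Union>I\<in>D1. {fst I..snd I}))"
      using S D1(1) by (intro measure_Un_le sets.Int sets.Diff sets.finite_UN fmeasurableD[OF S]) auto
    also have "measure lebesgue (S \<inter> (\<Union>I\<in>D1. {fst I..snd I})) = measure lebesgue S1"
    proof (rule measure_negligible_symdiff)
      have "negligible (\<Union>I\<in>D1. {fst I, snd I})" using D1(1) by (intro negligible_finite) auto
      moreover have "S1 - S \<inter> (\<Union>I\<in>D1. {fst I..snd I}) \<union> (S \<inter> (\<Union>I\<in>D1. {fst I..snd I}) - S1)
          \<subseteq> (\<Union>I\<in>D1. {fst I, snd I})"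
      proof
        fix x assume "x \<in> S1 - S \<inter> (\<Union>I\<in>D1. {fst I..snd I}) \<union> (S \<inter> (\<Union>I\<in>D1. {fst I..snd I}) - S1)"
        then obtain I where I: "I \<in> D1" "x \<in> {fst I..snd I}" "x \<notin> {fst I<..<snd I}"
          unfolding S1_def V_def by fastforce
        then have "x = fst I \<or> x = snd I" by auto
        then show "x \<in> (\<Union>I\<in>D1. {fst I, snd I})" using I(1) by blast
      qed
      ultimately show "negligible (S1 - S \<inter> (\<Union>I\<in>D1. {fst I..snd I}) \<union> (S \<inter> (\<Union>I\<in>D1. {fst I..snd I}) - S1))"
        by (rule negligible_subset)
    qed (rule S1)
    finally show ?thesis using D1(5) measure_le_intervals[OF S1 D2(1,3,5)] by linarith
  qed
  obtain G1 where G1: "finite G1" "nonoverlapping G1" "nonoverlapping (D1 \<union> G1)" "D1 \<inter> G1 = {}"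
     "\<forall>I\<in>G1. a \<le> fst I \<and> snd I \<le> b" "\<And>F. F b - F a = increment F D1 + increment F G1"
  proof -
    have "\<forall>I\<in>D1. a \<le> fst I \<and> snd I \<le> b"
      using D1(2) unfolding Q1_def by auto
    from exists_gaps[OF D1(1,3) \<open>a \<le> b\<close> this] show ?thesis using that by metis
  qed
  \<comment> \<open>A closed interval inside \<open>V\<close> lies within a single interval of
    \<open>D1\<close>: if it reached the right end of that one, this end would lie in the interior
    of a second interval of \<open>D1\<close>.\<close>
  have D2in: "\<exists>J\<in>D1. fst J < fst I \<and> snd I < snd J" if I: "I \<in> D2" for I
  proof -
    have lt: "fst I < snd I" using D2(3) I unfolding nonoverlapping_def by blast
    then have "fst I \<in> V" using bspec[OF D2(4) I] by auto
    then obtain J where J: "J \<in> D1" "fst J < fst I" "fst I < snd J" unfolding V_def by auto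
    have "snd I < snd J"
    proof (rule ccontr)
      assume "\<not> snd I < snd J"
      then have "snd J \<in> V" using bspec[OF D2(4) I] J by auto
      then obtain J' where J': "J' \<in> D1" "fst J' < snd J" "snd J < snd J'" unfolding V_def by auto
      then have "snd J \<le> fst J' \<or> snd J' \<le> fst J"
        using D1(3) J(1) unfolding nonoverlapping_def pairwise_def by (metis less_irrefl)
      then show False using J J' by linarith
    qed
    then show ?thesis using J by blast
  qed
  have D2ab: "a \<le> fst I \<and> snd I \<le> b" if "I \<in> D2" for I using D2(2) that unfolding Q2_def by auto
  have no21: "nonoverlapping (D2 \<union> G1)" and dis21: "D2 \<inter> G1 = {}"
  proof -
    have sep: "snd I < fst K \<or> snd K < fst I" if I: "I \<in> D2" and K: "K \<in> G1" for I K
    proof -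
      obtain J where J: "J \<in> D1" "fst J < fst I" "snd I < snd J" using D2in[OF I] by blast
      have "J \<noteq> K" using J(1) K G1(4) by blast
      then have "snd J \<le> fst K \<or> snd K \<le> fst J"
        using G1(3) J(1) K unfolding nonoverlapping_def pairwise_def by blast
      then show ?thesis using J by linarith
    qed
    show "nonoverlapping (D2 \<union> G1)"
      using D2(3) G1(2) sep unfolding nonoverlapping_def pairwise_def
      by (metis Un_iff less_imp_le)
    show "D2 \<inter> G1 = {}"
      using sep D2(3) unfolding nonoverlapping_def by fastforce
  qed
  \<comment> \<open>Complementing twice: the gaps of \<open>D2 \<union> G1\<close> are the parts of
    \<open>D1\<close> outside \<open>D2\<close>, so no interval of \<open>D1\<close> has to be
    decomposed on its own.\<close>
  obtain G2 where G2: "finite G2" "nonoverlapping G2"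
     "\<forall>I\<in>G2. a \<le> fst I \<and> snd I \<le> b" "\<And>F. F b - F a = increment F (D2 \<union> G1) + increment F G2"
  proof -
    have "finite (D2 \<union> G1)" using D2(1) G1(1) by simp
    moreover have "\<forall>I\<in>D2 \<union> G1. a \<le> fst I \<and> snd I \<le> b"
      using D2ab G1(5) by blast
    ultimately show ?thesis
      using exists_gaps[OF _ no21 \<open>a \<le> b\<close>] that by metis
  qed
  have key: "increment F D1 = increment F D2 + increment F G2" for F
  proof -
    have "increment F (D2 \<union> G1) = increment F D2 + increment F G1"
      unfolding increment_def using D2(1) G1(1) dis21 by (rule sum.union_disjoint)
    then show ?thesis using G1(6)[of F] G2(4)[of F] by simp
  qed
  have lens: "?l1 = ?l2 + (\<Sum>I\<in>G2. snd I - fst I)"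
    using key[of "\<lambda>x. x"] unfolding increment_def by simp
  have "\<bar>increment f G2\<bar> < \<epsilon>"
    using incr[rule_format, OF G2(1,2)] G2(3) lens l1 l2 \<eta>1 \<eta> by auto
  moreover have "increment f D1 \<le> r * ?l1"
    unfolding increment_def sum_distrib_left using D1(2) by (intro sum_mono) (auto simp: Q1_def)
  moreover have "s * ?l2 \<le> increment f D2"
    unfolding increment_def sum_distrib_left using D2(2) by (intro sum_mono) (auto simp: Q2_def)
  ultimately have "s * ?l2 - \<epsilon> < r * ?l1" using key[of f] by linarith
  then have "(s - r) * ?l2 < r * (?l1 - ?l2) + \<epsilon>" by (simp add: algebra_simps)
  also have "r * (?l1 - ?l2) \<le> \<bar>r\<bar> * (3 * \<eta>)"
  proof -
    have "0 \<le> ?l1 - ?l2" using lens G2(2) unfolding nonoverlapping_def by (simp add: sum_nonneg less_imp_le)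
    then have "r * (?l1 - ?l2) \<le> \<bar>r\<bar> * (?l1 - ?l2)" by (intro mult_right_mono) auto
    also have "\<dots> \<le> \<bar>r\<bar> * (3 * \<eta>)" using l1 l2 by (intro mult_left_mono) auto
    finally show ?thesis .
  qed
  finally have "(s - r) * ?l2 < \<bar>r\<bar> * (3 * \<eta>) + \<epsilon>" by simp
  moreover have "(s - r) * m * (3 / 4) \<le> (s - r) * ?l2"
    unfolding mult.assoc using l2 \<eta>2 assms by (intro mult_left_mono) auto
  moreover have "\<bar>r\<bar> * (3 * \<eta>) \<le> (s - r) * m * 3 / 16"
    using \<eta>3 \<eta> by (simp add: algebra_simps)
  \<comment> \<open>In units of \<open>(s - r) * m\<close> the quantity \<open>(s - r) * ?l2\<close>
    is at least \<open>3 / 4\<close>, but below \<open>3 / 16 + 1 / 4\<close>.\<close>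
  moreover have "(s - r) * m > 0" using assms m by simp
  ultimately show False unfolding \<epsilon>_def by linarith
qed

text \<open>In a window shorter than \<delta> every finite family of separated intervals has total
  length below \<delta>, so its increment stays below 1 in absolute value, while slopes below
  \<open>- n\<close> on a set of positive measure make it arbitrarily negative. Countably many
  windows cover the line.\<close>

lemma AC_infinite_slope_null:
  assumes ac: "abs_continuous_on {a..b} f"
  shows "negligible (\<Inter>n::nat. low_slope f a b (- real n))"
proof -
  define S where "S = (\<Inter>n::nat. low_slope f a b (- real n))"
  have S: "S \<in> sets lebesgue"
    unfolding S_def using low_slope_borel by (intro sets.countable_INT) auto
  obtain \<delta> where \<delta>: "\<delta> > 0" and incr: "\<forall>D. finite D \<longrightarrow> nonoverlapping D \<longrightarrow> (\<forall>I\<in>D. a \<le> fst I \<and> snd I \<le> b) \<longrightarrow>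
      (\<Sum>I\<in>D. snd I - fst I) < \<delta> \<longrightarrow> \<bar>increment f D\<bar> < 1"
    by (rule AC_intervals[OF ac zero_less_one]) (rule that)
  have null: "negligible (S \<inter> {c<..<c + \<delta> / 2})" for c
  proof -
    define T where "T = S \<inter> {c<..<c + \<delta> / 2}"
    have T: "T \<in> lmeasurable"
    proof (rule bounded_set_imp_lmeasurable)
      show "bounded T" unfolding T_def by (rule bounded_subset[of "{c<..<c + \<delta> / 2}"]) auto
      show "T \<in> sets lebesgue" unfolding T_def using S by auto
    qed
    have "measure lebesgue T = 0"
    proof (rule ccontr)
      define m where "m = measure lebesgue T"
      assume "measure lebesgue T \<noteq> 0"
      then have m: "m > 0" unfolding m_def using zero_less_measure_iff by blast
      \<comment> \<open>The cover will have length above \<open>m / 2\<close>, so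
        \<open>real n * (m / 2) > 1\<close> already violates the bound 1 on the increment.\<close>
      obtain n :: nat where n: "2 / m < real n" using reals_Archimedean2 by blast
      define Q where "Q = {(u, v). a \<le> u \<and> v \<le> b \<and> f v - f u < (- real n) * (v - u)}"
      have cov: "\<exists>u v. (u, v) \<in> Q \<and> u < x \<and> x < v \<and> v - u < d" if "x \<in> T" "d > 0" for x d
        using low_slope_cover[of x f a b "- real n" d] that unfolding T_def S_def Q_def by blast
      have TU: "T \<subseteq> {c<..<c + \<delta> / 2}" unfolding T_def by blast
      obtain D where D: "finite D" "D \<subseteq> Q" "nonoverlapping D" "\<forall>I\<in>D. {fst I..snd I} \<subseteq> {c<..<c + \<delta> / 2}"
          "measure lebesgue (T - (\<Union>I\<in>D. {fst I..snd I})) < m / 2"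
        by (rule vitali_finite_intervals[OF T open_greaterThanLessThan TU half_gt_zero[OF m] cov]) (assumption | rule that)+
      let ?l = "\<Sum>I\<in>D. snd I - fst I"
      have "?l = measure lebesgue (\<Union>I\<in>D. {fst I..snd I})"
        using measure_intervals_eq D by simp
      also have "\<dots> \<le> measure lebesgue {c<..<c + \<delta> / 2}"
      proof (rule measure_mono_fmeasurable)
        show "(\<Union>I\<in>D. {fst I..snd I}) \<subseteq> {c<..<c + \<delta> / 2}" using D(4) by blast
        show "(\<Union>I\<in>D. {fst I..snd I}) \<in> sets lebesgue" using D(1) by (intro sets.finite_UN) auto
      qed auto
      finally have "?l < \<delta>" using \<delta> by simp
      then have "\<bar>increment f D\<bar> < 1" using incr D(1-3) unfolding Q_def by fastforce
      moreover have "increment f D \<le> (- real n) * ?l"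
        unfolding increment_def sum_distrib_left using D(2) by (intro sum_mono) (auto simp: Q_def)
      ultimately have "real n * ?l < 1" by simp
      moreover have "m / 2 < ?l" using measure_le_intervals[OF T D(1,3,5)] unfolding m_def by simp
      then have "real n * (m / 2) \<le> real n * ?l" by (intro mult_left_mono) auto
      moreover have "1 < real n * (m / 2)" using n m by (simp add: field_simps)
      ultimately show False by linarith
    qed
    then show ?thesis unfolding T_def[symmetric] using T by (simp add: negligible_iff_measure)
  qed
  have "S \<subseteq> (\<Union>k::int. S \<inter> {k * (\<delta> / 4)<..<k * (\<delta> / 4) + \<delta> / 2})"
  proof
    fix x assume "x \<in> S"
    \<comment> \<open>Windows of length \<open>\<delta> / 2\<close> start at the multiples of
      \<open>\<delta> / 4\<close>, so they overlap; the ceiling minus 1 puts \<open>x\<close>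
      strictly to the right of the left end even when \<open>x\<close> is such a multiple.\<close>
    define k where "k = \<lceil>x / (\<delta> / 4)\<rceil> - 1"
    have "real_of_int k < x / (\<delta> / 4)" "x / (\<delta> / 4) \<le> real_of_int k + 1" unfolding k_def by linarith+
    then have "k * (\<delta> / 4) < x" "x \<le> (real_of_int k + 1) * (\<delta> / 4)"
      using \<delta> by (simp_all add: field_simps)
    then have "x \<in> {k * (\<delta> / 4)<..<k * (\<delta> / 4) + \<delta> / 2}" using \<delta> by (simp add: algebra_simps)
    then show "x \<in> (\<Union>k::int. S \<inter> {k * (\<delta> / 4)<..<k * (\<delta> / 4) + \<delta> / 2})" using \<open>x \<in> S\<close> by blast
  qed
  moreover have "negligible (\<Union>k::int. S \<inter> {k * (\<delta> / 4)<..<k * (\<delta> / 4) + \<delta> / 2})"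
    by (rule negligible_countable_Union) (use null in auto)
  ultimately show ?thesis unfolding S_def using negligible_subset by blast
qed

text \<open>For continuous \<open>f\<close> this is exactly the set of points of
  \<open>{a<..<b}\<close> without a finite derivative. Exactness matters as much as being null and
  Borel, because it tells where \<open>vector_derivative\<close> takes its default value. Rational
  slopes keep the union countable.\<close>

definition nondiff :: "(real \<Rightarrow> real) \<Rightarrow> real \<Rightarrow> real \<Rightarrow> real set" where
  "nondiff f a b = (\<Union>(r, s)\<in>{(r, s). r \<in> \<rat> \<and> s \<in> \<rat> \<and> r < s}. low_slope f a b r \<inter> low_slope (\<lambda>x. - f x) a b (- s))
     \<union> (\<Inter>n::nat. low_slope f a b (- real n)) \<union> (\<Inter>n::nat. low_slope (\<lambda>x. - f x) a b (- real n))"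

lemma countable_rat_pairs: "countable {(r, s::real). r \<in> \<rat> \<and> s \<in> \<rat> \<and> r < s}"
  by (rule countable_subset[of _ "\<rat> \<times> \<rat>"]) (auto intro: countable_rat)

lemma nondiff_borel: "nondiff f a b \<in> sets borel"
  unfolding nondiff_def using low_slope_borel countable_rat_pairs
  by (intro sets.Un sets.countable_UN'' sets.countable_INT) (auto intro!: sets.Int)

lemma AC_negligible_nondiff:
  assumes ac: "abs_continuous_on {a..b} f"
  shows "negligible (nondiff f a b)"
proof -
  have ac': "abs_continuous_on {a..b} (\<lambda>x. - f x)"
    using abs_continuous_on_lincomb[OF ac ac, of "-1" 0] by simp
  have "negligible (\<Union>(r, s)\<in>{(r, s). r \<in> \<rat> \<and> s \<in> \<rat> \<and> r < s}. low_slope f a b r \<inter> low_slope (\<lambda>x. - f x) a b (- s))"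
    using AC_slope_gap_null[OF ac] countable_rat_pairs
    by (intro negligible_countable_Union)
      (auto simp: negligible_iff_measure intro!: fmeasurable.Int low_slope_lmeasurable)
  then show ?thesis
    unfolding nondiff_def using AC_infinite_slope_null[OF ac] AC_infinite_slope_null[OF ac'] by simp
qed

text \<open>\<open>low_slope\<close> only speaks of intervals with \<open>x\<close> in their
  interior. Difference quotients at \<open>x\<close> itself are limits of the slopes over such
  intervals as one endpoint tends to \<open>x\<close>, which is where continuity enters.\<close>

lemma not_low_slope_eventually:
  assumes cont: "continuous_on {a..b} f" and x: "x \<in> {a<..<b}" "x \<notin> low_slope f a b r"
  shows "\<forall>\<^sub>F y in at x. r \<le> (f y - f x) / (y - x)"
proof -
  obtain d0 where d0: "d0 > 0" "\<And>u v. \<lbrakk>a \<le> u; u < x; x < v; v \<le> b; v - u < d0\<rbrakk> \<Longrightarrow> r * (v - u) \<le> f v - f u"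
    using x(2) unfolding low_slope_def by (auto simp: not_less) (metis not_less)
  \<comment> \<open>Half of \<open>d0\<close>, since \<open>y\<close> and the moving endpoint lie on
    opposite sides of \<open>x\<close>, each within \<open>d\<close>; the other two bounds keep both
    in \<open>{a..b}\<close>.\<close>
  define d where "d = min (d0 / 2) (min (x - a) (b - x))"
  have d: "d > 0" "d \<le> d0 / 2" "d \<le> x - a" "d \<le> b - x"
    using d0(1) x(1) unfolding d_def by (auto simp only: min.cobounded1 min.coboundedI2 min.cobounded2) auto
  have cx: "(f \<longlongrightarrow> f x) (at x)"
    using cont x(1) by (metis continuous_on_interior interior_atLeastAtMost_real isContD)
  have "r \<le> (f y - f x) / (y - x)" if y: "y \<noteq> x" "dist y x < d" for y
  proof (cases "x < y")
    case True
    have "((\<lambda>u. f y - f u - r * (y - u)) \<longlongrightarrow> f y - f x - r * (y - x)) (at_left x)"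
      by (intro tendsto_intros tendsto_within_subset[OF cx]) auto
    moreover have "\<forall>\<^sub>F u in at_left x. 0 \<le> f y - f u - r * (y - u)"
    proof (rule eventually_mono[OF eventually_at_left_real[of "x - d" x]])
      show "x - d < x" using d(1) by simp
      fix u assume "u \<in> {x - d<..<x}"
      then show "0 \<le> f y - f u - r * (y - u)" using d0(2)[of u y] d y True by (auto simp: dist_real_def)
    qed
    ultimately have "0 \<le> f y - f x - r * (y - x)" by (rule tendsto_lowerbound) auto
    then show ?thesis using True by (simp add: field_simps)
  next
    case False
    then have "y < x" using y by simp
    have "((\<lambda>v. f v - f y - r * (v - y)) \<longlongrightarrow> f x - f y - r * (x - y)) (at_right x)"
      by (intro tendsto_intros tendsto_within_subset[OF cx]) auto
    moreover have "\<forall>\<^sub>F v in at_right x. 0 \<le> f v - f y - r * (v - y)"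
    proof (rule eventually_mono[OF eventually_at_right_real[of x "x + d"]])
      show "x < x + d" using d(1) by simp
      fix v assume "v \<in> {x<..<x + d}"
      then show "0 \<le> f v - f y - r * (v - y)" using d0(2)[of y v] d y \<open>y < x\<close> by (auto simp: dist_real_def)
    qed
    ultimately have "0 \<le> f x - f y - r * (x - y)" by (rule tendsto_lowerbound) auto
    then have "r * (x - y) \<le> f x - f y" by simp
    then have "r \<le> (f x - f y) / (x - y)" using \<open>y < x\<close> by (simp add: field_simps)
    also have "\<dots> = (f y - f x) / (y - x)" using \<open>y < x\<close> by (simp add: field_simps)
    finally show ?thesis .
  qed
  then show ?thesis unfolding eventually_at using d(1) by blast
qed

lemma has_derivative_off_nondiff:
  assumes cont: "continuous_on {a..b} f" and x: "x \<in> {a<..<b}" "x \<notin> nondiff f a b"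
  shows "\<exists>L. (f has_real_derivative L) (at x)"
proof -
  have cont': "continuous_on {a..b} (\<lambda>x. - f x)" using cont by (intro continuous_intros)
  have up: "\<forall>\<^sub>F y in at x. (f y - f x) / (y - x) \<le> s" if "x \<notin> low_slope (\<lambda>x. - f x) a b (- s)" for s
    using not_low_slope_eventually[OF cont' x(1) that]
  proof (rule eventually_mono)
    fix y assume "- s \<le> (- f y - - f x) / (y - x)"
    also have "- f y - - f x = - (f y - f x)" by simp
    finally have "- s \<le> - ((f y - f x) / (y - x))" unfolding minus_divide_left .
    then show "(f y - f x) / (y - x) \<le> s" by simp
  qed
  \<comment> \<open>Each slope in \<open>R\<close> is eventually a lower bound of the difference
    quotients at \<open>x\<close>. Excluding infinite derivates makes \<open>R\<close> nonempty and
    bounded above, and \<open>Sup R\<close> turns out to be the derivative.\<close>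
  define R where "R = {r. x \<notin> low_slope f a b r}"
  have "x \<notin> (\<Inter>n::nat. low_slope f a b (- real n))" "x \<notin> (\<Inter>n::nat. low_slope (\<lambda>x. - f x) a b (- real n))"
    using x(2) unfolding nondiff_def Un_iff de_Morgan_disj by auto
  then obtain n M :: nat where n: "x \<notin> low_slope f a b (- real n)" and M: "x \<notin> low_slope (\<lambda>x. - f x) a b (- real M)"
    unfolding INT_iff by auto
  have ne: "R \<noteq> {}" using n unfolding R_def by blast
  have bdd: "bdd_above R"
  proof
    fix r assume "r \<in> R"
    then have "\<forall>\<^sub>F y in at x. r \<le> (f y - f x) / (y - x)"
      using not_low_slope_eventually[OF cont x(1), of r] unfolding R_def by blast
    from eventually_conj[OF this up[OF M]] have "\<forall>\<^sub>F y in at x. r \<le> real M"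
      by (rule eventually_mono) linarith
    then show "r \<le> real M" by simp
  qed
  have "((\<lambda>y. (f y - f x) / (y - x)) \<longlongrightarrow> Sup R) (at x)"
  proof (rule order_tendstoI)
    fix l assume "l < Sup R"
    then obtain r where "r \<in> R" "l < r" using less_cSup_iff[OF ne bdd] by blast
    then show "\<forall>\<^sub>F y in at x. l < (f y - f x) / (y - x)"
      using not_low_slope_eventually[OF cont x(1), of r] unfolding R_def
      by (auto elim: eventually_mono)
  next
    fix l assume "Sup R < l"
    \<comment> \<open>Two rationals fit between \<open>Sup R\<close> and \<open>l\<close>. As
      \<open>r \<notin> R\<close>, the pair \<open>(r, s)\<close> and
      \<open>x \<notin> nondiff f a b\<close> exclude \<open>x\<close> from the set for
      \<open>- f\<close> and \<open>- s\<close>, so the quotients are eventually at most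
      \<open>s < l\<close>.\<close>
    then obtain r where r: "r \<in> \<rat>" "Sup R < r" "r < l" using Rats_dense_in_real by blast
    then obtain s where s: "s \<in> \<rat>" "r < s" "s < l" using Rats_dense_in_real by blast
    have "r \<notin> R" using cSup_upper[OF _ bdd, of r] r by auto
    then have "x \<notin> low_slope (\<lambda>x. - f x) a b (- s)"
      using x(2) r s unfolding R_def nondiff_def by blast
    from up[OF this] show "\<forall>\<^sub>F y in at x. (f y - f x) / (y - x) < l"
      using s by (auto elim: eventually_mono)
  qed
  then show ?thesis unfolding has_field_derivative_iff by blast
qed

text \<open>Straddling: cutting the interval at \<open>x\<close> and applying the derivative
  estimate to both parts bounds its slope from below by \<open>L - e\<close>, however unequal the
  parts are.\<close>

lemma low_slope_derivative:
  assumes "(f has_real_derivative L) (at x)" "x \<in> low_slope f a b r"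
  shows "L \<le> r"
proof (rule field_le_epsilon)
  fix e :: real assume e: "e > 0"
  obtain d where d: "d > 0" "\<And>y. \<bar>y - x\<bar> < d \<Longrightarrow> \<bar>f y - f x - L * (y - x)\<bar> \<le> e * \<bar>y - x\<bar>"
    using assms(1) e unfolding has_field_derivative_def has_derivative_at_alt by (auto simp: mult.commute)
  obtain u v where uv: "u < x" "x < v" "v - u < d" "f v - f u < r * (v - u)"
    using assms(2) d(1) unfolding low_slope_def by blast
  have "\<bar>f v - f x - L * (v - x)\<bar> \<le> e * (v - x)" "\<bar>f u - f x - L * (u - x)\<bar> \<le> e * (x - u)"
    using d(2)[of v] d(2)[of u] uv by (auto simp: abs_if)
  then have "L * (v - x) - e * (v - x) \<le> f v - f x" "f u - f x \<le> L * (u - x) + e * (x - u)"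
    by linarith+
  then have "(L - e) * (v - u) \<le> f v - f u" by (simp add: algebra_simps)
  then have "(L - e) * (v - u) < r * (v - u)" using uv by linarith
  then have "L - e < r" using uv by (simp add: mult_less_cancel_right)
  then show "L \<le> r + e" by simp
qed

lemma derivative_not_nondiff:
  assumes "(f has_real_derivative L) (at x)"
  shows "x \<notin> nondiff f a b"
proof
  have D': "((\<lambda>x. - f x) has_real_derivative - L) (at x)" using assms by (intro derivative_intros)
  assume "x \<in> nondiff f a b"
  then consider r s where "r < s" "x \<in> low_slope f a b r" "x \<in> low_slope (\<lambda>x. - f x) a b (- s)"
    | "\<And>n::nat. x \<in> low_slope f a b (- real n)" | "\<And>n::nat. x \<in> low_slope (\<lambda>x. - f x) a b (- real n)"
    unfolding nondiff_def by blast
  then show False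
  proof cases
    case 1
    then show False using low_slope_derivative[OF assms] low_slope_derivative[OF D'] by fastforce
  next
    case 2
    obtain n :: nat where "- L < real n" using reals_Archimedean2 by blast
    then show False using low_slope_derivative[OF assms 2[of n]] by simp
  next
    case 3
    obtain n :: nat where "L < real n" using reals_Archimedean2 by blast
    then show False using low_slope_derivative[OF D' 3[of n]] by simp
  qed
qed

text \<open>Measurability is claimed for the function itself and not up to null sets, so the points
  without derivative count. There \<open>vector_derivative\<close> is \<open>SOME D. False\<close>,
  one constant on the Borel set \<open>nondiff\<close>; elsewhere in the open interval it is a limit
  of difference quotients, and the two endpoints are single points.\<close>

lemma vector_derivative_borel_measurable:
  fixes f :: "real \<Rightarrow> real"
  assumes cont: "continuous_on {a..b} f"
  shows "set_borel_measurable lborel {a..b} (\<lambda>x. vector_derivative f (at x within {a..b}))"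
proof (cases "a < b")
  case True
  define D where "D x = vector_derivative f (at x within {a..b})" for x
  \<comment> \<open>Constant extension beyond \<open>{a..b}\<close>, so that the difference
    quotients are defined and Borel on the whole line.\<close>
  define F where "F x = f (max a (min b x))" for x
  have F: "F \<in> borel_measurable borel"
    unfolding F_def by (intro borel_measurable_continuous_onI continuous_on_compose2[OF cont] continuous_intros)
      (use True in auto)
  define q where "q x = lim (\<lambda>n. (F (x + inverse (real (Suc n))) - F x) / inverse (real (Suc n)))" for x
  have q: "q \<in> borel_measurable borel"
    unfolding q_def by (intro borel_measurable_lim_metric) (use F in measurable)
  have diff: "D x = q x" if x: "x \<in> {a<..<b} - nondiff f a b" for x
  proof -
    obtain L where L: "(f has_real_derivative L) (at x)"
      using has_derivative_off_nondiff[OF cont, of x] x by blast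
    then have "(f has_vector_derivative L) (at x within {a..b})"
      by (simp add: has_real_derivative_iff_has_vector_derivative has_vector_derivative_at_within)
    then have "D x = L" unfolding D_def using x True by (intro vector_derivative_within_closed_interval) auto
    moreover have "(F has_real_derivative L) (at x)"
      by (rule has_field_derivative_transform_within_open[OF L open_greaterThanLessThan[of a b]])
        (use that in \<open>auto simp: F_def\<close>)
    then have "((\<lambda>h. (F (x + h) - F x) / h) \<longlongrightarrow> L) (at 0)" unfolding DERIV_def .
    then have "((\<lambda>n. (F (x + inverse (real (Suc n))) - F x) / inverse (real (Suc n))) \<longlonglongrightarrow> L)"
      by (rule filterlim_compose, intro filterlim_atI LIMSEQ_inverse_real_of_nat) auto
    then have "q x = L" unfolding q_def by (rule limI)
    ultimately show ?thesis by simp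
  qed
  define c where "c = (SOME D::real. False)"
  have nond: "D x = c" if "x \<in> {a<..<b} \<inter> nondiff f a b" for x
  proof -
    have "\<not> (f has_vector_derivative L) (at x within {a..b})" for L
      using that derivative_not_nondiff[of f _ x a b]
      by (auto simp: has_real_derivative_iff_has_vector_derivative at_within_Icc_at)
    then show ?thesis unfolding D_def vector_derivative_def c_def by simp
  qed
  have "(\<lambda>x. indicat_real {a..b} x *\<^sub>R D x) = (\<lambda>x. if x = a then D a else if x = b then D b
      else if x \<in> {a<..<b} then (if x \<in> nondiff f a b then c else q x) else 0)"
    using diff nond True by (auto simp: fun_eq_iff indicator_def)
  also have "\<dots> \<in> borel_measurable borel"
    using q nondiff_borel[of f a b] by measurable
  finally show ?thesis unfolding set_borel_measurable_def D_def by simp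
next
  case False
  then have "a = b \<or> {a..b} = {}" by auto
  then have "(\<lambda>x. indicat_real {a..b} x *\<^sub>R vector_derivative f (at x within {a..b})) =
     (\<lambda>x. if x = a then indicat_real {a..b} a *\<^sub>R vector_derivative f (at a within {a..b}) else 0)"
    by (auto simp: fun_eq_iff indicator_def)
  also have "\<dots> \<in> borel_measurable borel" by measurable
  finally show ?thesis unfolding set_borel_measurable_def by simp
qed

text \<open>The gauge confines the tags in \<open>N\<close> to an open set so small that absolute continuity
  controls the increments there.\<close>
lemma AC_has_integral:
  fixes f g :: "real \<Rightarrow> real"
  assumes ac: "abs_continuous_on {a..b} f" and "a \<le> b" and N: "negligible N"
    and der: "\<And>x. x \<in> {a..b} - N \<Longrightarrow> (f has_vector_derivative g x) (at x within {a..b})"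
  shows "(g has_integral (f b - f a)) {a..b}"
proof -
  \<comment> \<open>With the value 0 at tags in \<open>N\<close> a Riemann sum sees nothing there,
    and what remains of the error at these tags are increments of \<open>f\<close>.\<close>
  define g' where "g' x = (if x \<in> N then 0 else g x)" for x
  have "(g' has_integral (f b - f a)) (cbox a b)"
    unfolding has_integral
  proof (intro allI impI)
    fix e :: real assume e: "e > 0"
    \<comment> \<open>Half of \<open>e\<close> is spent on tags off \<open>N\<close>, with intervals
      of total length at most \<open>b - a\<close>; the other half is the total increment allowed at
      tags in \<open>N\<close>. The added 1 covers \<open>a = b\<close>.\<close>
    define e1 where "e1 = e / (2 * (b - a + 1))"
    have e1: "e1 > 0" unfolding e1_def using e \<open>a \<le> b\<close> by simp
    have "\<forall>x. \<exists>d>0. x \<in> {a..b} - N \<longrightarrow>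
         (\<forall>y\<in>{a..b}. norm (y-x) < d \<longrightarrow> norm (f y - f x - (y-x) *\<^sub>R g x) \<le> e1 * norm (y-x))"
    proof
      fix x
      show "\<exists>d>0. x \<in> {a..b} - N \<longrightarrow>
         (\<forall>y\<in>{a..b}. norm (y-x) < d \<longrightarrow> norm (f y - f x - (y-x) *\<^sub>R g x) \<le> e1 * norm (y-x))"
      proof (cases "x \<in> {a..b} - N")
        case True
        then show ?thesis
          using der[unfolded has_vector_derivative_def has_derivative_within_alt, of x] e1 by blast
      qed (auto intro: exI[of _ 1])
    qed
    then obtain d where d: "\<And>x. 0 < d x"
      "\<And>x y. \<lbrakk>x \<in> {a..b} - N; y \<in> {a..b}; norm (y-x) < d x\<rbrakk>
          \<Longrightarrow> norm (f y - f x - (y-x) *\<^sub>R g x) \<le> e1 * norm (y-x)"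
      by metis
    obtain \<delta> where \<delta>: "\<delta> > 0" "\<forall>(I::(real \<times> real set) set) u v. finite I \<longrightarrow> (\<forall>i\<in>I. u i \<le> v i \<and> {u i..v i} \<subseteq> {a..b}) \<longrightarrow>
       (\<forall>i\<in>I. \<forall>j\<in>I. i \<noteq> j \<longrightarrow> v i \<le> u j \<or> v j \<le> u i) \<longrightarrow>
       (\<Sum>i\<in>I. v i - u i) < \<delta> \<longrightarrow> (\<Sum>i\<in>I. \<bar>f (v i) - f (u i)\<bar>) < e / 2"
      by (rule abs_continuous_onE[OF ac half_gt_zero[OF e]]) (rule that)
    obtain U where U: "open U" "N \<subseteq> U" "U \<in> lmeasurable" "measure lebesgue U < \<delta>"
    proof -
      have N': "N \<in> lmeasurable" "measure lebesgue N = 0"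
        using N by (auto simp: negligible_imp_measure0 negligible_imp_measurable)
      obtain T where T: "open T" "N \<subseteq> T" "T - N \<in> lmeasurable" "emeasure lebesgue (T - N) < ennreal \<delta>"
        using sets_lebesgue_outer_open[OF fmeasurableD[OF N'(1)] \<delta>(1)] by blast
      have "measure lebesgue (T - N) < \<delta>"
        using T(3,4) \<delta>(1) by (simp add: emeasure_eq_measure2 ennreal_less_iff)
      moreover have "T = N \<union> (T - N)" using T(2) by blast
      then have "T \<in> lmeasurable" "measure lebesgue T \<le> measure lebesgue N + measure lebesgue (T - N)"
        using fmeasurable.Un[OF N'(1) T(3)] measure_Un_le[OF fmeasurableD[OF N'(1)] fmeasurableD[OF T(3)]] by simp_all
      ultimately show ?thesis using that T N'(2) by simp
    qed
    have "\<forall>x. \<exists>d>0. x \<in> U \<longrightarrow> ball x d \<subseteq> U"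
      using U(1) unfolding open_contains_ball by (meson zero_less_one)
    then obtain dU where dU: "\<And>x. 0 < dU x" "\<And>x. x \<in> U \<Longrightarrow> ball x (dU x) \<subseteq> U" by metis
    define \<gamma> where "\<gamma> x = ball x (min (d x) (dU x))" for x
    have gauge: "gauge \<gamma>" unfolding \<gamma>_def using d(1) dU(1) by (intro gauge_ball_dependent) auto
    have "norm ((\<Sum>(x, K)\<in>p. measure lborel K *\<^sub>R g' x) - (f b - f a)) < e"
      if p: "p tagged_division_of cbox a b" and fine: "\<gamma> fine p" for p
    proof -
      define w where "w = (\<lambda>(x, K). measure lborel K *\<^sub>R g' x - (f (Sup K) - f (Inf K)))"
      have fin: "finite p" using p by blast
      have ba: "b - a = (\<Sum>(x,K)\<in>p. Sup K - Inf K)" "f b - f a = (\<Sum>(x,K)\<in>p. f(Sup K) - f(Inf K))"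
        using additive_tagged_division_1[where f= "\<lambda>x. x"] additive_tagged_division_1[where f= f] \<open>a \<le> b\<close> p by auto
      have iv: "K = {Inf K..Sup K} \<and> Inf K \<in> K \<and> Sup K \<in> K \<and> x \<in> K \<and> Inf K \<le> x \<and> x \<le> Sup K \<and> K \<subseteq> {a..b} \<and> measure lborel K = Sup K - Inf K
          \<and> K \<subseteq> ball x (d x) \<and> K \<subseteq> ball x (dU x)" if "(x, K) \<in> p" for x K
      proof -
        have "x \<in> K" "K \<subseteq> {a..b}" using p that by auto
        moreover obtain u v where "K = {u..v}" using p \<open>(x, K) \<in> p\<close> by (metis box_real(2) tagged_division_ofD(4))
        moreover have "K \<subseteq> \<gamma> x" using fine that by blast
        ultimately show ?thesis unfolding \<gamma>_def by auto
      qed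
      \<comment> \<open>A degenerate interval may lie inside another one, which would break the
        separation required by absolute continuity; its error term is 0 anyway.\<close>
      define pN where "pN = {(x, K) \<in> p. x \<in> N \<and> Inf K < Sup K}"
      have finN: "finite pN" unfolding pN_def using fin by (rule rev_finite_subset) auto
      have sub: "pN \<subseteq> p" unfolding pN_def by auto
      have dis: "Sup (snd i) \<le> Inf (snd j) \<or> Sup (snd j) \<le> Inf (snd i)" if "i \<in> pN" "j \<in> pN" "i \<noteq> j" for i j
      proof (rule ccontr)
        obtain x K y L where ij: "i = (x, K)" "j = (y, L)" by (metis surj_pair)
        have in_p: "(x, K) \<in> p" "(y, L) \<in> p" "(x, K) \<noteq> (y, L)" and lt: "Inf K < Sup K" "Inf L < Sup L"
          using that ij unfolding pN_def by auto
        assume "\<not> ?thesis"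
        then have "Inf L < Sup K" "Inf K < Sup L" by (auto simp: ij)
        then obtain z where z: "max (Inf K) (Inf L) < z" "z < min (Sup K) (Sup L)"
          using lt dense[of "max (Inf K) (Inf L)" "min (Sup K) (Sup L)"] by auto
        have "interior K = {Inf K<..<Sup K}" "interior L = {Inf L<..<Sup L}"
          using iv[OF in_p(1)] iv[OF in_p(2)] by (metis interior_atLeastAtMost_real)+
        then have "z \<in> interior K \<inter> interior L" using z by auto
        then show False using tagged_division_ofD(5)[OF p in_p] by blast
      qed
      have lenN: "(\<Sum>i\<in>pN. Sup (snd i) - Inf (snd i)) < \<delta>"
      proof -
        have "(\<Sum>i\<in>pN. Sup (snd i) - Inf (snd i)) = measure lebesgue (\<Union>i\<in>pN. {Inf (snd i)..Sup (snd i)})"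
          using finN dis by (intro measure_UN_intervals[symmetric]) (auto simp: pN_def)
        also have "\<dots> \<le> measure lebesgue U"
        proof (rule measure_mono_fmeasurable[OF _ _ U(3)])
          show "(\<Union>i\<in>pN. {Inf (snd i)..Sup (snd i)}) \<subseteq> U"
          proof
            fix z assume "z \<in> (\<Union>i\<in>pN. {Inf (snd i)..Sup (snd i)})"
            then obtain x K where xK: "(x, K) \<in> p" "x \<in> N" "z \<in> {Inf K..Sup K}" unfolding pN_def by auto
            then have "z \<in> ball x (dU x)" using iv[OF xK(1)] by blast
            then show "z \<in> U" using dU(2)[of x] xK(2) U(2) by blast
          qed
          show "(\<Union>i\<in>pN. {Inf (snd i)..Sup (snd i)}) \<in> sets lebesgue"
            using finN by (intro sets.finite_UN) auto
        qed
        finally show ?thesis using U(4) by simp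
      qed
      have sN: "(\<Sum>i\<in>pN. \<bar>f (Sup (snd i)) - f (Inf (snd i))\<bar>) < e / 2"
      proof (rule \<delta>(2)[rule_format, of pN "\<lambda>i. Inf (snd i)" "\<lambda>i. Sup (snd i)"])
        show "Inf (snd i) \<le> Sup (snd i) \<and> {Inf (snd i)..Sup (snd i)} \<subseteq> {a..b}" if "i \<in> pN" for i
        proof -
          have "(fst i, snd i) \<in> p" using that sub by auto
          from iv[OF this] show ?thesis by (metis order_trans)
        qed
      qed (use finN dis lenN in auto)
      have good: "\<bar>w (x, K)\<bar> \<le> e1 * (Sup K - Inf K)" if "(x, K) \<in> p" "x \<notin> N" for x K
      proof -
        have K: "Inf K \<in> K" "Sup K \<in> K" "Inf K \<in> {a..b}" "Sup K \<in> {a..b}" "x \<in> {a..b} - N" "Inf K \<le> x" "x \<le> Sup K"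
          using iv[OF that(1)] that(2) by blast+
        have "norm (Inf K - x) < d x" "norm (Sup K - x) < d x"
          using iv[OF that(1)] K(1,2) by (auto simp: dist_real_def)
        from d(2)[OF K(5,3) this(1)] d(2)[OF K(5,4) this(2)]
        have "\<bar>f (Inf K) - f x - (Inf K - x) * g x\<bar> \<le> e1 * (x - Inf K)"
          "\<bar>f (Sup K) - f x - (Sup K - x) * g x\<bar> \<le> e1 * (Sup K - x)" using K by auto
        moreover have "w (x, K) = (f (Inf K) - f x - (Inf K - x) * g x) - (f (Sup K) - f x - (Sup K - x) * g x)"
        proof -
          have "measure lborel K = Sup K - Inf K" using iv[OF that(1)] by blast
          then show ?thesis unfolding w_def g'_def using that(2) by (simp only: prod.case) (simp add: algebra_simps)
        qed
        ultimately have "\<bar>w (x, K)\<bar> \<le> e1 * (x - Inf K) + e1 * (Sup K - x)" by linarith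
        then show ?thesis by (simp add: algebra_simps)
      qed
      have bad: "\<bar>w (x, K)\<bar> \<le> \<bar>f (Sup K) - f (Inf K)\<bar>" if "x \<in> N" for x K
        unfolding w_def g'_def using that by simp
      have zero: "w (x, K) = 0" if "(x, K) \<in> p" "x \<in> N" "\<not> Inf K < Sup K" for x K
      proof -
        have "Inf K = Sup K" using iv[OF that(1)] that(3) by auto
        then show ?thesis unfolding w_def g'_def using that by simp
      qed
      have "(\<Sum>(x, K)\<in>p. measure lborel K *\<^sub>R g' x) - (f b - f a) = sum w p"
        unfolding ba(2) w_def by (simp add: sum_subtractf split_def)
      also have "norm \<dots> \<le> (\<Sum>i\<in>p. \<bar>w i\<bar>)" using sum_abs by auto
      also have "\<dots> \<le> (\<Sum>i\<in>p. e1 * (Sup (snd i) - Inf (snd i)) + (if i \<in> pN then \<bar>f (Sup (snd i)) - f (Inf (snd i))\<bar> else 0))"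
      proof (rule sum_mono)
        fix i assume i: "i \<in> p"
        obtain x K where [simp]: "i = (x, K)" by (cases i)
        have "0 \<le> e1 * (Sup K - Inf K)" using iv[of x K] i e1 by auto
        then show "\<bar>w i\<bar> \<le> e1 * (Sup (snd i) - Inf (snd i)) + (if i \<in> pN then \<bar>f (Sup (snd i)) - f (Inf (snd i))\<bar> else 0)"
          using good[of x K] bad[of x K] zero[of x K] i unfolding pN_def by (cases "x \<in> N") auto
      qed
      also have "\<dots> = e1 * (b - a) + (\<Sum>i\<in>pN. \<bar>f (Sup (snd i)) - f (Inf (snd i))\<bar>)"
        using fin sub unfolding ba(1) by (simp add: sum.distrib sum_distrib_left split_def sum.inter_restrict[symmetric] Int_absorb1)
      also have "\<dots> < e1 * (b - a) + e / 2" using sN by simp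
      also have "e1 * (b - a) \<le> e / 2" unfolding e1_def using e \<open>a \<le> b\<close> by (simp add: field_simps)
      finally show ?thesis by simp
    qed
    then show "\<exists>\<gamma>. gauge \<gamma> \<and> (\<forall>\<D>. \<D> tagged_division_of cbox a b \<and> \<gamma> fine \<D> \<longrightarrow>
        norm ((\<Sum>(x, k)\<in>\<D>. measure lborel k *\<^sub>R g' x) - (f b - f a)) < e)"
      using gauge by blast
  qed
  then show ?thesis
    unfolding box_real by (rule has_integral_spike[OF N, rotated]) (auto simp: g'_def)
qed

section \<open>Symmetric operators on a real Hilbert space\<close>

lemma summable_on_iff_nn_integral:
  fixes f :: "'a \<Rightarrow> real"
  assumes "\<And>x. f x \<ge> 0"
  shows "f summable_on UNIV \<longleftrightarrow> (\<integral>\<^sup>+ x. ennreal (f x) \<partial>count_space UNIV) < \<infinity>"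
proof -
  have "f summable_on UNIV \<longleftrightarrow> integrable (count_space UNIV) f"
    using summable_on_iff_abs_summable_on_real[of f UNIV] abs_summable_equivalent[of f UNIV]
    unfolding Infinite_Set_Sum.abs_summable_on_def by simp
  then show ?thesis using assms by (simp add: integrable_iff_bounded)
qed

lemma set_integrable_square_iff:
  fixes w :: "real \<Rightarrow> real"
  assumes "set_borel_measurable lborel X w"
  shows "(\<lambda>t. indicator X t * ennreal ((w t)\<^sup>2)) = (\<lambda>t. ennreal (indicat_real X t *\<^sub>R (w t)\<^sup>2))"
    and "set_integrable lborel X (\<lambda>t. (w t)\<^sup>2) \<longleftrightarrow>
      (\<integral>\<^sup>+ t. indicator X t * ennreal ((w t)\<^sup>2) \<partial>lborel) < \<infinity>"
    and "set_borel_measurable lborel X (\<lambda>t. (w t)\<^sup>2)"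
proof -
  show eq: "(\<lambda>t. indicator X t * ennreal ((w t)\<^sup>2)) = (\<lambda>t. ennreal (indicat_real X t *\<^sub>R (w t)\<^sup>2))"
    by (auto simp: fun_eq_iff indicator_def)
  have sq: "(\<lambda>t. indicat_real X t *\<^sub>R (w t)\<^sup>2) = (\<lambda>t. (indicat_real X t *\<^sub>R w t)\<^sup>2)"
    by (auto simp: fun_eq_iff indicator_def)
  show m: "set_borel_measurable lborel X (\<lambda>t. (w t)\<^sup>2)"
    using assms unfolding set_borel_measurable_def sq by measurable
  show "set_integrable lborel X (\<lambda>t. (w t)\<^sup>2) \<longleftrightarrow>
      (\<integral>\<^sup>+ t. indicator X t * ennreal ((w t)\<^sup>2) \<partial>lborel) < \<infinity>"
    unfolding eq set_integrable_def integrable_iff_bounded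
    using m unfolding set_borel_measurable_def by simp
qed

text \<open>Infinite sums and Bochner integrals take the value 0 when they do not converge, so
  linear manipulations of \<open>l2inner\<close> need convergence facts. This form supplies them:
  integrability on each edge and summability over the edges.\<close>

lemma L2_iff:
  "L2 G u \<longleftrightarrow> (\<forall>e. set_borel_measurable lborel {0..len G e} (u e)) \<and>
     (\<forall>e. set_integrable lborel {0..len G e} (\<lambda>t. (u e t)\<^sup>2)) \<and>
     (\<lambda>e. LINT t:{0..len G e}|lborel. (u e t)\<^sup>2) summable_on UNIV"
proof (cases "\<forall>e. set_borel_measurable lborel {0..len G e} (u e)")
  case True
  define X where "X e = {0..len G e}" for e
  note sq = set_integrable_square_iff[OF True[rule_format, folded X_def]]
  have nn: "0 \<le> (LINT t:X e|lborel. (u e t)\<^sup>2)" for e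
    unfolding set_lebesgue_integral_def by (intro Bochner_Integration.integral_nonneg) auto
  have val: "(\<integral>\<^sup>+ t. indicator (X e) t * ennreal ((u e t)\<^sup>2) \<partial>lborel) = ennreal (LINT t:X e|lborel. (u e t)\<^sup>2)"
    if "set_integrable lborel (X e) (\<lambda>t. (u e t)\<^sup>2)" for e
    unfolding sq(1) set_lebesgue_integral_def
    by (rule nn_integral_eq_integral) (use that in \<open>auto simp: set_integrable_def\<close>)
  have fin: "(\<integral>\<^sup>+ t. indicator (X e) t * ennreal ((u e t)\<^sup>2) \<partial>lborel) < \<infinity>"
    if "(\<integral>\<^sup>+ e. (\<integral>\<^sup>+ t. indicator (X e) t * ennreal ((u e t)\<^sup>2) \<partial>lborel) \<partial>count_space UNIV) < \<infinity>" for e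
  proof -
    have "(\<integral>\<^sup>+ t. indicator (X e) t * ennreal ((u e t)\<^sup>2) \<partial>lborel) \<le>
      (\<integral>\<^sup>+ e. (\<integral>\<^sup>+ t. indicator (X e) t * ennreal ((u e t)\<^sup>2) \<partial>lborel) \<partial>count_space UNIV)"
      by (rule nn_integral_ge_point) simp
    then show ?thesis using that by (rule le_less_trans)
  qed
  show ?thesis
    unfolding L2_def X_def[symmetric] using True[folded X_def]
  proof (simp, intro iffI conjI)
    assume *: "(\<integral>\<^sup>+ e. (\<integral>\<^sup>+ t. indicator (X e) t * ennreal ((u e t)\<^sup>2) \<partial>lborel) \<partial>count_space UNIV) < top"
    then show i: "\<forall>e. set_integrable lborel (X e) (\<lambda>t. (u e t)\<^sup>2)" using sq(2) fin by simp
    show "(\<lambda>e. LINT t:X e|lborel. (u e t)\<^sup>2) summable_on UNIV"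
      unfolding summable_on_iff_nn_integral[OF nn] using * val i by simp
  next
    assume *: "(\<forall>e. set_integrable lborel (X e) (\<lambda>t. (u e t)\<^sup>2)) \<and> (\<lambda>e. LINT t:X e|lborel. (u e t)\<^sup>2) summable_on UNIV"
    then show "(\<integral>\<^sup>+ e. (\<integral>\<^sup>+ t. indicator (X e) t * ennreal ((u e t)\<^sup>2) \<partial>lborel) \<partial>count_space UNIV) < top"
      using val unfolding summable_on_iff_nn_integral[OF nn] by simp
  qed
next
  case False
  then show ?thesis unfolding L2_def by blast
qed

lemma set_borel_measurable_lincomb:
  fixes u v :: "real \<Rightarrow> real"
  assumes "set_borel_measurable lborel X u" "set_borel_measurable lborel X v"
  shows "set_borel_measurable lborel X (\<lambda>t. a * u t + b * v t)"
proof -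
  have "(\<lambda>t. indicat_real X t *\<^sub>R (a * u t + b * v t)) = (\<lambda>t. a * (indicat_real X t *\<^sub>R u t) + b * (indicat_real X t *\<^sub>R v t))"
    by (auto simp: fun_eq_iff algebra_simps)
  then show ?thesis using assms unfolding set_borel_measurable_def by simp
qed

text \<open>The bound of a product by the sum of squares is cruder than Cauchy-Schwarz, but it is
  additive: summed over the edges it gives absolute convergence of \<open>l2inner\<close> at
  once.\<close>

lemma set_integrable_mult_of_squares:
  fixes u v :: "real \<Rightarrow> real"
  assumes "set_borel_measurable lborel X u" "set_borel_measurable lborel X v"
    and "set_integrable lborel X (\<lambda>t. (u t)\<^sup>2)" "set_integrable lborel X (\<lambda>t. (v t)\<^sup>2)"
  shows "set_integrable lborel X (\<lambda>t. u t * v t)"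
    and "\<bar>LINT t:X|lborel. u t * v t\<bar> \<le> (LINT t:X|lborel. (u t)\<^sup>2) + (LINT t:X|lborel. (v t)\<^sup>2)"
proof -
  have eq: "(\<lambda>t. indicat_real X t *\<^sub>R (u t * v t)) = (\<lambda>t. (indicat_real X t *\<^sub>R u t) * (indicat_real X t *\<^sub>R v t))"
    by (auto simp: fun_eq_iff indicator_def)
  have m: "(\<lambda>t. indicat_real X t *\<^sub>R (u t * v t)) \<in> borel_measurable lborel"
    unfolding eq using assms(1,2) unfolding set_borel_measurable_def by measurable
  have le: "\<bar>u t * v t\<bar> \<le> (u t)\<^sup>2 + (v t)\<^sup>2" for t
  proof -
    have "2 * (\<bar>u t\<bar> * \<bar>v t\<bar>) \<le> \<bar>u t\<bar>\<^sup>2 + \<bar>v t\<bar>\<^sup>2"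
      using sum_squares_bound[of "\<bar>u t\<bar>" "\<bar>v t\<bar>"] by simp
    moreover have "0 \<le> \<bar>u t\<bar> * \<bar>v t\<bar>" by simp
    ultimately have "\<bar>u t\<bar> * \<bar>v t\<bar> \<le> \<bar>u t\<bar>\<^sup>2 + \<bar>v t\<bar>\<^sup>2" by linarith
    then show ?thesis by (simp add: abs_mult)
  qed
  have s: "set_integrable lborel X (\<lambda>t. (u t)\<^sup>2 + (v t)\<^sup>2)" using assms(3,4) by simp
  show i: "set_integrable lborel X (\<lambda>t. u t * v t)"
    using s m le unfolding set_integrable_def
    by (rule_tac Bochner_Integration.integrable_bound[OF s[unfolded set_integrable_def]])
      (auto simp: indicator_def intro!: AE_I2)
  have "\<bar>LINT t:X|lborel. u t * v t\<bar> \<le> (LINT t:X|lborel. \<bar>u t * v t\<bar>)"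
    using set_integral_norm_bound[OF i] by simp
  also have "\<dots> \<le> (LINT t:X|lborel. (u t)\<^sup>2 + (v t)\<^sup>2)"
    using set_integrable_abs[OF i] s le by (intro set_integral_mono)
  also have "\<dots> = (LINT t:X|lborel. (u t)\<^sup>2) + (LINT t:X|lborel. (v t)\<^sup>2)"
    using assms(3,4) by simp
  finally show "\<bar>LINT t:X|lborel. u t * v t\<bar> \<le> (LINT t:X|lborel. (u t)\<^sup>2) + (LINT t:X|lborel. (v t)\<^sup>2)" .
qed

lemma L2_product:
  assumes "L2 G u" "L2 G v"
  shows "set_integrable lborel {0..len G e} (\<lambda>t. u e t * v e t)"
    and "(\<lambda>e. LINT t:{0..len G e}|lborel. u e t * v e t) summable_on UNIV"
proof -
  note uv = assms[unfolded L2_iff]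
  show "set_integrable lborel {0..len G e} (\<lambda>t. u e t * v e t)" for e
    using uv by (intro set_integrable_mult_of_squares) auto
  have "(\<lambda>e. (LINT t:{0..len G e}|lborel. (u e t)\<^sup>2) + (LINT t:{0..len G e}|lborel. (v e t)\<^sup>2)) summable_on UNIV"
    using uv by (intro summable_on_add) auto
  then have "(\<lambda>e. norm (LINT t:{0..len G e}|lborel. u e t * v e t)) summable_on UNIV"
  proof (rule summable_on_comparison_test)
    fix e
    show "norm (LINT t:{0..len G e}|lborel. u e t * v e t)
      \<le> (LINT t:{0..len G e}|lborel. (u e t)\<^sup>2) + (LINT t:{0..len G e}|lborel. (v e t)\<^sup>2)"
      using uv set_integrable_mult_of_squares(2)[of "{0..len G e}" "u e" "v e"] by simp
  qed simp
  then show "(\<lambda>e. LINT t:{0..len G e}|lborel. u e t * v e t) summable_on UNIV"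
    by (rule abs_summable_summable)
qed

lemma L2_lincomb:
  assumes "L2 G u" "L2 G v"
  shows "L2 G (\<lambda>e t. a * u e t + b * v e t)"
proof -
  note uv = assms[unfolded L2_iff]
  have eq: "(a * u e t + b * v e t)\<^sup>2 = a\<^sup>2 * (u e t)\<^sup>2 + (2 * a * b) * (u e t * v e t) + b\<^sup>2 * (v e t)\<^sup>2" for e t
    by (simp add: power2_eq_square algebra_simps)
  have i: "set_integrable lborel {0..len G e} (\<lambda>t. (a * u e t + b * v e t)\<^sup>2)" for e
    unfolding eq using uv L2_product(1)[OF assms] by (intro set_integral_add set_integrable_mult_right) auto
  have "(LINT t:{0..len G e}|lborel. (a * u e t + b * v e t)\<^sup>2) =
     a\<^sup>2 * (LINT t:{0..len G e}|lborel. (u e t)\<^sup>2) + (2 * a * b) * (LINT t:{0..len G e}|lborel. u e t * v e t)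
     + b\<^sup>2 * (LINT t:{0..len G e}|lborel. (v e t)\<^sup>2)" for e
    unfolding eq using uv L2_product(1)[OF assms, of e] by (simp add: set_integral_add)
  then have "(\<lambda>e. LINT t:{0..len G e}|lborel. (a * u e t + b * v e t)\<^sup>2) summable_on UNIV"
    using uv L2_product(2)[OF assms] by (simp add: summable_on_add summable_on_cmult_right)
  then show ?thesis unfolding L2_iff using i uv set_borel_measurable_lincomb by blast
qed

lemma l2inner_lincomb_left:
  assumes "L2 G u" "L2 G v" "L2 G w"
  shows "l2inner G (\<lambda>e t. a * u e t + b * v e t) w = a * l2inner G u w + b * l2inner G v w"
proof -
  have "(LINT t:{0..len G e}|lborel. (a * u e t + b * v e t) * w e t) =
      a * (LINT t:{0..len G e}|lborel. u e t * w e t) + b * (LINT t:{0..len G e}|lborel. v e t * w e t)" for e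
    using L2_product(1)[OF assms(1,3), of e] L2_product(1)[OF assms(2,3), of e]
    by (simp add: distrib_right mult.assoc set_integral_add)
  then show ?thesis
    unfolding l2inner_def using L2_product(2)[OF assms(1,3)] L2_product(2)[OF assms(2,3)]
    by (simp add: infsum_add infsum_cmult_right summable_on_cmult_right)
qed

lemma l2inner_commute: "l2inner G u v = l2inner G v u"
  unfolding l2inner_def by (simp add: mult.commute)

lemma l2inner_lincomb_right:
  assumes "L2 G u" "L2 G v" "L2 G w"
  shows "l2inner G w (\<lambda>e t. a * u e t + b * v e t) = a * l2inner G w u + b * l2inner G w v"
  using l2inner_lincomb_left[OF assms] by (simp add: l2inner_commute[of G w])

lemma l2inner_nonneg: "0 \<le> l2inner G u u"
  unfolding l2inner_def set_lebesgue_integral_def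
  by (intro infsum_nonneg Bochner_Integration.integral_nonneg) auto

lemma l2inner_cong:
  assumes "L2 G u" "L2 G u'" "L2 G w" "ae_eq G u u'"
  shows "l2inner G u w = l2inner G u' w"
proof -
  have "(LINT t:{0..len G e}|lborel. u e t * w e t) = (LINT t:{0..len G e}|lborel. u' e t * w e t)" for e
    unfolding set_lebesgue_integral_def
  proof (rule integral_cong_AE)
    show "(\<lambda>t. indicat_real {0..len G e} t *\<^sub>R (u e t * w e t)) \<in> borel_measurable lborel"
      "(\<lambda>t. indicat_real {0..len G e} t *\<^sub>R (u' e t * w e t)) \<in> borel_measurable lborel"
      using L2_product(1)[OF assms(1,3), of e] L2_product(1)[OF assms(2,3), of e]
      unfolding set_integrable_def by auto
    have "AE t in lborel. t \<in> {0..len G e} \<longrightarrow> u e t = u' e t" using assms(4) unfolding ae_eq_def by blast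
    then show "AE t in lborel. indicat_real {0..len G e} t *\<^sub>R (u e t * w e t) = indicat_real {0..len G e} t *\<^sub>R (u' e t * w e t)"
      by (rule AE_mp) (auto simp: indicator_def)
  qed
  then show ?thesis unfolding l2inner_def by simp
qed

lemma l2inner_zero_imp_ae_eq:
  assumes u: "L2 G u" and v: "L2 G v"
    and 0: "l2inner G (\<lambda>e t. u e t - v e t) (\<lambda>e t. u e t - v e t) = 0"
  shows "ae_eq G u v"
  unfolding ae_eq_def
proof
  fix e
  define w where "w e t = u e t - v e t" for e t
  have w: "L2 G w" using L2_lincomb[OF u v, of 1 "-1"] unfolding w_def by simp
  have nn: "0 \<le> (LINT t:{0..len G e}|lborel. w e t * w e t)" for e
    unfolding set_lebesgue_integral_def by (intro Bochner_Integration.integral_nonneg) auto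
  have "(LINT t:{0..len G e}|lborel. w e t * w e t) = 0"
    using nonneg_infsum_le_0D[of "\<lambda>e. LINT t:{0..len G e}|lborel. w e t * w e t" UNIV e]
      0 L2_product(2)[OF w w] nn unfolding l2inner_def w_def[symmetric] by auto
  then have "AE t in lborel. indicat_real {0..len G e} t *\<^sub>R (w e t * w e t) = 0"
    using L2_product(1)[OF w w, of e] unfolding set_lebesgue_integral_def set_integrable_def
    by (subst (asm) integral_nonneg_eq_0_iff_AE) (auto simp: indicator_def)
  then show "AE t in lborel. t \<in> {0..len G e} \<longrightarrow> u e t = v e t"
    by (rule AE_mp) (auto simp: w_def)
qed

text \<open>The difference \<open>w\<close> of \<open>h\<close> and \<open>h'\<close> is orthogonal
  to \<open>D\<close>. For \<open>f\<close> in \<open>D\<close> close to \<open>w\<close>,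
  Pythagoras then bounds the squared norm of \<open>w\<close> by its squared distance from
  \<open>f\<close>.\<close>

lemma dense_L2_orthogonal:
  assumes D: "dense_L2 G D" "\<forall>f\<in>D. L2 G f" and h: "L2 G h" "L2 G h'"
    and eq: "\<And>f. f \<in> D \<Longrightarrow> l2inner G f h = l2inner G f h'"
  shows "ae_eq G h h'"
proof (rule l2inner_zero_imp_ae_eq[OF h])
  define w where "w e t = h e t - h' e t" for e t
  have w: "L2 G w" using L2_lincomb[OF h, of 1 "-1"] unfolding w_def by simp
  have "l2inner G w w \<le> 0 + \<epsilon>" if \<epsilon>: "\<epsilon> > 0" for \<epsilon>
  proof -
    obtain f where f: "f \<in> D" "l2inner G (\<lambda>e t. w e t - f e t) (\<lambda>e t. w e t - f e t) < \<epsilon>"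
      using D(1) w \<epsilon> unfolding dense_L2_def by blast
    have f2: "L2 G f" using D(2) f(1) by blast
    have fw: "l2inner G f w = 0"
      using l2inner_lincomb_right[OF h f2, of 1 "-1"] eq[OF f(1)] unfolding w_def by simp
    define d where "d e t = w e t - f e t" for e t
    have d: "L2 G d" using L2_lincomb[OF w f2, of 1 "-1"] unfolding d_def by simp
    have "l2inner G d d = l2inner G w d - l2inner G f d"
      using l2inner_lincomb_left[OF w f2 d, of 1 "-1"] unfolding d_def by simp
    also have "\<dots> = (l2inner G w w - l2inner G w f) - (l2inner G f w - l2inner G f f)"
      using l2inner_lincomb_right[OF w f2 w, of 1 "-1"] l2inner_lincomb_right[OF w f2 f2, of 1 "-1"]
      unfolding d_def by simp
    finally have "l2inner G d d = l2inner G w w + l2inner G f f"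
      using fw l2inner_commute[of G w f] by simp
    then show ?thesis using f(2) l2inner_nonneg[of G f] unfolding d_def by simp
  qed
  then have "l2inner G w w \<le> 0" by (rule field_le_epsilon)
  then show "l2inner G (\<lambda>e t. h e t - h' e t) (\<lambda>e t. h e t - h' e t) = 0"
    using l2inner_nonneg[of G w] unfolding w_def by simp
qed

text \<open>Measurability of \<open>v\<close> is a separate premise because \<open>lborel\<close> is
  not complete: changing a Borel function on a null set may destroy measurability.\<close>

lemma ae_eq_L2_cong:
  assumes "ae_eq G u v" "L2 G u" "\<And>e. set_borel_measurable lborel {0..len G e} (v e)"
  shows "L2 G v"
proof -
  have "(\<integral>\<^sup>+ t. indicator {0..len G e} t * ennreal ((v e t)\<^sup>2) \<partial>lborel) =
    (\<integral>\<^sup>+ t. indicator {0..len G e} t * ennreal ((u e t)\<^sup>2) \<partial>lborel)" for e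
  proof (rule nn_integral_cong_AE)
    have "AE t in lborel. t \<in> {0..len G e} \<longrightarrow> u e t = v e t" using assms(1) unfolding ae_eq_def by blast
    then show "AE t in lborel. indicator {0..len G e} t * ennreal ((v e t)\<^sup>2) = indicator {0..len G e} t * ennreal ((u e t)\<^sup>2)"
      by (rule AE_mp) (auto simp: indicator_def)
  qed
  then show ?thesis using assms unfolding L2_def by simp
qed

text \<open>The restriction of the adjoint to \<open>L\<close> is self-adjoint when \<open>L\<close>
  contains its own complement under \<omega>. Maximality gives this: a \<open>g\<close> in the
  complement is isotropic by itself, so it could be adjoined to \<open>L\<close>.\<close>

theorem symmetric_op_has_self_adjoint_ext:
  assumes sym: "symmetric_op G D A"
  shows "has_self_adjoint_ext G D A"
proof -
  have D_L2: "L2 G u" "L2 G (A u)" if "u \<in> D" for u using sym that unfolding symmetric_op_def by blast+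
  have D_sym: "l2inner G (A u) v = l2inner G u (A v)" if "u \<in> D" "v \<in> D" for u v
    using sym that unfolding symmetric_op_def by blast
  have D_lin: "(\<lambda>e t. a * u e t + b * v e t) \<in> D" if "u \<in> D" "v \<in> D" for u v a b
    using sym that unfolding symmetric_op_def by blast
  have dense: "dense_L2 G D" using sym unfolding symmetric_op_def by blast
  \<comment> \<open>The graph of the adjoint as a relation. Density of \<open>D\<close> makes it
    single valued only up to \<open>ae_eq\<close>, so \<open>B\<close> picks a
    representative.\<close>
  define adj where "adj g h \<longleftrightarrow> L2 G g \<and> L2 G h \<and> (\<forall>f\<in>D. l2inner G (A f) g = l2inner G f h)" for g h
  define Ds where "Ds = {g. \<exists>h. adj g h}"
  define B where "B g = (SOME h. adj g h)" for g
  have adjB: "adj g (B g)" if "g \<in> Ds" for g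
    using that unfolding Ds_def B_def by (simp add: someI_ex[of "adj g"])
  have adj_unique: "ae_eq G h h'" if "adj g h" "adj g h'" for g h h'
    using that D_L2 unfolding adj_def by (intro dense_L2_orthogonal[OF dense]) auto
  have Ds_L2: "L2 G g" "L2 G (B g)" if "g \<in> Ds" for g using adjB[OF that] unfolding adj_def by auto
  have DA: "adj u (A u)" if "u \<in> D" for u using that D_L2 D_sym unfolding adj_def by auto
  have D_Ds: "D \<subseteq> Ds" using DA unfolding Ds_def by blast
  have adj_lin: "adj (\<lambda>e t. a * u e t + b * v e t) (\<lambda>e t. a * p e t + b * q e t)"
    if "adj u p" "adj v q" for u v p q a b
    using that D_L2 unfolding adj_def
    by (auto intro!: L2_lincomb simp: l2inner_lincomb_right)
  have Ds_lin: "(\<lambda>e t. a * u e t + b * v e t) \<in> Ds" if "u \<in> Ds" "v \<in> Ds" for u v a b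
    using adj_lin[OF adjB[OF that(1)] adjB[OF that(2)]] unfolding Ds_def by blast
  have B_lin: "ae_eq G (B (\<lambda>e t. a * u e t + b * v e t)) (\<lambda>e t. a * B u e t + b * B v e t)"
    if "u \<in> Ds" "v \<in> Ds" for u v a b
    using adj_unique[OF adjB[OF Ds_lin[OF that]] adj_lin[OF adjB[OF that(1)] adjB[OF that(2)]]] .
  define \<omega> where "\<omega> u v = l2inner G (B u) v - l2inner G u (B v)" for u v
  \<comment> \<open>Cancellation by symmetry of the real inner product; no property of
    \<open>u\<close> is used.\<close>
  have \<omega>_self: "\<omega> u u = 0" for u unfolding \<omega>_def using l2inner_commute[of G u "B u"] by simp
  have \<omega>_skew: "\<omega> u v = - \<omega> v u" for u v
    unfolding \<omega>_def using l2inner_commute[of G u "B v"] l2inner_commute[of G v "B u"] by simp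
  have \<omega>_lin: "\<omega> (\<lambda>e t. a * u e t + b * v e t) w = a * \<omega> u w + b * \<omega> v w"
    if "u \<in> Ds" "v \<in> Ds" "w \<in> Ds" for u v w a b
  proof -
    have "l2inner G (B (\<lambda>e t. a * u e t + b * v e t)) w = l2inner G (\<lambda>e t. a * B u e t + b * B v e t) w"
      using that by (intro l2inner_cong B_lin Ds_L2 Ds_lin L2_lincomb)
    then show ?thesis
      unfolding \<omega>_def using that Ds_L2 by (simp add: l2inner_lincomb_left algebra_simps)
  qed
  have \<omega>_lin': "\<omega> w (\<lambda>e t. a * u e t + b * v e t) = a * \<omega> w u + b * \<omega> w v"
    if "u \<in> Ds" "v \<in> Ds" "w \<in> Ds" for u v w a b
    using \<omega>_lin[OF that, of a b] \<omega>_skew[of w] by simp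
  \<comment> \<open>\<open>D\<close> lies in the radical of \<omega> on \<open>Ds\<close>, since
    there \<open>B\<close> agrees with \<open>A\<close> almost everywhere. In particular
    \<open>D\<close> is isotropic, which starts the Zorn argument.\<close>
  have \<omega>_D: "\<omega> u v = 0" if "u \<in> D" "v \<in> Ds" for u v
  proof -
    have "l2inner G (B u) v = l2inner G (A u) v"
      using that D_Ds D_L2 Ds_L2 adj_unique[OF adjB DA] by (intro l2inner_cong) auto
    also have "\<dots> = l2inner G u (B v)" using adjB[OF that(2)] that(1) unfolding adj_def by blast
    finally show ?thesis unfolding \<omega>_def by simp
  qed
  define iso where "iso = {L. D \<subseteq> L \<and> L \<subseteq> Ds \<and> (\<forall>u\<in>L. \<forall>v\<in>L. \<omega> u v = 0) \<and>
     (\<forall>u\<in>L. \<forall>v\<in>L. \<forall>a b. (\<lambda>e t. a * u e t + b * v e t) \<in> L)}"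
  have "D \<in> iso" unfolding iso_def using D_Ds D_lin \<omega>_D by blast
  have "\<exists>L\<in>iso. \<forall>X\<in>iso. L \<subseteq> X \<longrightarrow> X = L"
  proof (rule subset_Zorn_nonempty)
    show "iso \<noteq> {}" using \<open>D \<in> iso\<close> by blast
    fix C assume "C \<noteq> {}" and chain: "subset.chain iso C"
    have C: "L \<in> iso" if "L \<in> C" for L using chain that unfolding subset.chain_def by blast
    have two: "\<exists>L\<in>C. u \<in> L \<and> v \<in> L" if "u \<in> \<Union>C" "v \<in> \<Union>C" for u v
      using that chain unfolding subset_chain_def by blast
    show "\<Union>C \<in> iso"
      unfolding iso_def
    proof (intro CollectI conjI ballI allI)
      show "D \<subseteq> \<Union>C" using C \<open>C \<noteq> {}\<close> unfolding iso_def by blast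
      show "\<Union>C \<subseteq> Ds" using C unfolding iso_def by blast
    next
      fix u v assume uv: "u \<in> \<Union>C" "v \<in> \<Union>C"
      from two[OF uv] obtain L where L: "L \<in> C" "u \<in> L" "v \<in> L" by blast
      show "\<omega> u v = 0" using C[OF L(1)] L unfolding iso_def by blast
      show "(\<lambda>e t. a * u e t + b * v e t) \<in> \<Union>C" for a b using C[OF L(1)] L unfolding iso_def by blast
    qed
  qed
  then obtain L where L: "L \<in> iso" "\<And>X. X \<in> iso \<Longrightarrow> L \<subseteq> X \<Longrightarrow> X = L" by blast
  have DL: "D \<subseteq> L" and LDs: "L \<subseteq> Ds" and L_iso: "\<And>u v. u \<in> L \<Longrightarrow> v \<in> L \<Longrightarrow> \<omega> u v = 0"
    and L_lin: "\<And>u v a b. u \<in> L \<Longrightarrow> v \<in> L \<Longrightarrow> (\<lambda>e t. a * u e t + b * v e t) \<in> L"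
    using L(1) unfolding iso_def by blast+
  \<comment> \<open>Density applied to the zero function yields an element of \<open>D\<close>; it
    later produces the zero vector of \<open>L\<close>, needed to exhibit \<open>g\<close> as a
    member of \<open>X\<close>.\<close>
  have "L2 G (\<lambda>e t. 0)" unfolding L2_iff by (simp add: set_borel_measurable_def set_integrable_def)
  then obtain u0 where u0: "u0 \<in> D" using dense unfolding dense_L2_def by (meson zero_less_one)
  have complement: "g \<in> L" if g: "g \<in> Ds" and g0: "\<And>v. v \<in> L \<Longrightarrow> \<omega> v g = 0" for g
  proof -
    \<comment> \<open>The span of \<open>g\<close> and \<open>L\<close>. The factor 1 gives its
      members the literal shape of the linear combination rules.\<close>
    define X where "X = {(\<lambda>e t. a * g e t + 1 * u e t) | a u. u \<in> L}"
    have mem: "(\<lambda>e t. a * g e t + 1 * u e t) \<in> X" if "u \<in> L" for a u unfolding X_def using that by blast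
    have "L \<subseteq> X"
    proof
      fix u assume "u \<in> L"
      from mem[OF this, of 0] show "u \<in> X" by simp
    qed
    have "X \<in> iso"
      unfolding iso_def
    proof (intro CollectI conjI ballI allI)
      show "D \<subseteq> X" using DL \<open>L \<subseteq> X\<close> by blast
      show "X \<subseteq> Ds" unfolding X_def using Ds_lin[OF g] LDs by blast
    next
      fix x y assume "x \<in> X" "y \<in> X"
      then obtain a u b v where x: "x = (\<lambda>e t. a * g e t + 1 * u e t)" "u \<in> L"
        and y: "y = (\<lambda>e t. b * g e t + 1 * v e t)" "v \<in> L" unfolding X_def by blast
      have Ds: "u \<in> Ds" "v \<in> Ds" using x y LDs by auto
      show "\<omega> x y = 0"
        unfolding x y using Ds g g0[OF x(2)] g0[OF y(2)] L_iso[OF x(2) y(2)] \<omega>_self[of g] \<omega>_skew[of g v]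
        by (simp only: \<omega>_lin \<omega>_lin' Ds_lin) simp
      fix p q
      have "(\<lambda>e t. p * x e t + q * y e t) = (\<lambda>e t. (p * a + q * b) * g e t + 1 * (p * u e t + q * v e t))"
        unfolding x y by (auto simp: fun_eq_iff algebra_simps)
      also have "\<dots> \<in> X" by (rule mem[OF L_lin[OF x(2) y(2)]])
      finally show "(\<lambda>e t. p * x e t + q * y e t) \<in> X" .
    qed
    from L(2)[OF this \<open>L \<subseteq> X\<close>] have "X = L" .
    moreover have "(\<lambda>e t. 1 * g e t + 1 * (0 * u0 e t + 0 * u0 e t)) \<in> X"
      using u0 DL by (intro mem L_lin) auto
    ultimately show "g \<in> L" by simp
  qed
  have "self_adjoint_op G L B"
    unfolding self_adjoint_op_def symmetric_op_def
  proof (intro conjI ballI allI impI)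
    show "L2 G u" "L2 G (B u)" if "u \<in> L" for u using that LDs Ds_L2 by blast+
    show "(\<lambda>e t. a * u e t + b * v e t) \<in> L" if "u \<in> L" "v \<in> L" for u v a b using L_lin that .
    show "ae_eq G (B (\<lambda>e t. a * u e t + b * v e t)) (\<lambda>e t. a * B u e t + b * B v e t)"
      if "u \<in> L" "v \<in> L" for u v a b using B_lin that LDs by blast
    show "dense_L2 G L" using dense DL unfolding dense_L2_def by (meson subsetD)
    show "l2inner G (B u) v = l2inner G u (B v)" if "u \<in> L" "v \<in> L" for u v
      using L_iso[OF that] unfolding \<omega>_def by simp
  next
    \<comment> \<open>As \<open>D \<subseteq> L\<close>, such a \<open>g\<close> lies in the domain
      of the adjoint of \<open>A\<close>, and \<open>h\<close> equals \<open>B g\<close> almost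
      everywhere; the equation for \<open>h\<close> then says that \<omega> vanishes between
      \<open>L\<close> and \<open>g\<close>.\<close>
    fix g assume "L2 G g \<and> (\<exists>h. L2 G h \<and> (\<forall>f\<in>L. l2inner G (B f) g = l2inner G f h))"
    then obtain h where h: "L2 G g" "L2 G h" "\<And>f. f \<in> L \<Longrightarrow> l2inner G (B f) g = l2inner G f h" by blast
    have "l2inner G (A f) g = l2inner G f h" if f: "f \<in> D" for f
    proof -
      have "l2inner G (A f) g = l2inner G (B f) g"
        using f D_Ds D_L2 Ds_L2 h(1) adj_unique[OF DA adjB] by (intro l2inner_cong) auto
      then show ?thesis using h(3) f DL by auto
    qed
    then have gh: "adj g h" unfolding adj_def using h by blast
    then have g: "g \<in> Ds" unfolding Ds_def by blast
    show "g \<in> L"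
    proof (rule complement[OF g])
      fix f assume f: "f \<in> L"
      have "l2inner G f (B g) = l2inner G f h"
        using l2inner_cong[OF Ds_L2(2)[OF g] h(2) _ adj_unique[OF adjB[OF g] gh], of f] Ds_L2(1) f LDs
        by (metis l2inner_commute subsetD)
      then show "\<omega> f g = 0" unfolding \<omega>_def using h(3)[OF f] by simp
    qed
  qed
  moreover have "ae_eq G (B u) (A u)" if "u \<in> D" for u
    using adj_unique[OF adjB DA] D_Ds that by blast
  ultimately show ?thesis unfolding has_self_adjoint_ext_def using DL by blast
qed

section \<open>Density of test functions\<close>

definition square_integrable :: "'a measure \<Rightarrow> ('a \<Rightarrow> real) \<Rightarrow> bool" where
  "square_integrable M w \<longleftrightarrow> w \<in> borel_measurable M \<and> integrable M (\<lambda>x. (w x)\<^sup>2)"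

definition L2_approximable :: "'a measure \<Rightarrow> ('a \<Rightarrow> real) set \<Rightarrow> ('a \<Rightarrow> real) \<Rightarrow> bool" where
  "L2_approximable M T w \<longleftrightarrow> square_integrable M w \<and> (\<forall>\<epsilon>>0. \<exists>q\<in>T. (\<integral>x. (w x - q x)\<^sup>2 \<partial>M) < \<epsilon>)"

text \<open>Squared distances obey \<open>(u + v)^2 \<le> 2 * u^2 + 2 * v^2\<close> in place of a
  triangle inequality; these factors 2 shape the constants in the approximation lemmas
  below.\<close>

lemma square_integrable_add:
  assumes "square_integrable M u" "square_integrable M v"
  shows "square_integrable M (\<lambda>x. u x + v x)"
    and "(\<integral>x. (u x + v x)\<^sup>2 \<partial>M) \<le> 2 * (\<integral>x. (u x)\<^sup>2 \<partial>M) + 2 * (\<integral>x. (v x)\<^sup>2 \<partial>M)"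
proof -
  have [measurable]: "u \<in> borel_measurable M" "v \<in> borel_measurable M"
    and int: "integrable M (\<lambda>x. (u x)\<^sup>2)" "integrable M (\<lambda>x. (v x)\<^sup>2)"
    using assms unfolding square_integrable_def by auto
  have le: "(u x + v x)\<^sup>2 \<le> 2 * (u x)\<^sup>2 + 2 * (v x)\<^sup>2" for x
    using sum_squares_bound[of "u x" "v x"] by (simp add: power2_sum)
  have i2: "integrable M (\<lambda>x. 2 * (u x)\<^sup>2 + 2 * (v x)\<^sup>2)" using int by simp
  have i: "integrable M (\<lambda>x. (u x + v x)\<^sup>2)"
    by (rule Bochner_Integration.integrable_bound[OF i2]) (use le in \<open>auto intro!: AE_I2\<close>)
  then show "square_integrable M (\<lambda>x. u x + v x)" unfolding square_integrable_def by simp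
  have "(\<integral>x. (u x + v x)\<^sup>2 \<partial>M) \<le> (\<integral>x. 2 * (u x)\<^sup>2 + 2 * (v x)\<^sup>2 \<partial>M)"
    using i i2 le by (intro integral_mono)
  then show "(\<integral>x. (u x + v x)\<^sup>2 \<partial>M) \<le> 2 * (\<integral>x. (u x)\<^sup>2 \<partial>M) + 2 * (\<integral>x. (v x)\<^sup>2 \<partial>M)"
    using int by simp
qed

lemma square_integrable_cmult:
  assumes "square_integrable M u"
  shows "square_integrable M (\<lambda>x. c * u x)"
  using assms unfolding square_integrable_def by (auto simp: power_mult_distrib intro!: borel_measurable_times)

lemma square_integrable_diff:
  assumes "square_integrable M u" "square_integrable M v"
  shows "square_integrable M (\<lambda>x. u x - v x)"
  using square_integrable_add(1)[OF assms(1) square_integrable_cmult[OF assms(2), of "-1"]] by simp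

lemma square_integrable_bound:
  assumes "square_integrable M v" "u \<in> borel_measurable M" "\<And>x. x \<in> space M \<Longrightarrow> \<bar>u x\<bar> \<le> \<bar>v x\<bar>"
  shows "square_integrable M u"
proof -
  have "integrable M (\<lambda>x. (v x)\<^sup>2)" using assms(1) unfolding square_integrable_def by blast
  then have "integrable M (\<lambda>x. (u x)\<^sup>2)"
    by (rule Bochner_Integration.integrable_bound)
      (use assms(2,3) in \<open>auto intro!: AE_I2 simp: abs_le_square_iff[symmetric]\<close>)
  then show ?thesis using assms(2) unfolding square_integrable_def by blast
qed

text \<open>\<open>T\<close> is a linear space of square integrable functions and
  \<open>approx\<close> is membership in its closure. An abstract measure space keeps the density
  argument free of edges and intervals.\<close>

locale L2_test =
  fixes M :: "'a measure" and T :: "('a \<Rightarrow> real) set"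
  assumes T_square: "q \<in> T \<Longrightarrow> square_integrable M q"
    and T_lin: "q \<in> T \<Longrightarrow> q' \<in> T \<Longrightarrow> (\<lambda>x. a * q x + b * q' x) \<in> T"
    and T_nonempty: "T \<noteq> {}"
begin

abbreviation "approx \<equiv> L2_approximable M T"

lemma approx_T: "q \<in> T \<Longrightarrow> approx q"
  unfolding L2_approximable_def using T_square by (auto intro!: bexI[of _ q])

lemma approx_closed:
  assumes w: "square_integrable M w"
    and "\<And>\<epsilon>. \<epsilon> > 0 \<Longrightarrow> \<exists>w'. approx w' \<and> (\<integral>x. (w x - w' x)\<^sup>2 \<partial>M) < \<epsilon>"
  shows "approx w"
  unfolding L2_approximable_def
proof (intro conjI w allI impI)
  fix \<epsilon> :: real assume "\<epsilon> > 0"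
  then obtain w' where w': "approx w'" "(\<integral>x. (w x - w' x)\<^sup>2 \<partial>M) < \<epsilon> / 4"
    using assms(2)[of "\<epsilon> / 4"] by auto
  then obtain q where q: "q \<in> T" "(\<integral>x. (w' x - q x)\<^sup>2 \<partial>M) < \<epsilon> / 4" and sq: "square_integrable M w'"
    unfolding L2_approximable_def using \<open>\<epsilon> > 0\<close> by (metis zero_less_divide_iff zero_less_numeral)
  have "(\<integral>x. (w x - q x)\<^sup>2 \<partial>M) = (\<integral>x. ((w x - w' x) + (w' x - q x))\<^sup>2 \<partial>M)" by simp
  also have "\<dots> \<le> 2 * (\<integral>x. (w x - w' x)\<^sup>2 \<partial>M) + 2 * (\<integral>x. (w' x - q x)\<^sup>2 \<partial>M)"
    by (intro square_integrable_add square_integrable_diff w sq T_square q)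
  also have "\<dots> < \<epsilon>" using w'(2) q(2) by simp
  finally show "\<exists>q\<in>T. (\<integral>x. (w x - q x)\<^sup>2 \<partial>M) < \<epsilon>" using q(1) by blast
qed

lemma approx_lincomb:
  assumes u: "approx u" and v: "approx v"
  shows "approx (\<lambda>x. a * u x + b * v x)"
  unfolding L2_approximable_def
proof (intro conjI allI impI)
  have su: "square_integrable M u" and sv: "square_integrable M v"
    using u v unfolding L2_approximable_def by auto
  then show "square_integrable M (\<lambda>x. a * u x + b * v x)"
    by (intro square_integrable_add square_integrable_cmult)
  fix \<epsilon> :: real assume \<epsilon>: "\<epsilon> > 0"
  \<comment> \<open>The squared error is at most \<open>2 * a^2 * c + 2 * b^2 * c\<close>; the added
    1 keeps \<open>c\<close> positive for \<open>a = b = 0\<close> and the final inequality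
    strict.\<close>
  define c where "c = \<epsilon> / (4 * (a\<^sup>2 + b\<^sup>2 + 1))"
  have pos: "a\<^sup>2 + b\<^sup>2 + 1 > 0" by (simp add: add_nonneg_pos)
  have c: "c > 0" unfolding c_def using \<epsilon> pos by simp
  obtain p q where p: "p \<in> T" "(\<integral>x. (u x - p x)\<^sup>2 \<partial>M) < c" and q: "q \<in> T" "(\<integral>x. (v x - q x)\<^sup>2 \<partial>M) < c"
    using u v c unfolding L2_approximable_def by blast
  have "(\<integral>x. (a * u x + b * v x - (a * p x + b * q x))\<^sup>2 \<partial>M) = (\<integral>x. (a * (u x - p x) + b * (v x - q x))\<^sup>2 \<partial>M)"
    by (simp add: algebra_simps)
  also have "\<dots> \<le> 2 * (\<integral>x. (a * (u x - p x))\<^sup>2 \<partial>M) + 2 * (\<integral>x. (b * (v x - q x))\<^sup>2 \<partial>M)"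
    by (intro square_integrable_add square_integrable_cmult square_integrable_diff su sv T_square p q)
  also have "\<dots> = 2 * a\<^sup>2 * (\<integral>x. (u x - p x)\<^sup>2 \<partial>M) + 2 * b\<^sup>2 * (\<integral>x. (v x - q x)\<^sup>2 \<partial>M)"
    by (simp add: power_mult_distrib)
  also have "\<dots> \<le> 2 * a\<^sup>2 * c + 2 * b\<^sup>2 * c"
    using p(2) q(2) by (intro add_mono mult_left_mono) auto
  also have "\<dots> < 4 * (a\<^sup>2 + b\<^sup>2 + 1) * c"
  proof -
    have "0 \<le> a\<^sup>2 * c" "0 \<le> b\<^sup>2 * c" using c by simp_all
    moreover have "4 * (a\<^sup>2 + b\<^sup>2 + 1) * c = 4 * (a\<^sup>2 * c) + 4 * (b\<^sup>2 * c) + 4 * c" by (simp add: algebra_simps)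
    ultimately show ?thesis using c unfolding mult.assoc by linarith
  qed
  also have "\<dots> = \<epsilon>" unfolding c_def using pos by simp
  finally show "\<exists>q\<in>T. (\<integral>x. (a * u x + b * v x - q x)\<^sup>2 \<partial>M) < \<epsilon>"
    by (rule bexI[OF _ T_lin[OF p(1) q(1)]])
qed

text \<open>Dominated convergence: the limit inherits the bound \<open>g\<close> almost everywhere,
  so the squared differences are dominated by \<open>4 * g^2\<close>.\<close>

lemma approx_limit:
  assumes W: "\<And>n::nat. approx (W n)" and w: "w \<in> borel_measurable M" and g: "square_integrable M g"
    and bound: "\<And>n x. x \<in> space M \<Longrightarrow> \<bar>W n x\<bar> \<le> g x" and lim: "AE x in M. (\<lambda>n. W n x) \<longlonglongrightarrow> w x"
  shows "approx w"
proof (rule approx_closed)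
  have Wm: "W n \<in> borel_measurable M" for n using W unfolding L2_approximable_def square_integrable_def by blast
  have wg: "AE x in M. \<bar>w x\<bar> \<le> g x"
    using lim AE_space
  proof eventually_elim
    fix x assume "(\<lambda>n. W n x) \<longlonglongrightarrow> w x" "x \<in> space M"
    then show "\<bar>w x\<bar> \<le> g x"
      using bound by (intro LIMSEQ_le_const2[OF tendsto_rabs]) auto
  qed
  have g2: "integrable M (\<lambda>x. (g x)\<^sup>2)" using g unfolding square_integrable_def by blast
  have w2: "integrable M (\<lambda>x. (w x)\<^sup>2)"
  proof (rule Bochner_Integration.integrable_bound[OF g2])
    show "AE x in M. norm ((w x)\<^sup>2) \<le> norm ((g x)\<^sup>2)"
      using wg by eventually_elim (simp add: abs_le_square_iff[symmetric])
  qed (use w in simp)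
  then show "square_integrable M w" using w unfolding square_integrable_def by blast
  have "(\<lambda>n. \<integral>x. (w x - W n x)\<^sup>2 \<partial>M) \<longlonglongrightarrow> (\<integral>x. 0 \<partial>M)"
  proof (rule integral_dominated_convergence[where w = "\<lambda>x. 4 * (g x)\<^sup>2"])
    show "AE x in M. norm ((w x - W n x)\<^sup>2) \<le> 4 * (g x)\<^sup>2" for n
      using wg AE_space
    proof eventually_elim
      fix x assume "\<bar>w x\<bar> \<le> g x" "x \<in> space M"
      then have "\<bar>w x - W n x\<bar> \<le> \<bar>2 * g x\<bar>" using bound[of x n] by linarith
      then have "(w x - W n x)\<^sup>2 \<le> (2 * g x)\<^sup>2" by (simp only: abs_le_square_iff)
      then show "norm ((w x - W n x)\<^sup>2) \<le> 4 * (g x)\<^sup>2" by (simp add: power_mult_distrib)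
    qed
    show "AE x in M. (\<lambda>n. (w x - W n x)\<^sup>2) \<longlonglongrightarrow> 0"
      using lim
    proof eventually_elim
      fix x assume "(\<lambda>n. W n x) \<longlonglongrightarrow> w x"
      then have "(\<lambda>n. (w x - W n x)\<^sup>2) \<longlonglongrightarrow> (w x - w x)\<^sup>2" by (intro tendsto_intros)
      then show "(\<lambda>n. (w x - W n x)\<^sup>2) \<longlonglongrightarrow> 0" by simp
    qed
  qed (use w Wm g2 in auto)
  then have "\<forall>\<^sub>F n in sequentially. (\<integral>x. (w x - W n x)\<^sup>2 \<partial>M) < \<epsilon>" if "\<epsilon> > 0" for \<epsilon>
    using that by (intro order_tendstoD) auto
  then show "\<exists>w'. approx w' \<and> (\<integral>x. (w x - w' x)\<^sup>2 \<partial>M) < \<epsilon>" if "\<epsilon> > 0" for \<epsilon>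
    using W that by (meson eventually_sequentially order_refl)
qed

lemma approx_zero: "approx (\<lambda>x. 0)"
proof -
  obtain q where "q \<in> T" using T_nonempty by blast
  then show ?thesis using approx_lincomb[OF approx_T approx_T, of q q 0 0] by simp
qed

text \<open>Induction over nonnegative measurable functions, with square integrability as a premise
  inside the induction: summands and members of an increasing sequence are dominated by the whole
  and inherit it. Signed functions split into positive and negative parts.\<close>

lemma approx_all:
  assumes ind: "\<And>A. A \<in> sets M \<Longrightarrow> approx (indicator A)"
    and w: "square_integrable M w"
  shows "approx w"
proof -
  have nonneg: "square_integrable M u \<longrightarrow> approx u" if "u \<in> borel_measurable M" "\<And>x. 0 \<le> u x" for u
    using that
  proof (induction rule: borel_measurable_induct_real)
    case (set A)
    then show ?case using ind by simp
  next
    case (mult u c)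
    show ?case
    \<comment> \<open>For \<open>c = 0\<close> square integrability of \<open>c * u\<close> says
      nothing about \<open>u\<close>, so the zero function is approximated directly.\<close>
    proof (cases "c = 0")
      case True
      then show ?thesis using approx_zero by simp
    next
      case False
      show ?thesis
      proof
        assume "square_integrable M (\<lambda>x. c * u x)"
        then have "square_integrable M (\<lambda>x. inverse c * (c * u x))" by (rule square_integrable_cmult)
        then have "square_integrable M u" using False by (simp add: mult.assoc[symmetric])
        then have "approx u" using mult by blast
        then show "approx (\<lambda>x. c * u x)" using approx_lincomb[of u u c 0] by simp
      qed
    qed
  next
    case (add u v)
    show ?case
    proof
      assume sq: "square_integrable M (\<lambda>x. v x + u x)"
      have "square_integrable M u" by (rule square_integrable_bound[OF sq]) (use add in auto)
      moreover have "square_integrable M v" by (rule square_integrable_bound[OF sq]) (use add in auto)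
      ultimately have "approx u" "approx v" using add by blast+
      then show "approx (\<lambda>x. v x + u x)" using approx_lincomb[of v u 1 1] by simp
    qed
  next
    case (seq U)
    show ?case
    proof
      assume sq: "square_integrable M u"
      have le: "U i x \<le> u x" if "x \<in> space M" for i x
      proof (rule incseq_le)
        show "incseq (\<lambda>i. U i x)" using seq(3) unfolding incseq_def le_fun_def by blast
      qed (rule seq(4)[OF that])
      show "approx u"
      proof (rule approx_limit[where W = U and g = u])
        show "approx (U n)" for n
        proof -
          have "square_integrable M (U n)"
          proof (rule square_integrable_bound[OF sq seq(1)])
            show "\<bar>U n x\<bar> \<le> \<bar>u x\<bar>" if "x \<in> space M" for x using le[OF that, of n] seq(2)[of n x] by linarith
          qed
          then show ?thesis using seq(5) by blast
        qed
        show "u \<in> borel_measurable M" using sq unfolding square_integrable_def by blast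
        show "\<bar>U n x\<bar> \<le> u x" if "x \<in> space M" for n x using le[OF that] seq(2) by simp
        show "AE x in M. (\<lambda>n. U n x) \<longlonglongrightarrow> u x" using seq(4) by (intro AE_I2)
      qed (rule sq)
    qed
  qed
  have wm: "w \<in> borel_measurable M" using w unfolding square_integrable_def by blast
  have "approx (\<lambda>x. max 0 (w x))"
    using wm by (intro nonneg[rule_format] square_integrable_bound[OF w]) auto
  moreover have "approx (\<lambda>x. max 0 (- w x))"
    using wm by (intro nonneg[rule_format] square_integrable_bound[OF w]) auto
  ultimately have "approx (\<lambda>x. 1 * max 0 (w x) + (-1) * max 0 (- w x))" by (rule approx_lincomb)
  moreover have "(\<lambda>x. 1 * max 0 (w x) + (-1) * max 0 (- w x)) = w" by (auto simp: fun_eq_iff max_def)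
  ultimately show ?thesis by simp
qed

text \<open>Sets with approximable indicator form a Dynkin system: complements use the constant 1,
  and countable disjoint unions use dominated convergence with bound 1, square integrable as
  \<open>M\<close> is finite. A generator stable under intersection therefore suffices.\<close>

lemma approx_indicator:
  assumes fin: "finite_measure M" and M: "sets M = sigma_sets UNIV \<G>" "Int_stable \<G>" "\<G> \<subseteq> Pow UNIV"
    and basic: "\<And>A. A \<in> \<G> \<Longrightarrow> approx (indicator A)" and space: "approx (\<lambda>x. 1)"
    and A: "A \<in> sets M"
  shows "approx (indicator A)"
  using M(2,3) A[unfolded M(1)]
proof (induction rule: sigma_sets_induct_disjoint)
  interpret finite_measure M by (rule fin)
  have one: "square_integrable M (\<lambda>x. 1)" unfolding square_integrable_def by simp
  {
    case (basic A)
    then show ?case using assms(5) by blast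
  next
    case empty
    then show ?case using approx_zero by simp
  next
    case (compl A)
    have "approx (\<lambda>x. 1 * 1 + (-1) * indicator A x)"
      using compl space by (intro approx_lincomb)
    moreover have "(\<lambda>x. 1 * 1 + (-1) * indicator A x) = indicat_real (UNIV - A)"
      by (auto simp: fun_eq_iff indicator_def)
    ultimately show ?case by simp
  next
    case (union A)
    have A_sets: "A i \<in> sets M" for i using union(2) unfolding M(1) by blast
    have "approx (indicator (\<Union>i<n. A i))" for n :: nat
    proof (induction n)
      case 0
      then show ?case using approx_zero by simp
    next
      case (Suc n)
      have "A i \<inter> A n = {}" if "i < n" for i
        using disjoint_family_onD[OF union(1), of i n] that by simp
      then have "(\<Union>i<n. A i) \<inter> A n = {}" by blast
      then have "indicator (\<Union>i<Suc n. A i) = (\<lambda>x. 1 * indicat_real (\<Union>i<n. A i) x + 1 * indicat_real (A n) x)"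
        by (auto simp: fun_eq_iff lessThan_Suc indicator_def)
      then show ?case using approx_lincomb[OF Suc union(3)[of n], of 1 1] by simp
    qed
    then show ?case
    proof (rule approx_limit[where g = "\<lambda>_. 1"])
      show "AE x in M. (\<lambda>n. indicat_real (\<Union>i<n. A i) x) \<longlonglongrightarrow> indicat_real (\<Union>i. A i) x"
        by (intro AE_I2 LIMSEQ_indicator_UN)
      show "indicat_real (\<Union>i. A i) \<in> borel_measurable M" using A_sets by auto
    qed (auto simp: one indicator_def)
  }
qed

end

text \<open>Two continuous derivatives on the whole line are what \<open>Dmax\<close> asks for
  without one-sided cases. The bounds \<alpha> and \<beta> are kept because \<alpha> and
  \<open>l - \<beta>\<close> later give the size of a neighbourhood of the boundary on which the
  function vanishes.\<close>

definition test_fns :: "real \<Rightarrow> (real \<Rightarrow> real) set" where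
  "test_fns l = {q. \<exists>q' q'' \<alpha> \<beta>. 0 < \<alpha> \<and> \<beta> < l \<and> (\<forall>t. t \<notin> {\<alpha>..\<beta>} \<longrightarrow> q t = 0)
     \<and> (\<forall>t. (q has_real_derivative q' t) (at t)) \<and> (\<forall>t. (q' has_real_derivative q'' t) (at t))
     \<and> continuous_on UNIV q''}"

lemma test_fns_lincomb:
  assumes "p \<in> test_fns l" "q \<in> test_fns l"
  shows "(\<lambda>t. a * p t + b * q t) \<in> test_fns l"
proof -
  obtain p' p'' \<alpha> \<beta> where p: "0 < \<alpha>" "\<beta> < l" "\<And>t. t \<notin> {\<alpha>..\<beta>} \<Longrightarrow> p t = 0"
     "\<And>t. (p has_real_derivative p' t) (at t)" "\<And>t. (p' has_real_derivative p'' t) (at t)" "continuous_on UNIV p''"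
    using assms(1) unfolding test_fns_def by blast
  obtain q' q'' \<gamma> \<delta> where q: "0 < \<gamma>" "\<delta> < l" "\<And>t. t \<notin> {\<gamma>..\<delta>} \<Longrightarrow> q t = 0"
     "\<And>t. (q has_real_derivative q' t) (at t)" "\<And>t. (q' has_real_derivative q'' t) (at t)" "continuous_on UNIV q''"
    using assms(2) unfolding test_fns_def by blast
  show ?thesis
    unfolding test_fns_def
  proof (intro CollectI exI conjI allI impI)
    show "0 < min \<alpha> \<gamma>" "max \<beta> \<delta> < l" using p q by auto
    show "a * p t + b * q t = 0" if "t \<notin> {min \<alpha> \<gamma>..max \<beta> \<delta>}" for t
    proof -
      have "t \<notin> {\<alpha>..\<beta>}" "t \<notin> {\<gamma>..\<delta>}" using that by (auto simp: min_def max_def split: if_splits)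
      then show ?thesis using p(3) q(3) by simp
    qed
    show "((\<lambda>t. a * p t + b * q t) has_real_derivative a * p' t + b * q' t) (at t)" for t
      by (intro DERIV_add DERIV_cmult p q)
    show "((\<lambda>t. a * p' t + b * q' t) has_real_derivative a * p'' t + b * q'' t) (at t)" for t
      by (intro DERIV_add DERIV_cmult p q)
    show "continuous_on UNIV (\<lambda>t. a * p'' t + b * q'' t)"
      by (intro continuous_intros p q)
  qed
qed

lemma zero_test_fns: "l > 0 \<Longrightarrow> (\<lambda>t. 0) \<in> test_fns l"
  unfolding test_fns_def
  by (intro CollectI exI[of _ "\<lambda>t. 0"] exI[of _ "l / 2"] conjI) (auto intro!: derivative_eq_intros)

lemma test_fns_continuous: "q \<in> test_fns l \<Longrightarrow> continuous_on S q"
  unfolding test_fns_def by (auto intro!: continuous_at_imp_continuous_on dest: DERIV_isCont)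

text \<open>Away from 0 this is the power rule; at 0 the difference quotient is itself a power of
  \<open>max 0 x\<close> with exponent lowered by one, and tends to 0.\<close>

lemma DERIV_max_0_power:
  "((\<lambda>x::real. max 0 x ^ Suc (Suc k)) has_real_derivative real (Suc (Suc k)) * max 0 x ^ Suc k) (at x)"
proof -
  consider "x < 0" | "x > 0" | "x = 0" by linarith
  then show ?thesis
  proof cases
    case 1
    have "((\<lambda>x::real. 0) has_real_derivative 0) (at x)" by simp
    then have "((\<lambda>x::real. max 0 x ^ Suc (Suc k)) has_real_derivative 0) (at x)"
      by (rule has_field_derivative_transform_within_open[of _ _ _ "{..<0}"]) (use 1 in auto)
    then show ?thesis using 1 by simp
  next
    case 2
    have "((\<lambda>x::real. x ^ Suc (Suc k)) has_real_derivative real (Suc (Suc k)) * x ^ Suc k) (at x)"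
      by (rule derivative_eq_intros refl)+ simp
    then have "((\<lambda>x::real. max 0 x ^ Suc (Suc k)) has_real_derivative real (Suc (Suc k)) * x ^ Suc k) (at x)"
      by (rule has_field_derivative_transform_within_open[of _ _ _ "{0<..}"]) (use 2 in auto)
    then show ?thesis using 2 by simp
  next
    case 3
    have "((\<lambda>y::real. max 0 y ^ Suc k) \<longlongrightarrow> max 0 0 ^ Suc k) (at 0)"
      by (intro tendsto_intros)
    moreover have "\<forall>\<^sub>F y::real in at 0. max 0 y ^ Suc k = (max 0 y ^ Suc (Suc k) - max 0 0 ^ Suc (Suc k)) / (y - 0)"
      by (auto simp: eventually_at_filter max_def)
    ultimately show ?thesis unfolding 3 has_field_derivative_iff
      by (auto intro: Lim_transform_eventually)
  qed
qed

lemma DERIV_max_0_chain: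
  assumes "(g has_real_derivative g') (at x)"
  shows "((\<lambda>x. max 0 (g x) ^ 2) has_real_derivative 2 * max 0 (g x) * g') (at x)"
    and "((\<lambda>x. max 0 (g x) ^ 3) has_real_derivative 3 * max 0 (g x) ^ 2 * g') (at x)"
  using DERIV_chain2[OF DERIV_max_0_power[of 0 "g x"] assms] DERIV_chain2[OF DERIV_max_0_power[of 1 "g x"] assms]
  by (simp_all add: numeral_2_eq_2 numeral_3_eq_3)

text \<open>Positive exactly where \<open>t * (c - t)\<close> exceeds \<open>1 / (n + 1)\<close>,
  hence supported in a compact part of \<open>{0<..<c}\<close> for positive \<open>c\<close>. The
  cube makes the truncation twice continuously differentiable, and the exponential keeps the values
  in \<open>{0..1}\<close> while they tend to 1 on \<open>{0<..<c}\<close>.\<close>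

definition bump :: "real \<Rightarrow> nat \<Rightarrow> real \<Rightarrow> real" where
  "bump c n t = 1 - exp (- (max 0 (real (Suc n) * (t * (c - t)) - 1) ^ 3))"

lemma bump_test_fns:
  assumes "0 < c" "c \<le> l"
  shows "bump c n \<in> test_fns l"
proof -
  define k where "k = real (Suc n)"
  have k: "k > 0" unfolding k_def by simp
  define g where "g t = k * (t * (c - t)) - 1" for t
  define g' where "g' t = k * (c - 2 * t)" for t
  define m where "m t = max 0 (g t)" for t
  have g: "(g has_real_derivative g' t) (at t)" for t
    unfolding g_def g'_def by (auto intro!: derivative_eq_intros simp: algebra_simps)
  have g': "(g' has_real_derivative (- 2 * k)) (at t)" for t
    unfolding g'_def by (auto intro!: derivative_eq_intros simp: algebra_simps)
  note m = DERIV_max_0_chain[OF g, folded m_def]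
  have eq: "bump c n = (\<lambda>t. 1 - exp (- (m t ^ 3)))"
    unfolding bump_def m_def g_def k_def by simp
  show ?thesis
    unfolding test_fns_def
  proof (intro CollectI exI conjI allI impI)
    \<comment> \<open>A nonzero value forces \<open>k * c * t > 1\<close> and
      \<open>k * c * (c - t) > 1\<close>, which gives the two ends of the support.\<close>
    have "0 < 1 / (k * c)" using assms k by simp
    then show "0 < 1 / (k * c)" "c - 1 / (k * c) < l" using assms by linarith+
    show "bump c n t = 0" if t: "t \<notin> {1 / (k * c)..c - 1 / (k * c)}" for t
    proof -
      have kc: "k * c > 0" using k assms by simp
      have "k * (t * (c - t)) \<le> 1"
      proof (cases "0 < t \<and> t < c")
        case False
        then have "t * (c - t) \<le> 0" using assms by (auto simp: mult_le_0_iff)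
        then have "k * (t * (c - t)) \<le> 0" using k by (simp add: mult_le_0_iff)
        then show ?thesis by simp
      next
        case True
        have "t < 1 / (k * c) \<or> c - t < 1 / (k * c)" using t by auto
        then have "(k * c) * t < 1 \<or> (k * c) * (c - t) < 1"
          using kc by (auto simp: pos_less_divide_eq mult.commute)
        moreover have "k * (t * (c - t)) \<le> (k * c) * t" "k * (t * (c - t)) \<le> (k * c) * (c - t)"
          using True k by (auto simp: mult.assoc mult.commute[of t] intro!: mult_left_mono mult_right_mono)
        ultimately show ?thesis by linarith
      qed
      then have "m t = 0" unfolding m_def g_def by simp
      then show ?thesis unfolding eq by simp
    qed
    show d1: "(bump c n has_real_derivative exp (- (m t ^ 3)) * (3 * (m t)\<^sup>2 * g' t)) (at t)" for t
      unfolding eq by (rule derivative_eq_intros m refl)+ simp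
    show "((\<lambda>t. exp (- (m t ^ 3)) * (3 * (m t)\<^sup>2 * g' t)) has_real_derivative
        (- (3 * (m t)\<^sup>2 * g' t) * exp (- (m t ^ 3))) * (3 * (m t)\<^sup>2 * g' t)
        + exp (- (m t ^ 3)) * (3 * (2 * m t * g' t) * g' t + 3 * (m t)\<^sup>2 * (- 2 * k))) (at t)" for t
      by (rule derivative_eq_intros m g' refl)+ (simp add: algebra_simps)
    show "continuous_on UNIV (\<lambda>t. (- (3 * (m t)\<^sup>2 * g' t) * exp (- (m t ^ 3))) * (3 * (m t)\<^sup>2 * g' t)
        + exp (- (m t ^ 3)) * (3 * (2 * m t * g' t) * g' t + 3 * (m t)\<^sup>2 * (- 2 * k)))"
      unfolding m_def g_def g'_def by (intro continuous_intros)
  qed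
qed

lemma bump_bounds: "0 \<le> bump c n t" "bump c n t \<le> 1"
  unfolding bump_def by auto

lemma bump_outside: "t \<notin> {0<..<c} \<Longrightarrow> 0 < c \<Longrightarrow> bump c n t = 0"
proof -
  assume "t \<notin> {0<..<c}" "0 < c"
  then have "t * (c - t) \<le> 0" by (auto simp: mult_le_0_iff)
  then have "real (Suc n) * (t * (c - t)) \<le> 0" by (metis mult_le_0_iff of_nat_0_le_iff)
  then show ?thesis unfolding bump_def by simp
qed

lemma bump_tendsto:
  assumes "t \<in> {0<..<c}"
  shows "(\<lambda>n. bump c n t) \<longlonglongrightarrow> 1"
proof -
  have pos: "t * (c - t) > 0" using assms by simp
  have "filterlim (\<lambda>n. real (Suc n)) at_top sequentially"
    by (rule filterlim_compose[OF filterlim_real_sequentially filterlim_Suc])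
  then have "filterlim (\<lambda>n. (t * (c - t)) * real (Suc n)) at_top sequentially"
    using pos by (intro filterlim_tendsto_pos_mult_at_top[OF tendsto_const])
  then have "filterlim (\<lambda>n. - 1 + (t * (c - t)) * real (Suc n)) at_top sequentially"
    by (intro filterlim_tendsto_add_at_top[OF tendsto_const])
  then have "filterlim (\<lambda>n. max 0 (real (Suc n) * (t * (c - t)) - 1)) at_top sequentially"
    by (rule filterlim_at_top_mono) (auto simp: mult.commute)
  then have "filterlim (\<lambda>n. max 0 (real (Suc n) * (t * (c - t)) - 1) ^ 3) at_top sequentially"
    by (intro filterlim_pow_at_top) auto
  then have "filterlim (\<lambda>n. - (max 0 (real (Suc n) * (t * (c - t)) - 1) ^ 3)) at_bot sequentially"
    by (simp add: filterlim_uminus_at_bot)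
  then have "(\<lambda>n. exp (- (max 0 (real (Suc n) * (t * (c - t)) - 1) ^ 3))) \<longlonglongrightarrow> 0"
    by (rule filterlim_compose[OF exp_at_bot])
  then have "(\<lambda>n. 1 - exp (- (max 0 (real (Suc n) * (t * (c - t)) - 1) ^ 3))) \<longlonglongrightarrow> 1 - 0"
    by (intro tendsto_intros)
  then show ?thesis unfolding bump_def by simp
qed

text \<open>Half-lines generate the Borel sets, and inside \<open>{0<..<l}\<close> a half-line
  \<open>{..<c}\<close> with positive \<open>c\<close> is the interval on which the bumps for
  \<open>min c l\<close> tend to 1. So the closure of the test functions contains all indicators,
  hence all of L2.\<close>

lemma test_fns_dense:
  assumes l: "l > 0" and w: "set_borel_measurable lborel {0..l} w" "set_integrable lborel {0..l} (\<lambda>t. (w t)\<^sup>2)"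
    and "\<epsilon> > 0"
  shows "\<exists>q\<in>test_fns l. (LINT t:{0..l}|lborel. (w t - q t)\<^sup>2) < \<epsilon>"
proof -
  \<comment> \<open>A density on the whole line: the space stays \<open>UNIV\<close>, so
    measurability for \<open>M\<close> is Borel measurability and the half-lines are a
    generator.\<close>
  define M where "M = density lborel (\<lambda>t. ennreal (indicat_real {0..l} t))"
  have sets_M: "sets M = sets borel" and space_M: "space M = UNIV" unfolding M_def by simp_all
  have bm: "f \<in> borel_measurable M \<longleftrightarrow> f \<in> borel_measurable borel" for f :: "real \<Rightarrow> real"
    using sets_M by (simp cong: measurable_cong_sets)
  have int: "integrable M f \<longleftrightarrow> set_integrable lborel {0..l} f" if "f \<in> borel_measurable borel" for f :: "real \<Rightarrow> real"
    unfolding M_def set_integrable_def using that by (subst integrable_density) auto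
  have ae: "AE t in M. P t" if "\<And>t. t \<in> {0<..<l} \<Longrightarrow> P t" for P
  proof -
    have "AE t in lborel. 0 < ennreal (indicat_real {0..l} t) \<longrightarrow> P t"
      using AE_lborel_singleton[of 0] AE_lborel_singleton[of l]
      by eventually_elim (use that in \<open>auto simp: indicator_def split: if_splits\<close>)
    then show ?thesis unfolding M_def by (subst AE_density) auto
  qed
  have fin: "finite_measure M"
  proof (rule finite_measureI)
    have "(\<integral>\<^sup>+ t. ennreal (indicat_real {0..l} t) \<partial>lborel) = (\<integral>\<^sup>+ t. indicator {0..l} t \<partial>lborel)"
      by (simp add: ennreal_indicator)
    also have "\<dots> = ennreal l" using l by (simp del: nn_integral_indicator add: nn_integral_indicator)
    finally show "emeasure M (space M) \<noteq> \<infinity>" unfolding M_def by (simp add: emeasure_density)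
  qed
  have sq: "square_integrable M q" if "continuous_on UNIV q" for q
  proof -
    have "q \<in> borel_measurable borel" using that by (rule borel_measurable_continuous_onI)
    moreover have "set_integrable lborel {0..l} (\<lambda>t. (q t)\<^sup>2)"
      by (intro borel_integrable_atLeastAtMost' continuous_intros continuous_on_subset[OF that]) auto
    ultimately show ?thesis unfolding square_integrable_def by (simp add: bm int)
  qed
  interpret L2_test M "test_fns l"
    by standard (use zero_test_fns[OF l] in \<open>auto intro!: sq test_fns_continuous test_fns_lincomb\<close>)
  have step: "approx f" if c: "0 < c" "c \<le> l" and f: "f \<in> borel_measurable borel"
    "\<And>t. t \<in> {0<..<l} \<Longrightarrow> f t = (if t < c then 1 else 0)" for c f
  proof (rule approx_limit[where W = "bump c" and g = "\<lambda>_. 1"])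
    show "AE t in M. (\<lambda>n. bump c n t) \<longlonglongrightarrow> f t"
    proof (rule ae)
      fix t assume t: "t \<in> {0<..<l}"
      show "(\<lambda>n. bump c n t) \<longlonglongrightarrow> f t"
        using bump_tendsto[of t c] bump_outside[of t c] f(2)[OF t] c(1) t by (cases "t < c") auto
    qed
    show "approx (bump c n)" for n by (intro approx_T bump_test_fns c)
    show "f \<in> borel_measurable M" using f(1) by (simp add: bm)
    show "square_integrable M (\<lambda>_. 1)" by (intro sq continuous_on_const)
    show "\<bar>bump c n x\<bar> \<le> 1" for n x using bump_bounds[of c n x] by linarith
  qed
  have Iio: "approx (indicator {..<c})" for c
  proof (cases "c \<le> 0")
    case True
    show ?thesis
      by (rule approx_limit[where W = "\<lambda>_ _. 0" and g = "\<lambda>_. 0"])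
        (use True in \<open>auto simp: bm approx_zero intro!: sq ae\<close>)
  next
    case False
    show ?thesis by (rule step[of "min c l"]) (use False l in \<open>auto simp: indicator_def\<close>)
  qed
  have one: "approx (\<lambda>_. 1)" by (rule step[of l]) (use l in auto)
  have ind: "approx (indicator A)" if "A \<in> sets M" for A
  proof (rule approx_indicator[OF fin _ _ _ _ one that])
    show "sets M = sigma_sets UNIV (range lessThan)" unfolding sets_M borel_Iio by (simp add: sets_measure_of)
    show "Int_stable (range lessThan :: real set set)"
    proof (rule Int_stableI)
      fix A B :: "real set" assume "A \<in> range lessThan" "B \<in> range lessThan"
      then obtain a b where "A = {..<a}" "B = {..<b}" by blast
      then have "A \<inter> B = {..<min a b}" by auto
      then show "A \<inter> B \<in> range lessThan" by blast
    qed
  qed (use Iio in auto)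
  \<comment> \<open>Measurability of \<open>w\<close> is known on \<open>{0..l}\<close> only;
    cutting it off outside gives a Borel function without changing integrals over
    \<open>{0..l}\<close>.\<close>
  define w0 where "w0 t = indicat_real {0..l} t *\<^sub>R w t" for t
  have w0: "w0 \<in> borel_measurable borel" using w(1) unfolding set_borel_measurable_def w0_def by simp
  have "set_integrable lborel {0..l} (\<lambda>t. (w0 t)\<^sup>2)"
    using w(2) unfolding set_integrable_def w0_def by (rule back_subst[of "integrable lborel"]) (auto simp: indicator_def)
  then have "square_integrable M w0" unfolding square_integrable_def using w0 by (simp add: bm int)
  then have "approx w0" using approx_all[OF ind] by blast
  then obtain q where q: "q \<in> test_fns l" "(\<integral>t. (w0 t - q t)\<^sup>2 \<partial>M) < \<epsilon>"
    unfolding L2_approximable_def using \<open>\<epsilon> > 0\<close> by blast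
  have qm: "q \<in> borel_measurable borel" using test_fns_continuous[OF q(1)] by (rule borel_measurable_continuous_onI)
  have "(\<integral>t. (w0 t - q t)\<^sup>2 \<partial>M) = (LINT t|lborel. indicat_real {0..l} t *\<^sub>R (w0 t - q t)\<^sup>2)"
    unfolding M_def using w0 qm by (subst integral_density) auto
  also have "\<dots> = (LINT t:{0..l}|lborel. (w t - q t)\<^sup>2)"
    unfolding set_lebesgue_integral_def w0_def by (rule Bochner_Integration.integral_cong) (auto simp: indicator_def)
  finally show ?thesis using q by auto
qed

text \<open>All but finitely many edges together carry less than \<open>\<epsilon> / 2\<close> of
  the squared norm and receive the zero function; the remaining ones are approximated one by
  one.\<close>

lemma dense_L2_test_fns:
  fixes G :: "('v, 'e, 'z) mgraph_scheme"
  assumes len: "\<And>e. 0 < len G e"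
    and lin: "\<And>u v a b. u \<in> D \<Longrightarrow> v \<in> D \<Longrightarrow> (\<lambda>e t. a * u e t + b * v e t) \<in> D"
    and test: "\<And>e0 q. q \<in> test_fns (len G e0) \<Longrightarrow> (\<lambda>e t. if e = e0 then q t else 0) \<in> D"
  shows "dense_L2 G D"
  unfolding dense_L2_def
proof (intro allI impI)
  fix u and \<epsilon> :: real assume u: "L2 G u" and \<epsilon>: "\<epsilon> > 0"
  define s where "s e = (LINT t:{0..len G e}|lborel. (u e t)\<^sup>2)" for e
  have s: "s summable_on UNIV" using u unfolding L2_iff s_def by blast
  have "(sum s \<longlongrightarrow> infsum s UNIV) (finite_subsets_at_top UNIV)"
    using s has_sum_def has_sum_infsum by blast
  then have "\<forall>\<^sub>F F in finite_subsets_at_top UNIV. infsum s UNIV - \<epsilon> / 2 < sum s F"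
    by (rule order_tendstoD) (use \<epsilon> in simp)
  then obtain F where F: "finite F" "infsum s UNIV - \<epsilon> / 2 < sum s F"
    unfolding eventually_finite_subsets_at_top by blast
  \<comment> \<open>Makes the total error over \<open>F\<close> at most
    \<open>\<epsilon> / 2\<close>; the added 1 covers an empty \<open>F\<close>.\<close>
  define \<eta> where "\<eta> = \<epsilon> / (2 * (real (card F) + 1))"
  have \<eta>: "\<eta> > 0" unfolding \<eta>_def using \<epsilon> by simp
  have "\<exists>q\<in>test_fns (len G e). (LINT t:{0..len G e}|lborel. (u e t - q t)\<^sup>2) < \<eta>" for e
    using u \<eta> unfolding L2_iff by (intro test_fns_dense[OF len]) auto
  then obtain q where q: "\<And>e. q e \<in> test_fns (len G e)"
    "\<And>e. (LINT t:{0..len G e}|lborel. (u e t - q e t)\<^sup>2) < \<eta>" by metis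
  have vD: "(\<lambda>e t. if e \<in> F then q e t else 0) \<in> D" using F(1)
  proof induction
    case empty
    show ?case using lin[OF test[OF q(1)] test[OF q(1)], where a = 0 and b = 0] by simp
  next
    case (insert e0 F)
    have "(\<lambda>e t. if e \<in> insert e0 F then q e t else 0) =
      (\<lambda>e t. 1 * (if e = e0 then q e0 t else 0) + 1 * (if e \<in> F then q e t else 0))"
      using insert by (auto simp: fun_eq_iff)
    also have "\<dots> \<in> D" by (rule lin[OF test[OF q(1)] insert.IH])
    finally show ?case .
  qed
  define v where "v = (\<lambda>e t. if e \<in> F then q e t else 0)"
  define r where "r e = (LINT t:{0..len G e}|lborel. (u e t - v e t) * (u e t - v e t))" for e
  have r_out: "r e = s e" if "e \<in> - F" for e using that unfolding r_def s_def v_def by (simp add: power2_eq_square)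
  have r_in: "r e \<le> \<eta>" if "e \<in> F" for e using that q(2)[of e] unfolding r_def v_def by (simp add: power2_eq_square)
  have sF: "s summable_on (- F)" using s by (rule summable_on_subset_banach) simp
  have "r summable_on (- F) \<longleftrightarrow> s summable_on (- F)" by (rule summable_on_cong) (rule r_out)
  with sF have rF: "r summable_on (- F)" by simp
  have "infsum r UNIV = sum r F + infsum r (- F)"
    using infsum_Un_disjoint[of r F "- F"] rF F(1) by simp
  moreover have "infsum r (- F) = infsum s (- F)" using r_out by (rule infsum_cong)
  moreover have "infsum s UNIV = sum s F + infsum s (- F)"
    using infsum_Un_disjoint[of s F "- F"] sF F(1) by simp
  moreover have "sum r F \<le> real (card F) * \<eta>" using r_in by (rule sum_bounded_above)
  moreover have "real (card F) * \<eta> \<le> \<epsilon> / 2" unfolding \<eta>_def using \<epsilon> by (simp add: field_simps)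
  ultimately have "infsum r UNIV < \<epsilon>" using F(2) by linarith
  then have "l2inner G (\<lambda>e t. u e t - v e t) (\<lambda>e t. u e t - v e t) < \<epsilon>"
    unfolding l2inner_def r_def by simp
  then show "\<exists>v\<in>D. l2inner G (\<lambda>e t. u e t - v e t) (\<lambda>e t. u e t - v e t) < \<epsilon>"
    using vD[folded v_def] by (rule bexI)
qed

section \<open>Geometry of the completed graph\<close>

locale completed_graph =
  fixes G :: "('v, 'e) mgraph" and \<iota> :: "('v, 'e) gpoint \<Rightarrow> 'm::metric_space"
  assumes graph: "metric_graph G" and compl: "is_completion G \<iota>"
begin

lemma len_pos: "0 < len G e"
  and finite_incident: "finite {e. src G e = v \<or> tgt G e = v}"
  and walk_exists: "\<exists>L. walk G u w L"
  using graph unfolding metric_graph_def by auto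

lemma finite_src: "finite {e. src G e = v}" and finite_tgt: "finite {e. tgt G e = v}"
  using finite_incident[of v] by (auto elim: rev_finite_subset)

lemma walk_nonneg: "walk G u w L \<Longrightarrow> 0 \<le> L"
  by (induction rule: walk.induct) (use len_pos in \<open>auto intro!: add_pos_nonneg less_imp_le\<close>)

lemma vdist_le: "walk G u w L \<Longrightarrow> vdist G u w \<le> L"
  unfolding vdist_def by (intro cInf_lower bdd_belowI[of _ 0]) (use walk_nonneg in auto)

lemma le_vdist: "(\<And>L. walk G u w L \<Longrightarrow> c \<le> L) \<Longrightarrow> c \<le> vdist G u w"
  unfolding vdist_def by (intro cInf_greatest) (use walk_exists in auto)

lemma vdist_nonneg: "0 \<le> vdist G u w"
  by (intro le_vdist walk_nonneg)

lemma vdist_self: "vdist G u u = 0"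
  using vdist_le[OF walk.nil, of u] vdist_nonneg[of u u] by simp

text \<open>Strictly within this distance of \<open>v\<close> there is no other vertex and no point
  off the edges at \<open>v\<close>. It is positive by local finiteness; the element 1 keeps the
  minimum defined at a vertex without edges.\<close>

definition star_radius :: "'v \<Rightarrow> real" where
  "star_radius v = Min (insert 1 (len G ` {e. src G e = v \<or> tgt G e = v}))"

lemma star_radius_pos: "0 < star_radius v"
  unfolding star_radius_def using finite_incident len_pos by auto

lemma star_radius_le: "src G e = v \<or> tgt G e = v \<Longrightarrow> star_radius v \<le> len G e"
  unfolding star_radius_def using finite_incident by (intro Min_le) auto

lemma star_radius_le_vdist:
  assumes "v \<noteq> w"
  shows "star_radius v \<le> vdist G v w"
proof (rule le_vdist)
  fix L assume "walk G v w L"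
  then show "star_radius v \<le> L"
  proof cases
    case nil
    then show ?thesis using assms by simp
  next
    case (fwd e L')
    then show ?thesis using star_radius_le[of e v] walk_nonneg[of _ _ L'] by fastforce
  next
    case (bwd e L')
    then show ?thesis using star_radius_le[of e v] walk_nonneg[of _ _ L'] by fastforce
  qed
qed

lemma gdist_lessD:
  assumes "gdist G x y < r"
  shows "(\<exists>u a w b. (u, a) \<in> anchors G x \<and> (w, b) \<in> anchors G y \<and> a + vdist G u w + b < r)
    \<or> (\<exists>d\<in>direct x y. d < r)"
proof -
  have "anchors G x \<noteq> {}" "anchors G y \<noteq> {}" by (cases x; simp) (cases y; simp)
  then have "{a + vdist G u w + b | u a w b. (u, a) \<in> anchors G x \<and> (w, b) \<in> anchors G y} \<noteq> {}" by fast
  then have "{a + vdist G u w + b | u a w b. (u, a) \<in> anchors G x \<and> (w, b) \<in> anchors G y} \<union> direct x y \<noteq> {}"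
    by simp
  from cInf_lessD[OF this assms[unfolded gdist_def]] show ?thesis by blast
qed

lemma anchors_nonneg: "x \<in> gpoints G \<Longrightarrow> (u, a) \<in> anchors G x \<Longrightarrow> 0 \<le> a"
  unfolding gpoints_def by auto

lemma direct_nonneg: "d \<in> direct x y \<Longrightarrow> 0 \<le> d"
  by (cases "(x, y)" rule: direct.cases) (auto split: if_splits)

lemma gdist_le:
  assumes "x \<in> gpoints G" "y \<in> gpoints G"
  shows "(u, a) \<in> anchors G x \<Longrightarrow> (w, b) \<in> anchors G y \<Longrightarrow> gdist G x y \<le> a + vdist G u w + b"
    and "d \<in> direct x y \<Longrightarrow> gdist G x y \<le> d"
proof -
  have bdd: "bdd_below ({a + vdist G u w + b | u a w b. (u, a) \<in> anchors G x \<and> (w, b) \<in> anchors G y} \<union> direct x y)"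
  proof (rule bdd_belowI[of _ 0])
    fix d assume "d \<in> {a + vdist G u w + b | u a w b. (u, a) \<in> anchors G x \<and> (w, b) \<in> anchors G y} \<union> direct x y"
    then consider u a w b where "(u, a) \<in> anchors G x" "(w, b) \<in> anchors G y" "d = a + vdist G u w + b"
      | "d \<in> direct x y" by blast
    then show "0 \<le> d"
    proof cases
      case 1
      then show ?thesis
        using anchors_nonneg[OF assms(1) 1(1)] anchors_nonneg[OF assms(2) 1(2)] vdist_nonneg[of u w] by simp
    qed (rule direct_nonneg)
  qed
  show "(u, a) \<in> anchors G x \<Longrightarrow> (w, b) \<in> anchors G y \<Longrightarrow> gdist G x y \<le> a + vdist G u w + b"
    unfolding gdist_def by (rule cInf_lower[OF _ bdd]) blast
  show "d \<in> direct x y \<Longrightarrow> gdist G x y \<le> d"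
    unfolding gdist_def by (rule cInf_lower[OF _ bdd]) blast
qed

text \<open>A path that leaves the edge first runs to one of its ends, a length of at least
  \<open>r\<close>, so only the direct segment can be shorter.\<close>

lemma gdist_edge_lessD:
  assumes "0 < t" "t < len G e" "y \<in> gpoints G" "gdist G (Ed e t) y < r" "r \<le> t" "r \<le> len G e - t"
  obtains s where "y = Ed e s" "\<bar>t - s\<bar> < r"
proof -
  from gdist_lessD[OF assms(4)] show thesis
  proof (elim disjE exE conjE bexE)
    fix u a w b assume a: "(u, a) \<in> anchors G (Ed e t)" "(w, b) \<in> anchors G y" "a + vdist G u w + b < r"
    then have "r \<le> a" using assms by auto
    then show thesis using a(3) vdist_nonneg[of u w] anchors_nonneg[OF assms(3) a(2)] by linarith
  next
    fix d assume d: "d \<in> direct (Ed e t) y" "d < r"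
    then show thesis using that by (cases y) (auto split: if_splits)
  qed
qed

lemma gdist_vertex_lessD:
  assumes "y \<in> gpoints G" "gdist G (Vx v) y < star_radius v"
  shows "y = Vx v \<or> (\<exists>e t. y = Ed e t \<and> (src G e = v \<or> tgt G e = v))"
proof -
  from gdist_lessD[OF assms(2)] obtain w b where wb: "(w, b) \<in> anchors G y" "vdist G v w + b < star_radius v"
    by auto
  then have "v = w" using star_radius_le_vdist[of v w] anchors_nonneg[OF assms(1) wb(1)] by (cases "v = w") auto
  then show ?thesis using wb(1) by (cases y) auto
qed

lemma gpt_gpoints: "t \<in> {0..len G e} \<Longrightarrow> gpt G e t \<in> gpoints G"
  unfolding gpt_def gpoints_def by auto

lemma gpt_interior: "0 < t \<Longrightarrow> t < len G e \<Longrightarrow> gpt G e t = Ed e t"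
  unfolding gpt_def by simp

lemma dist_eq_gdist: "x \<in> gpoints G \<Longrightarrow> y \<in> gpoints G \<Longrightarrow> dist (\<iota> x) (\<iota> y) = gdist G x y"
  using compl unfolding is_completion_def by blast

lemma vdist_edge: "vdist G (src G e) (tgt G e) \<le> len G e" "vdist G (tgt G e) (src G e) \<le> len G e"
  using vdist_le[OF walk.fwd[OF refl walk.nil], of e] vdist_le[OF walk.bwd[OF refl walk.nil], of e] by simp_all

text \<open>Only an inequality, as another route may be shorter than the edge. The cases arise
  because \<open>gpt\<close> switches from edge points to vertices at the two ends.\<close>

lemma dist_gpt_le:
  assumes "s \<in> {0..len G e}" "t \<in> {0..len G e}"
  shows "dist (\<iota> (gpt G e s)) (\<iota> (gpt G e t)) \<le> \<bar>s - t\<bar>"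
proof -
  have main: "dist (\<iota> (gpt G e s)) (\<iota> (gpt G e t)) \<le> t - s" if st: "s < t" "0 \<le> s" "t \<le> len G e" for s t
  proof -
    have p: "gpt G e s \<in> gpoints G" "gpt G e t \<in> gpoints G" using st by (auto intro!: gpt_gpoints)
    note le = gdist_le[OF p]
    have "gdist G (gpt G e s) (gpt G e t) \<le> t - s"
    proof (cases "s = 0")
      case True
      then have s: "gpt G e s = Vx (src G e)" unfolding gpt_def by simp
      show ?thesis
      proof (cases "t = len G e")
        case True
        then have "gpt G e t = Vx (tgt G e)" using st len_pos[of e] unfolding gpt_def by auto
        then show ?thesis using le(1)[of "src G e" 0 "tgt G e" 0] s vdist_edge(1)[of e] True \<open>s = 0\<close> by simp
      next
        case False
        then have "gpt G e t = Ed e t" using st True by (intro gpt_interior) auto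
        then show ?thesis using le(1)[of "src G e" 0 "src G e" t] s True by (simp add: vdist_self)
      qed
    next
      case False
      then have s: "gpt G e s = Ed e s" using st by (intro gpt_interior) auto
      show ?thesis
      proof (cases "t = len G e")
        case True
        then have "gpt G e t = Vx (tgt G e)" using st len_pos[of e] unfolding gpt_def by auto
        then show ?thesis using le(1)[of "tgt G e" "len G e - s" "tgt G e" 0] s True by (simp add: vdist_self)
      next
        case False
        then have "gpt G e t = Ed e t" using st by (intro gpt_interior) auto
        then show ?thesis using le(2)[of "t - s"] s st by simp
      qed
    qed
    then show ?thesis using dist_eq_gdist[OF p] by simp
  qed
  consider "s < t" | "t < s" | "s = t" by linarith
  then show ?thesis
  proof cases
    case 1
    then show ?thesis using main[of s t] assms by simp
  next
    case 2
    then show ?thesis using main[of t s] assms by (simp add: dist_commute)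
  qed simp
qed

text \<open>\<open>x\<close> may be a point of the completion, which the formulas for
  \<open>gdist\<close> do not reach. Graph points near \<open>Ed e t\<close> lie on the image of a
  compact segment; being closed, this image contains their limit \<open>x\<close> as well.\<close>

lemma interior_far_from_bnd:
  assumes t: "0 < t" "t < len G e" and x: "dist (\<iota> (Ed e t)) x < r" and r: "r \<le> t" "r \<le> len G e - t"
  shows "x \<in> \<iota> ` gint G"
proof -
  \<comment> \<open>Strictly between the distance and \<open>r\<close>: the closed segment of radius
    \<open>r'\<close> stays inside the open edge, while \<open>x\<close> remains in the open
    ball.\<close>
  define r' where "r' = (dist (\<iota> (Ed e t)) x + r) / 2"
  have r': "dist (\<iota> (Ed e t)) x < r'" "r' < r" unfolding r'_def using x by auto
  define K where "K = (\<lambda>s. \<iota> (gpt G e s)) ` {t - r'..t + r'}"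
  have "0 \<le> r'" using r'(1) zero_le_dist[of "\<iota> (Ed e t)" x] by linarith
  have sub: "{t - r'..t + r'} \<subseteq> {0<..<len G e}" using r r' t by auto
  have "continuous_on {t - r'..t + r'} (\<lambda>s. \<iota> (gpt G e s))"
    unfolding continuous_on_iff
  proof (intro ballI allI impI)
    fix p and \<epsilon> :: real assume p: "p \<in> {t - r'..t + r'}" and "\<epsilon> > 0"
    have "dist (\<iota> (gpt G e q)) (\<iota> (gpt G e p)) < \<epsilon>" if "q \<in> {t - r'..t + r'}" "dist q p < \<epsilon>" for q
    proof -
      have "q \<in> {0..len G e}" "p \<in> {0..len G e}" using sub p that(1) by auto
      from dist_gpt_le[OF this] that(2) show ?thesis by (simp add: dist_real_def)
    qed
    then show "\<exists>d>0. \<forall>x'\<in>{t - r'..t + r'}. dist x' p < d \<longrightarrow> dist (\<iota> (gpt G e x')) (\<iota> (gpt G e p)) < \<epsilon>"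
      using \<open>\<epsilon> > 0\<close> by blast
  qed
  then have "closed K" unfolding K_def by (intro compact_imp_closed compact_continuous_image) auto
  have "x \<in> closure (\<iota> ` gpoints G)" using compl unfolding is_completion_def by auto
  then have "x \<in> closure (ball (\<iota> (Ed e t)) r' \<inter> \<iota> ` gpoints G)"
    using open_Int_closure_subset[OF open_ball, of "\<iota> (Ed e t)" r' "\<iota> ` gpoints G"] r'(1) by auto
  moreover have "ball (\<iota> (Ed e t)) r' \<inter> \<iota> ` gpoints G \<subseteq> K"
  proof
    fix z assume "z \<in> ball (\<iota> (Ed e t)) r' \<inter> \<iota> ` gpoints G"
    then obtain y where y: "y \<in> gpoints G" "z = \<iota> y" "dist (\<iota> (Ed e t)) (\<iota> y) < r'" by auto
    have "Ed e t \<in> gpoints G" unfolding gpoints_def using t by auto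
    then have "gdist G (Ed e t) y < r'" using y dist_eq_gdist by metis
    then obtain s where s: "y = Ed e s" "\<bar>t - s\<bar> < r'"
      using gdist_edge_lessD[OF t y(1)] r r'(2) by (metis less_imp_le order_trans)
    then have "s \<in> {t - r'..t + r'}" by auto
    moreover have "gpt G e s = Ed e s" using sub \<open>s \<in> {t - r'..t + r'}\<close> by (intro gpt_interior) auto
    ultimately show "z \<in> K" unfolding K_def y(2) s(1) by force
  qed
  ultimately have "x \<in> K" using closure_minimal[OF _ \<open>closed K\<close>] by blast
  then obtain s where s: "s \<in> {t - r'..t + r'}" "x = \<iota> (gpt G e s)" unfolding K_def by blast
  then have "gpt G e s = Ed e s" "Ed e s \<in> gint G"
    using sub gpt_interior[of s e] unfolding gint_def gpoints_def by auto
  then show ?thesis using s(2) by simp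
qed

text \<open>\<open>bnd\<close> removes the image of the interior, so no interior point may share the
  image of \<open>v\<close>. Equal images have distance 0, and the local description of balls rules
  this out.\<close>

lemma bdry_vertex_in_bnd:
  assumes "v \<in> bdry G"
  shows "\<iota> (Vx v) \<in> bnd G \<iota>"
  unfolding bnd_def
proof (intro DiffI UNIV_I notI)
  assume "\<iota> (Vx v) \<in> \<iota> ` gint G"
  then obtain p where p: "p \<in> gint G" "\<iota> (Vx v) = \<iota> p" by auto
  have pg: "p \<in> gpoints G" and vg: "Vx v \<in> gpoints G" using p unfolding gint_def gpoints_def by auto
  have d: "gdist G (Vx v) p = 0" using dist_eq_gdist[OF vg pg] p(2) by simp
  from gdist_vertex_lessD[OF pg, of v] d star_radius_pos[of v]
  consider "p = Vx v" | e t where "p = Ed e t" by auto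
  then show False
  proof cases
    case 1
    then show False using p(1) assms unfolding gint_def by auto
  next
    case 2
    then have t: "0 < t" "t < len G e" using pg unfolding gpoints_def by auto
    have "gdist G (Ed e t) (Vx v) = 0" using dist_eq_gdist[OF pg vg] p(2) 2 by simp
    then show False using gdist_edge_lessD[OF t vg, of "min t (len G e - t)"] t by auto
  qed
qed

lemma open_Nbh: "open (Nbh \<epsilon> S)"
  unfolding Nbh_def by auto

lemma subset_Nbh: "\<epsilon> > 0 \<Longrightarrow> S \<subseteq> Nbh \<epsilon> S"
  unfolding Nbh_def by auto

text \<open>Points on infinitely many such edges would accumulate, by compactness, at a point off
  the open neighbourhood and hence at an interior point of the graph; but near such a point only
  finitely many edges pass.\<close>

lemma finite_edges_off_bnd:
  assumes cpt: "compact (UNIV :: 'm set)" and "\<epsilon> > 0"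
  shows "finite {e. \<exists>t\<in>{0..len G e}. \<iota> (gpt G e t) \<notin> Nbh \<epsilon> (bnd G \<iota>)}"
proof (rule ccontr)
  assume "infinite {e. \<exists>t\<in>{0..len G e}. \<iota> (gpt G e t) \<notin> Nbh \<epsilon> (bnd G \<iota>)}"
  then obtain c :: "nat \<Rightarrow> 'e" where c: "inj c"
    "range c \<subseteq> {e. \<exists>t\<in>{0..len G e}. \<iota> (gpt G e t) \<notin> Nbh \<epsilon> (bnd G \<iota>)}"
    using infinite_countable_subset by blast
  then have "\<forall>n. \<exists>t. t \<in> {0..len G (c n)} \<and> \<iota> (gpt G (c n) t) \<notin> Nbh \<epsilon> (bnd G \<iota>)" by blast
  then obtain \<tau> where \<tau>: "\<And>n. \<tau> n \<in> {0..len G (c n)}" "\<And>n. \<iota> (gpt G (c n) (\<tau> n)) \<notin> Nbh \<epsilon> (bnd G \<iota>)"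
    unfolding choice_iff by blast
  define y where "y n = gpt G (c n) (\<tau> n)" for n
  have yg: "y n \<in> gpoints G" for n unfolding y_def using \<tau>(1) by (rule gpt_gpoints)
  obtain x \<rho> where \<rho>: "strict_mono (\<rho> :: nat \<Rightarrow> nat)" and lim: "(\<lambda>n. \<iota> (y (\<rho> n))) \<longlonglongrightarrow> x"
    using cpt[unfolded compact_def, rule_format, of "\<lambda>n. \<iota> (y n)"] by (auto simp: comp_def)
  have "closed (- Nbh \<epsilon> (bnd G \<iota>))" by (intro closed_Compl open_Nbh)
  then have "x \<in> - Nbh \<epsilon> (bnd G \<iota>)"
    by (rule closed_sequentially[OF _ _ lim]) (use \<tau>(2) in \<open>simp add: y_def\<close>)
  then have "x \<notin> bnd G \<iota>" using subset_Nbh[OF \<open>\<epsilon> > 0\<close>] by blast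
  then obtain p where p: "p \<in> gint G" "x = \<iota> p" unfolding bnd_def by auto
  then have pg: "p \<in> gpoints G" unfolding gint_def by blast
  \<comment> \<open>Local finiteness in metric form: near a vertex only its star is met, near an
    edge point only its edge.\<close>
  have "\<exists>r>0. \<exists>E. finite E \<and> (\<forall>e. \<forall>t\<in>{0..len G e}. gdist G p (gpt G e t) < r \<longrightarrow> e \<in> E)"
  proof (cases p)
    case (Vx v)
    have *: "e \<in> {e. src G e = v \<or> tgt G e = v}"
      if "t \<in> {0..len G e}" "gdist G p (gpt G e t) < star_radius v" for e t
      using gdist_vertex_lessD[OF gpt_gpoints[OF that(1)], of v] that(2) unfolding Vx gpt_def
      by (auto split: if_splits)
    show ?thesis
      by (intro exI[of _ "star_radius v"] exI[of _ "{e. src G e = v \<or> tgt G e = v}"] conjI allI ballI impI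
          star_radius_pos finite_incident *)
  next
    case (Ed e0 t0)
    then have t0: "0 < t0" "t0 < len G e0" using pg unfolding gpoints_def by auto
    have *: "e \<in> {e0}" if t: "t \<in> {0..len G e}" "gdist G p (gpt G e t) < min t0 (len G e0 - t0)" for e t
    proof -
      obtain s where "gpt G e t = Ed e0 s"
        using gdist_edge_lessD[OF t0 gpt_gpoints[OF t(1)] t(2)[unfolded Ed]] by auto
      then show ?thesis unfolding gpt_def by (auto split: if_splits)
    qed
    have "min t0 (len G e0 - t0) > 0" using t0 by simp
    then show ?thesis
      by (intro exI[of _ "min t0 (len G e0 - t0)"] exI[of _ "{e0}"] conjI allI ballI impI *) auto
  qed
  then obtain r E where r: "r > 0" "finite E"
    and E: "\<forall>e. \<forall>t\<in>{0..len G e}. gdist G p (gpt G e t) < r \<longrightarrow> e \<in> E" by (elim exE conjE)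
  obtain n0 where n0: "\<And>n. n \<ge> n0 \<Longrightarrow> dist (\<iota> (y (\<rho> n))) x < r"
    using lim r(1) unfolding lim_sequentially by blast
  have "c (\<rho> n) \<in> E" if "n \<ge> n0" for n
  proof (rule E[rule_format, OF \<tau>(1)])
    show "gdist G p (gpt G (c (\<rho> n)) (\<tau> (\<rho> n))) < r"
      using n0[OF that] dist_eq_gdist[OF pg yg, of "\<rho> n"] p(2) unfolding y_def by (simp add: dist_commute)
  qed
  then have "(c \<circ> \<rho>) ` {n0..} \<subseteq> E" by auto
  moreover have "inj (c \<circ> \<rho>)" using c(1) \<rho> by (simp add: inj_compose strict_mono_imp_inj_on)
  then have "infinite ((c \<circ> \<rho>) ` {n0..})"
    using finite_imageD[of "c \<circ> \<rho>" "{n0..}"] infinite_Ici[of n0] inj_on_subset[of "c \<circ> \<rho>" UNIV "{n0..}"] by auto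
  ultimately show False using finite_subset[OF _ r(2)] by blast
qed

end

section \<open>Green's formula\<close>

lemma abs_continuous_on_C1:
  fixes f f' :: "real \<Rightarrow> real"
  assumes der: "\<And>t. t \<in> {a..b} \<Longrightarrow> (f has_real_derivative f' t) (at t within {a..b})"
    and cont: "continuous_on {a..b} f'"
  shows "abs_continuous_on {a..b} f"
proof -
  have "bounded (f' ` {a..b})" by (intro compact_imp_bounded compact_continuous_image cont) auto
  then obtain B where "\<forall>y\<in>f' ` {a..b}. norm y \<le> B" unfolding bounded_iff by blast
  then have B: "norm (f' t) \<le> B" if "t \<in> {a..b}" for t using that by blast
  show ?thesis
  proof (rule abs_continuous_on_lipschitz[of _ _ "\<bar>B\<bar>"])
    fix x y assume xy: "x \<in> {a..b}" "y \<in> {a..b}"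
    have "norm (f x - f y) \<le> \<bar>B\<bar> * norm (x - y)"
    proof (rule field_differentiable_bound[of "{a..b}" f f'])
      show "norm (f' t) \<le> \<bar>B\<bar>" if "t \<in> {a..b}" for t using B[OF that] by linarith
    qed (use xy der in auto)
    then show "\<bar>f x - f y\<bar> \<le> \<bar>B\<bar> * \<bar>x - y\<bar>" by simp
  qed simp
qed

text \<open>The exceptional set is delivered as a Borel set so that it yields statements
  \<open>AE\<close> in \<open>lborel\<close>; the endpoints are added since \<open>nondiff\<close>
  says nothing about them.\<close>

lemma AC_AE_has_vector_derivative:
  fixes f :: "real \<Rightarrow> real"
  assumes ac: "abs_continuous_on {a..b} f"
  obtains N where "negligible N" "N \<in> sets borel"
    "\<forall>x\<in>{a..b} - N. (f has_vector_derivative vector_derivative f (at x within {a..b})) (at x within {a..b})"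
proof (rule that[of "nondiff f a b \<union> {a, b}"])
  show "negligible (nondiff f a b \<union> {a, b})"
    using AC_negligible_nondiff[OF ac] by (intro negligible_Un) auto
  show "nondiff f a b \<union> {a, b} \<in> sets borel" using nondiff_borel by (intro sets.Un) auto
  show "\<forall>x\<in>{a..b} - (nondiff f a b \<union> {a, b}).
      (f has_vector_derivative vector_derivative f (at x within {a..b})) (at x within {a..b})"
  proof
    fix x assume x: "x \<in> {a..b} - (nondiff f a b \<union> {a, b})"
    then obtain L where "(f has_real_derivative L) (at x)"
      using has_derivative_off_nondiff[OF abs_continuous_on_imp_continuous_on[OF ac], of x] by auto
    then have "(f has_vector_derivative L) (at x within {a..b})"
      by (simp add: has_real_derivative_iff_has_vector_derivative has_vector_derivative_at_within)
    then show "(f has_vector_derivative vector_derivative f (at x within {a..b})) (at x within {a..b})"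
      using vector_derivative_within_closed_interval[of a b x f L] x by auto
  qed
qed

lemma AE_not_in_negligible:
  assumes "negligible N" "N \<in> sets borel"
  shows "AE t in lborel. t \<notin> N"
  using assms by (intro AE_not_in) (simp add: negligible_iff_null_sets null_sets_completion_iff)

section \<open>Linearity of the maximal domain\<close>

lemma gcont_on_lincomb:
  assumes f: "gcont_on G U f" and g: "gcont_on G U g"
  shows "gcont_on G U (\<lambda>p. a * f p + b * g p)"
  unfolding gcont_on_def
proof (intro ballI allI impI)
  fix p and \<epsilon> :: real assume p: "p \<in> U" and \<epsilon>: "\<epsilon> > 0"
  define c where "c = \<epsilon> / (\<bar>a\<bar> + \<bar>b\<bar> + 1)"
  have c: "c > 0" unfolding c_def using \<epsilon> by (simp add: add_nonneg_pos)
  obtain \<eta>1 where \<eta>1: "\<eta>1 > 0" "\<And>q. q \<in> U \<Longrightarrow> gdist G p q < \<eta>1 \<Longrightarrow> \<bar>f q - f p\<bar> < c"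
    using f p c unfolding gcont_on_def by blast
  obtain \<eta>2 where \<eta>2: "\<eta>2 > 0" "\<And>q. q \<in> U \<Longrightarrow> gdist G p q < \<eta>2 \<Longrightarrow> \<bar>g q - g p\<bar> < c"
    using g p c unfolding gcont_on_def by blast
  have "\<bar>a * f q + b * g q - (a * f p + b * g p)\<bar> < \<epsilon>" if "q \<in> U" "gdist G p q < min \<eta>1 \<eta>2" for q
  proof -
    have "a * f q + b * g q - (a * f p + b * g p) = a * (f q - f p) + b * (g q - g p)" by (simp add: algebra_simps)
    then have "\<bar>a * f q + b * g q - (a * f p + b * g p)\<bar> \<le> \<bar>a\<bar> * \<bar>f q - f p\<bar> + \<bar>b\<bar> * \<bar>g q - g p\<bar>"
      by (metis abs_mult abs_triangle_ineq)
    also have "\<dots> \<le> \<bar>a\<bar> * c + \<bar>b\<bar> * c"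
      using \<eta>1(2)[of q] \<eta>2(2)[of q] that by (intro add_mono mult_left_mono) auto
    also have "\<dots> < (\<bar>a\<bar> + \<bar>b\<bar> + 1) * c" using c by (simp add: algebra_simps)
    also have "\<dots> = \<epsilon>" unfolding c_def by (simp add: add_nonneg_pos less_imp_neq[symmetric])
    finally show ?thesis .
  qed
  moreover have "min \<eta>1 \<eta>2 > 0" using \<eta>1 \<eta>2 by simp
  ultimately show "\<exists>\<eta>>0. \<forall>q\<in>U. gdist G p q < \<eta> \<longrightarrow> \<bar>a * f q + b * g q - (a * f p + b * g p)\<bar> < \<epsilon>"
    by blast
qed

lemma rep_lincomb: "rep G (\<lambda>p. a * f p + b * g p) = (\<lambda>e t. a * rep G f e t + b * rep G g e t)"
  unfolding rep_def by simp

lemma L2_cong: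
  assumes "\<And>e t. t \<in> {0..len G e} \<Longrightarrow> u e t = v e t"
  shows "L2 G u \<longleftrightarrow> L2 G v"
proof -
  have "set_borel_measurable lborel {0..len G e} (u e) \<longleftrightarrow> set_borel_measurable lborel {0..len G e} (v e)" for e
    unfolding set_borel_measurable_def using assms
    by (intro arg_cong[where f = "\<lambda>f. f \<in> borel_measurable lborel"]) (auto simp: fun_eq_iff indicator_def)
  moreover have "(\<integral>\<^sup>+ t. indicator {0..len G e} t * ennreal ((u e t)\<^sup>2) \<partial>lborel) =
    (\<integral>\<^sup>+ t. indicator {0..len G e} t * ennreal ((v e t)\<^sup>2) \<partial>lborel)" for e
    using assms by (intro nn_integral_cong) (auto simp: indicator_def)
  ultimately show ?thesis unfolding L2_def by simp
qed

lemma L2_single_edge: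
  assumes "continuous_on {0..len G e0} g"
  shows "L2 G (\<lambda>e t. if e = e0 then g t else 0)"
  unfolding L2_iff
proof (intro conjI allI)
  fix e
  have i: "set_integrable lborel {0..len G e0} g" using assms by (rule borel_integrable_atLeastAtMost')
  then show "set_borel_measurable lborel {0..len G e} (\<lambda>t. if e = e0 then g t else 0)"
    unfolding set_integrable_def set_borel_measurable_def by (cases "e = e0") auto
  have "set_integrable lborel {0..len G e0} (\<lambda>t. (g t)\<^sup>2)"
    by (intro borel_integrable_atLeastAtMost' continuous_intros assms)
  then show "set_integrable lborel {0..len G e} (\<lambda>t. (if e = e0 then g t else 0)\<^sup>2)"
    by (cases "e = e0") (auto simp: set_integrable_def)
next
  have "(\<lambda>e. LINT t:{0..len G e}|lborel. (if e = e0 then g t else 0)\<^sup>2) summable_on {e0}" by simp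
  then show "(\<lambda>e. LINT t:{0..len G e}|lborel. (if e = e0 then g t else 0)\<^sup>2) summable_on UNIV"
    by (rule summable_on_cong_neutral[THEN iffD1, rotated -1]) auto
qed

context completed_graph
begin

lemma d1_eqI:
  assumes "t \<in> {0..len G e}" "(u e has_vector_derivative D) (at t within {0..len G e})"
  shows "d1 G u e t = D"
  unfolding d1_def using assms len_pos[of e] by (intro vector_derivative_within_closed_interval) auto

lemma d1_local:
  assumes t: "t \<in> {0..len G e}" and "r > 0" and g: "(g has_real_derivative D) (at t)"
    and eq: "\<And>\<tau>. \<tau> \<in> {0..len G e} \<Longrightarrow> \<bar>\<tau> - t\<bar> < r \<Longrightarrow> u e \<tau> = g \<tau>"
  shows "d1 G u e t = D"
proof (rule d1_eqI[OF t])
  have "(g has_vector_derivative D) (at t within {0..len G e})"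
    using g by (simp add: has_real_derivative_iff_has_vector_derivative has_vector_derivative_at_within)
  then show "(u e has_vector_derivative D) (at t within {0..len G e})"
    by (rule has_vector_derivative_transform_within[OF _ \<open>r > 0\<close> t]) (use eq in \<open>auto simp: dist_real_def\<close>)
qed

lemma Dmax_d1:
  assumes "\<phi> \<in> Dmax G" "t \<in> {0..len G e}"
  shows "(rep G \<phi> e has_vector_derivative d1 G (rep G \<phi>) e t) (at t within {0..len G e})"
  using assms unfolding Dmax_def d1_def by (simp add: vector_derivative_works)

lemma Dmax_AC:
  assumes "\<phi> \<in> Dmax G"
  shows "abs_continuous_on {0..len G e} (d1 G (rep G \<phi>) e)"
    and "abs_continuous_on {0..len G e} (rep G \<phi> e)"
proof -
  show 1: "abs_continuous_on {0..len G e} (d1 G (rep G \<phi>) e)" using assms unfolding Dmax_def by blast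
  show "abs_continuous_on {0..len G e} (rep G \<phi> e)"
    by (rule abs_continuous_on_C1[OF _ abs_continuous_on_imp_continuous_on[OF 1]])
      (use Dmax_d1[OF assms] in \<open>simp add: has_real_derivative_iff_has_vector_derivative\<close>)
qed

lemma Dmax_d2_AE:
  assumes "\<phi> \<in> Dmax G"
  obtains N where "negligible N" "N \<in> sets borel"
    "\<forall>t\<in>{0..len G e} - N. (d1 G (rep G \<phi>) e has_vector_derivative d2 G (rep G \<phi>) e t) (at t within {0..len G e})"
  using AC_AE_has_vector_derivative[OF Dmax_AC(1)[OF assms, of e]] unfolding d2_def d1_def by blast

lemma d1_lincomb:
  assumes "\<phi> \<in> Dmax G" "\<psi> \<in> Dmax G" "t \<in> {0..len G e}"
  shows "(rep G (\<lambda>p. a * \<phi> p + b * \<psi> p) e has_vector_derivative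
      a * d1 G (rep G \<phi>) e t + b * d1 G (rep G \<psi>) e t) (at t within {0..len G e})"
    and "d1 G (rep G (\<lambda>p. a * \<phi> p + b * \<psi> p)) e t = a * d1 G (rep G \<phi>) e t + b * d1 G (rep G \<psi>) e t"
proof -
  show *: "(rep G (\<lambda>p. a * \<phi> p + b * \<psi> p) e has_vector_derivative
      a * d1 G (rep G \<phi>) e t + b * d1 G (rep G \<psi>) e t) (at t within {0..len G e})"
    using Dmax_d1[OF assms(1,3)] Dmax_d1[OF assms(2,3)] unfolding rep_lincomb
    by (auto simp flip: has_real_derivative_iff_has_vector_derivative intro!: DERIV_add DERIV_cmult)
  show "d1 G (rep G (\<lambda>p. a * \<phi> p + b * \<psi> p)) e t = a * d1 G (rep G \<phi>) e t + b * d1 G (rep G \<psi>) e t"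
    by (rule d1_eqI) (rule assms(3), rule *)
qed

text \<open>Only almost everywhere: where a second derivative fails to exist, \<open>d2\<close> is a
  default value that need not be additive.\<close>

lemma d2_lincomb:
  assumes "\<phi> \<in> Dmax G" "\<psi> \<in> Dmax G"
  shows "ae_eq G (\<lambda>e t. a * d2 G (rep G \<phi>) e t + b * d2 G (rep G \<psi>) e t) (d2 G (rep G (\<lambda>p. a * \<phi> p + b * \<psi> p)))"
  unfolding ae_eq_def
proof
  fix e
  let ?X = "{0..len G e}"
  obtain N where N: "negligible N" "N \<in> sets borel"
    "\<forall>t\<in>?X - N. (d1 G (rep G \<phi>) e has_vector_derivative d2 G (rep G \<phi>) e t) (at t within ?X)"
    by (rule Dmax_d2_AE[OF assms(1)])
  obtain M where M: "negligible M" "M \<in> sets borel"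
    "\<forall>t\<in>?X - M. (d1 G (rep G \<psi>) e has_vector_derivative d2 G (rep G \<psi>) e t) (at t within ?X)"
    by (rule Dmax_d2_AE[OF assms(2)])
  have "a * d2 G (rep G \<phi>) e t + b * d2 G (rep G \<psi>) e t = d2 G (rep G (\<lambda>p. a * \<phi> p + b * \<psi> p)) e t"
    if t: "t \<in> ?X" "t \<notin> N" "t \<notin> M" for t
  proof -
    have "((\<lambda>t. a * d1 G (rep G \<phi>) e t + b * d1 G (rep G \<psi>) e t) has_vector_derivative
        a * d2 G (rep G \<phi>) e t + b * d2 G (rep G \<psi>) e t) (at t within ?X)"
      using N(3) M(3) t
      by (auto simp flip: has_real_derivative_iff_has_vector_derivative intro!: DERIV_add DERIV_cmult)
    then have "(d1 G (rep G (\<lambda>p. a * \<phi> p + b * \<psi> p)) e has_vector_derivative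
        a * d2 G (rep G \<phi>) e t + b * d2 G (rep G \<psi>) e t) (at t within ?X)"
      by (rule has_vector_derivative_transform[OF t(1), rotated]) (use d1_lincomb(2)[OF assms] in auto)
    then show ?thesis unfolding d2_def[of G "rep G (\<lambda>p. a * \<phi> p + b * \<psi> p)"] by (rule d1_eqI[OF t(1), symmetric])
  qed
  then show "AE t in lborel. t \<in> ?X \<longrightarrow> a * d2 G (rep G \<phi>) e t + b * d2 G (rep G \<psi>) e t
      = d2 G (rep G (\<lambda>p. a * \<phi> p + b * \<psi> p)) e t"
    using AE_not_in_negligible[OF N(1,2)] AE_not_in_negligible[OF M(1,2)] by (auto elim: eventually_elim2)
qed

lemma d2_set_borel_measurable:
  assumes "abs_continuous_on {0..len G e} (d1 G u e)"
  shows "set_borel_measurable lborel {0..len G e} (d2 G u e)"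
  using vector_derivative_borel_measurable[OF abs_continuous_on_imp_continuous_on[OF assms]]
  unfolding d2_def d1_def[of G "d1 G u"] .

lemma kirch_lincomb:
  assumes "\<phi> \<in> Dmax G" "\<psi> \<in> Dmax G"
  shows "kirch G (rep G (\<lambda>p. a * \<phi> p + b * \<psi> p)) v = a * kirch G (rep G \<phi>) v + b * kirch G (rep G \<psi>) v"
proof -
  have "0 \<in> {0..len G e}" "len G e \<in> {0..len G e}" for e using len_pos[of e] by auto
  then show ?thesis
    unfolding kirch_def using d1_lincomb(2)[OF assms]
    by (simp add: sum.distrib sum_distrib_left algebra_simps)
qed

lemma Dmax_lincomb:
  assumes "\<phi> \<in> Dmax G" "\<psi> \<in> Dmax G"
  shows "(\<lambda>p. a * \<phi> p + b * \<psi> p) \<in> Dmax G"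
proof -
  note 1 = assms(1)[unfolded Dmax_def, simplified] and 2 = assms(2)[unfolded Dmax_def, simplified]
  let ?f = "\<lambda>p. a * \<phi> p + b * \<psi> p"
  have ac: "abs_continuous_on {0..len G e} (d1 G (rep G ?f) e)" for e
    by (rule abs_continuous_on_cong[OF abs_continuous_on_lincomb[OF Dmax_AC(1)[OF assms(1)] Dmax_AC(1)[OF assms(2)]]])
      (simp add: d1_lincomb(2)[OF assms])
  show ?thesis
    unfolding Dmax_def
  proof (intro CollectI conjI allI ballI impI ac)
    show "gcont_on G (gpoints G) ?f" using 1 2 by (intro gcont_on_lincomb) auto
    show "rep G ?f e differentiable (at t within {0..len G e})" if "t \<in> {0..len G e}" for e t
      using d1_lincomb(1)[OF assms that] by (rule differentiableI_vector)
    show "L2 G (rep G ?f)" unfolding rep_lincomb using 1 2 by (intro L2_lincomb) auto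
    \<comment> \<open>Equality almost everywhere transports the finite norm but not Borel
      measurability, which comes from the continuity of the first derivative.\<close>
    show "L2 G (d2 G (rep G ?f))"
      by (rule ae_eq_L2_cong[OF d2_lincomb[OF assms] L2_lincomb d2_set_borel_measurable[OF ac]]) (use 1 2 in auto)
    show "kirch G (rep G ?f) v = 0" if "v \<notin> bdry G" for v
      using 1 2 that kirch_lincomb[OF assms] by simp
  qed
qed

text \<open>The sign is such that the derivative is \<open>d2\<close> of \<phi> times \<psi> minus
  \<phi> times \<open>d2\<close> of \<psi>, wherever the second derivatives exist.\<close>

definition wronskian :: "(('v, 'e) gpoint \<Rightarrow> real) \<Rightarrow> (('v, 'e) gpoint \<Rightarrow> real) \<Rightarrow> 'e \<Rightarrow> real \<Rightarrow> real" where
  "wronskian \<phi> \<psi> e t = d1 G (rep G \<phi>) e t * rep G \<psi> e t - rep G \<phi> e t * d1 G (rep G \<psi>) e t"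

text \<open>The Wronskian is built from absolutely continuous functions, so the fundamental theorem
  applies although its derivative exists only almost everywhere. The two integrals separate because
  each integrand is a product of two L2 functions.\<close>

lemma Green_edge:
  assumes \<phi>: "\<phi> \<in> Dmax G" and \<psi>: "\<psi> \<in> Dmax G"
  shows "(LINT t:{0..len G e}|lborel. d2 G (rep G \<phi>) e t * rep G \<psi> e t)
     - (LINT t:{0..len G e}|lborel. rep G \<phi> e t * d2 G (rep G \<psi>) e t)
     = wronskian \<phi> \<psi> e (len G e) - wronskian \<phi> \<psi> e 0"
proof -
  let ?X = "{0..len G e}"
  obtain N where N: "negligible N" "N \<in> sets borel"
    "\<forall>t\<in>?X - N. (d1 G (rep G \<phi>) e has_vector_derivative d2 G (rep G \<phi>) e t) (at t within ?X)"
    by (rule Dmax_d2_AE[OF \<phi>])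
  obtain M where M: "negligible M" "M \<in> sets borel"
    "\<forall>t\<in>?X - M. (d1 G (rep G \<psi>) e has_vector_derivative d2 G (rep G \<psi>) e t) (at t within ?X)"
    by (rule Dmax_d2_AE[OF \<psi>])
  define g where "g t = d2 G (rep G \<phi>) e t * rep G \<psi> e t - rep G \<phi> e t * d2 G (rep G \<psi>) e t" for t
  have L2s: "L2 G (rep G \<phi>)" "L2 G (rep G \<psi>)" "L2 G (d2 G (rep G \<phi>))" "L2 G (d2 G (rep G \<psi>))"
    using \<phi> \<psi> unfolding Dmax_def by auto
  note i1 = L2_product(1)[OF L2s(3,2), of e] and i2 = L2_product(1)[OF L2s(1,4), of e]
  have "abs_continuous_on ?X (\<lambda>t. 1 * (d1 G (rep G \<phi>) e t * rep G \<psi> e t) + (-1) * (rep G \<phi> e t * d1 G (rep G \<psi>) e t))"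
    by (intro abs_continuous_on_lincomb abs_continuous_on_mult Dmax_AC \<phi> \<psi>)
  then have ac: "abs_continuous_on ?X (wronskian \<phi> \<psi> e)"
    by (rule abs_continuous_on_cong) (simp add: wronskian_def)
  have "(g has_integral (wronskian \<phi> \<psi> e (len G e) - wronskian \<phi> \<psi> e 0)) ?X"
  proof (rule AC_has_integral[OF ac _ negligible_Un[OF N(1) M(1)]])
    fix t assume t: "t \<in> ?X - (N \<union> M)"
    let ?F = "at t within ?X"
    have d: "(rep G \<phi> e has_real_derivative d1 G (rep G \<phi>) e t) ?F" "(rep G \<psi> e has_real_derivative d1 G (rep G \<psi>) e t) ?F"
      "(d1 G (rep G \<phi>) e has_real_derivative d2 G (rep G \<phi>) e t) ?F" "(d1 G (rep G \<psi>) e has_real_derivative d2 G (rep G \<psi>) e t) ?F"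
      using Dmax_d1[OF \<phi>] Dmax_d1[OF \<psi>] N(3) M(3) t by (auto simp: has_real_derivative_iff_has_vector_derivative)
    have "(wronskian \<phi> \<psi> e has_real_derivative g t) ?F"
      unfolding wronskian_def g_def
      by (rule derivative_eq_intros d refl)+ (simp add: algebra_simps)
    then show "(wronskian \<phi> \<psi> e has_vector_derivative g t) ?F"
      by (simp add: has_real_derivative_iff_has_vector_derivative)
  qed (use len_pos[of e] in simp)
  moreover have "set_integrable lborel ?X g" unfolding g_def using i1 i2 by (rule set_integral_diff(1))
  from set_borel_integral_eq_integral(2)[OF this] have "(LINT t:?X|lborel. g t) = integral ?X g" .
  ultimately have "(LINT t:?X|lborel. g t) = wronskian \<phi> \<psi> e (len G e) - wronskian \<phi> \<psi> e 0"
    by (simp add: integral_unique)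
  then show ?thesis unfolding g_def using i1 i2 by (simp add: set_integral_diff(2))
qed

lemma gpt_ends: "gpt G e 0 = Vx (src G e)" "gpt G e (len G e) = Vx (tgt G e)"
  unfolding gpt_def using len_pos[of e] by auto

text \<open>All edges at \<open>v\<close> share the values of \<phi> and \<psi> at
  \<open>Vx v\<close>. These factor out and leave \<open>kirch G (rep G \<phi>) v * \<psi> (Vx v) -
  \<phi> (Vx v) * kirch G (rep G \<psi>) v\<close>.\<close>

lemma wronskian_vertex_sum:
  assumes \<phi>: "\<phi> \<in> Dmax G" and \<psi>: "\<psi> \<in> Dmax G" and v: "v \<notin> bdry G"
  shows "(\<Sum>e\<in>{e. src G e = v}. wronskian \<phi> \<psi> e 0) - (\<Sum>e\<in>{e. tgt G e = v}. wronskian \<phi> \<psi> e (len G e)) = 0"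
proof -
  have "(\<Sum>e\<in>{e. src G e = v}. wronskian \<phi> \<psi> e 0) =
      (\<Sum>e\<in>{e. src G e = v}. d1 G (rep G \<phi>) e 0) * \<psi> (Vx v) - \<phi> (Vx v) * (\<Sum>e\<in>{e. src G e = v}. d1 G (rep G \<psi>) e 0)"
    unfolding sum_distrib_left sum_distrib_right sum_subtractf[symmetric]
    by (rule sum.cong) (auto simp: wronskian_def rep_def gpt_ends)
  moreover have "(\<Sum>e\<in>{e. tgt G e = v}. wronskian \<phi> \<psi> e (len G e)) =
      (\<Sum>e\<in>{e. tgt G e = v}. d1 G (rep G \<phi>) e (len G e)) * \<psi> (Vx v)
      - \<phi> (Vx v) * (\<Sum>e\<in>{e. tgt G e = v}. d1 G (rep G \<psi>) e (len G e))"
    unfolding sum_distrib_left sum_distrib_right sum_subtractf[symmetric]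
    by (rule sum.cong) (auto simp: wronskian_def rep_def gpt_ends)
  ultimately have "(\<Sum>e\<in>{e. src G e = v}. wronskian \<phi> \<psi> e 0) - (\<Sum>e\<in>{e. tgt G e = v}. wronskian \<phi> \<psi> e (len G e))
      = kirch G (rep G \<phi>) v * \<psi> (Vx v) - \<phi> (Vx v) * kirch G (rep G \<psi>) v"
    unfolding kirch_def by (simp add: algebra_simps)
  then show ?thesis using \<phi> \<psi> v unfolding Dmax_def by simp
qed

text \<open>Only finitely many edges leave the neighbourhood of the boundary on which the Wronskian
  vanishes; on them the boundary terms of Green's formula are regrouped by vertices.\<close>
lemma Green_symmetric:
  assumes cpt: "compact (UNIV :: 'm set)" and \<phi>: "\<phi> \<in> Dmax G" and \<psi>: "\<psi> \<in> Dmax G" and "\<epsilon> > 0"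
    and flat: "\<And>e t. t \<in> {0..len G e} \<Longrightarrow> \<iota> (gpt G e t) \<in> Nbh \<epsilon> (bnd G \<iota>) \<Longrightarrow>
      wronskian \<phi> \<psi> e t = 0 \<and> d2 G (rep G \<phi>) e t = 0 \<and> d2 G (rep G \<psi>) e t = 0"
  shows "l2inner G (negD2 G (rep G \<phi>)) (rep G \<psi>) = l2inner G (rep G \<phi>) (negD2 G (rep G \<psi>))"
proof -
  define K where "K = {e. \<exists>t\<in>{0..len G e}. \<iota> (gpt G e t) \<notin> Nbh \<epsilon> (bnd G \<iota>)}"
  have K: "finite K" unfolding K_def by (rule finite_edges_off_bnd[OF cpt \<open>\<epsilon> > 0\<close>])
  have off: "wronskian \<phi> \<psi> e t = 0" "d2 G (rep G \<phi>) e t = 0" "d2 G (rep G \<psi>) e t = 0"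
    if "e \<notin> K" "t \<in> {0..len G e}" for e t
    using flat that unfolding K_def by blast+
  have ends: "0 \<in> {0..len G e}" "len G e \<in> {0..len G e}" for e using len_pos[of e] by auto
  define A where "A e = (LINT t:{0..len G e}|lborel. negD2 G (rep G \<phi>) e t * rep G \<psi> e t)" for e
  define B where "B e = (LINT t:{0..len G e}|lborel. rep G \<phi> e t * negD2 G (rep G \<psi>) e t)" for e
  have "A e = 0" "B e = 0" if "e \<notin> K" for e
    unfolding A_def B_def set_lebesgue_integral_def negD2_def
    using off(2,3)[OF that] by (auto intro!: integral_eq_zero_AE AE_I2 simp: indicator_def)
  then have "infsum A UNIV = infsum A K" "infsum B UNIV = infsum B K"
    by (auto intro!: infsum_cong_neutral)
  then have AB: "l2inner G (negD2 G (rep G \<phi>)) (rep G \<psi>) = sum A K" "l2inner G (rep G \<phi>) (negD2 G (rep G \<psi>)) = sum B K"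
    using K unfolding l2inner_def A_def B_def by simp_all
  have diff: "A e - B e = wronskian \<phi> \<psi> e 0 - wronskian \<phi> \<psi> e (len G e)" for e
    using Green_edge[OF \<phi> \<psi>, of e] unfolding A_def B_def negD2_def set_lebesgue_integral_def by simp
  define V where "V = src G ` K \<union> tgt G ` K"
  have V: "finite V" unfolding V_def using K by simp
  have "(\<Sum>e\<in>K. wronskian \<phi> \<psi> e 0) = (\<Sum>v\<in>V. \<Sum>e\<in>{e \<in> K. src G e = v}. wronskian \<phi> \<psi> e 0)"
    by (rule sum.group[symmetric]) (use K V in \<open>auto simp: V_def\<close>)
  \<comment> \<open>Edges outside \<open>K\<close> contribute 0, so the inner sum may run over all
    edges starting at \<open>v\<close>, as the Kirchhoff condition does.\<close>
  also have "\<dots> = (\<Sum>v\<in>V. \<Sum>e\<in>{e. src G e = v}. wronskian \<phi> \<psi> e 0)"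
    using off(1) ends finite_src by (intro sum.cong sum.mono_neutral_left) auto
  finally have s: "(\<Sum>e\<in>K. wronskian \<phi> \<psi> e 0) = (\<Sum>v\<in>V. \<Sum>e\<in>{e. src G e = v}. wronskian \<phi> \<psi> e 0)" .
  have "(\<Sum>e\<in>K. wronskian \<phi> \<psi> e (len G e)) = (\<Sum>v\<in>V. \<Sum>e\<in>{e \<in> K. tgt G e = v}. wronskian \<phi> \<psi> e (len G e))"
    by (rule sum.group[symmetric]) (use K V in \<open>auto simp: V_def\<close>)
  also have "\<dots> = (\<Sum>v\<in>V. \<Sum>e\<in>{e. tgt G e = v}. wronskian \<phi> \<psi> e (len G e))"
    using off(1) ends finite_tgt by (intro sum.cong sum.mono_neutral_left) auto
  finally have t: "(\<Sum>e\<in>K. wronskian \<phi> \<psi> e (len G e)) = (\<Sum>v\<in>V. \<Sum>e\<in>{e. tgt G e = v}. wronskian \<phi> \<psi> e (len G e))" .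
  \<comment> \<open>At a boundary vertex every summand is 0, because the vertex lies in the
    neighbourhood; at an interior vertex only the combination cancels.\<close>
  have "(\<Sum>e\<in>{e. src G e = v}. wronskian \<phi> \<psi> e 0) - (\<Sum>e\<in>{e. tgt G e = v}. wronskian \<phi> \<psi> e (len G e)) = 0" for v
  proof (cases "v \<in> bdry G")
    case True
    then have "\<iota> (Vx v) \<in> Nbh \<epsilon> (bnd G \<iota>)" using bdry_vertex_in_bnd subset_Nbh[OF \<open>\<epsilon> > 0\<close>] by blast
    then have "wronskian \<phi> \<psi> e 0 = 0" if "src G e = v" for e using flat[OF ends(1), of e] that by (simp add: gpt_ends)
    moreover have "wronskian \<phi> \<psi> e (len G e) = 0" if "tgt G e = v" for e
      using flat[OF ends(2), of e] that \<open>\<iota> (Vx v) \<in> Nbh \<epsilon> (bnd G \<iota>)\<close> by (simp add: gpt_ends)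
    ultimately show ?thesis by simp
  qed (rule wronskian_vertex_sum[OF \<phi> \<psi>])
  then have "sum A K - sum B K = 0"
    unfolding sum_subtractf[symmetric] diff unfolding sum_subtractf s t unfolding sum_subtractf[symmetric] by simp
  then show ?thesis unfolding AB by simp
qed

text \<open>Multiples of one linear function have proportional values and slopes, so their Wronskian
  cancels whatever the constants; this is why both functions must refer to the same
  \<open>h\<close>.\<close>

lemma flat_near:
  assumes t: "t \<in> {0..len G e}" and "open S" "\<iota> (gpt G e t) \<in> S"
    and lin: "\<And>a b. 0 \<le> a \<Longrightarrow> a \<le> b \<Longrightarrow> b \<le> len G e \<Longrightarrow> gpt G e ` {a..b} \<subseteq> Gpart G \<iota> S
       \<Longrightarrow> \<exists>\<alpha> \<beta>. \<forall>t\<in>{a..b}. h (gpt G e t) = \<alpha> + \<beta> * t"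
    and \<phi>: "\<And>p. p \<in> Gpart G \<iota> S \<Longrightarrow> \<phi> p = c * h p" and \<psi>: "\<And>p. p \<in> Gpart G \<iota> S \<Longrightarrow> \<psi> p = c' * h p"
  shows "wronskian \<phi> \<psi> e t = 0 \<and> d2 G (rep G \<phi>) e t = 0 \<and> d2 G (rep G \<psi>) e t = 0"
proof -
  obtain d where d: "d > 0" "ball (\<iota> (gpt G e t)) d \<subseteq> S" using assms(2,3) open_contains_ball by blast
  \<comment> \<open>Clipped to the edge, so that an end of the edge gets a one-sided
    neighbourhood.\<close>
  define a where "a = max 0 (t - d / 2)"
  define b where "b = min (len G e) (t + d / 2)"
  have ab: "0 \<le> a" "a \<le> b" "b \<le> len G e" unfolding a_def b_def using t d by auto
  have sub: "gpt G e \<tau> \<in> Gpart G \<iota> S" if "\<tau> \<in> {a..b}" for \<tau>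
  proof -
    have \<tau>: "\<tau> \<in> {0..len G e}" "\<bar>t - \<tau>\<bar> < d" using that d unfolding a_def b_def by (auto simp: abs_if)
    then have "\<iota> (gpt G e \<tau>) \<in> ball (\<iota> (gpt G e t)) d" using dist_gpt_le[OF t \<tau>(1)] by simp
    then show ?thesis unfolding Gpart_def using d(2) gpt_gpoints[OF \<tau>(1)] by auto
  qed
  obtain \<alpha> \<beta> where h: "\<And>\<tau>. \<tau> \<in> {a..b} \<Longrightarrow> h (gpt G e \<tau>) = \<alpha> + \<beta> * \<tau>"
    using lin[OF ab] sub by blast
  have key: "rep G f e t = k * (\<alpha> + \<beta> * t) \<and> d1 G (rep G f) e t = k * \<beta> \<and> d2 G (rep G f) e t = 0"
    if f: "\<And>p. p \<in> Gpart G \<iota> S \<Longrightarrow> f p = k * h p" for f k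
  proof -
    have near: "\<tau> \<in> {a..b}" if "\<tau> \<in> {0..len G e}" "\<bar>\<tau> - t\<bar> < d / 2" for \<tau>
      using that unfolding a_def b_def by (auto simp: abs_if split: if_splits)
    have val: "rep G f e \<tau> = k * (\<alpha> + \<beta> * \<tau>)" if "\<tau> \<in> {a..b}" for \<tau>
      unfolding rep_def using f[OF sub[OF that]] h[OF that] by simp
    have D: "((\<lambda>\<tau>. k * (\<alpha> + \<beta> * \<tau>)) has_real_derivative k * \<beta>) (at \<tau>)" for \<tau>
      by (auto intro!: derivative_eq_intros)
    have d1: "d1 G (rep G f) e \<tau> = k * \<beta>" if \<tau>: "\<tau> \<in> {0..len G e}" "\<bar>\<tau> - t\<bar> < d / 2" for \<tau>
    proof (rule d1_local[OF \<tau>(1) _ D])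
      show "d / 2 - \<bar>\<tau> - t\<bar> > 0" using \<tau>(2) by simp
      show "rep G f e \<sigma> = k * (\<alpha> + \<beta> * \<sigma>)" if "\<sigma> \<in> {0..len G e}" "\<bar>\<sigma> - \<tau>\<bar> < d / 2 - \<bar>\<tau> - t\<bar>" for \<sigma>
        by (rule val[OF near[OF that(1)]]) (use that(2) in linarith)
    qed
    have "d2 G (rep G f) e t = 0"
      unfolding d2_def by (rule d1_local[where g = "\<lambda>_. k * \<beta>" and r = "d / 2"]) (use t d(1) d1 in auto)
    then show ?thesis using val[OF near[OF t]] d1[OF t] d(1) by simp
  qed
  show ?thesis using key[OF \<phi>] key[OF \<psi>] unfolding wronskian_def by (simp add: algebra_simps)
qed

text \<open>A common criterion for the single domains and for their union. The radius \<epsilon> may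
  depend on the pair of functions, as it does in the definition of the domains.\<close>

lemma symmetric_op_negD2:
  assumes cpt: "compact (UNIV :: 'm set)" and sub: "D \<subseteq> Dmax G"
    and lin: "\<And>\<phi> \<psi> a b. \<phi> \<in> D \<Longrightarrow> \<psi> \<in> D \<Longrightarrow> (\<lambda>p. a * \<phi> p + b * \<psi> p) \<in> D"
    and test: "\<And>e0 q. q \<in> test_fns (len G e0) \<Longrightarrow> (\<lambda>e t. if e = e0 then q t else 0) \<in> rep G ` D"
    and flat: "\<And>\<phi> \<psi>. \<phi> \<in> D \<Longrightarrow> \<psi> \<in> D \<Longrightarrow> \<exists>\<epsilon>>0. \<forall>e. \<forall>t\<in>{0..len G e}. \<iota> (gpt G e t) \<in> Nbh \<epsilon> (bnd G \<iota>) \<longrightarrow>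
      wronskian \<phi> \<psi> e t = 0 \<and> d2 G (rep G \<phi>) e t = 0 \<and> d2 G (rep G \<psi>) e t = 0"
  shows "symmetric_op G (rep G ` D) (negD2 G)"
proof -
  have rlin: "(\<lambda>e t. a * u e t + b * v e t) \<in> rep G ` D" if "u \<in> rep G ` D" "v \<in> rep G ` D" for u v a b
    using that lin by (auto simp: rep_lincomb[symmetric])
  show ?thesis
    unfolding symmetric_op_def
  proof (intro conjI ballI allI rlin)
    fix u assume "u \<in> rep G ` D"
    then obtain \<phi> where \<phi>: "\<phi> \<in> D" "u = rep G \<phi>" by blast
    then have "L2 G (rep G \<phi>)" "L2 G (d2 G (rep G \<phi>))" using sub unfolding Dmax_def by auto
    then show "L2 G u" "L2 G (negD2 G u)"
      using L2_lincomb[of G "d2 G u" "d2 G u" "-1" 0] unfolding \<phi>(2) negD2_def by simp_all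
  next
    fix u v a b assume "u \<in> rep G ` D" "v \<in> rep G ` D"
    then obtain \<phi> \<psi> where \<phi>: "\<phi> \<in> Dmax G" "u = rep G \<phi>" and \<psi>: "\<psi> \<in> Dmax G" "v = rep G \<psi>" using sub by blast
    show "ae_eq G (negD2 G (\<lambda>e t. a * u e t + b * v e t)) (\<lambda>e t. a * negD2 G u e t + b * negD2 G v e t)"
      using d2_lincomb[OF \<phi>(1) \<psi>(1), of a b] unfolding \<phi>(2) \<psi>(2) rep_lincomb[symmetric] ae_eq_def negD2_def
      by (auto elim!: eventually_mono)
  next
    show "dense_L2 G (rep G ` D)" by (rule dense_L2_test_fns[OF len_pos rlin test])
  next
    fix u v assume "u \<in> rep G ` D" "v \<in> rep G ` D"
    then obtain \<phi> \<psi> where \<phi>: "\<phi> \<in> D" "u = rep G \<phi>" and \<psi>: "\<psi> \<in> D" "v = rep G \<psi>" by blast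
    obtain \<epsilon> where \<epsilon>: "\<epsilon> > 0" "\<forall>e. \<forall>t\<in>{0..len G e}. \<iota> (gpt G e t) \<in> Nbh \<epsilon> (bnd G \<iota>) \<longrightarrow>
      wronskian \<phi> \<psi> e t = 0 \<and> d2 G (rep G \<phi>) e t = 0 \<and> d2 G (rep G \<psi>) e t = 0"
      using flat[OF \<phi>(1) \<psi>(1)] by blast
    show "l2inner G (negD2 G u) v = l2inner G u (negD2 G v)"
      unfolding \<phi>(2) \<psi>(2) by (rule Green_symmetric[OF cpt _ _ \<epsilon>(1) \<epsilon>(2)[rule_format]]) (use sub \<phi> \<psi> in auto)
  qed
qed

end

section \<open>The domains attached to partitions\<close>

context completed_graph
begin

section \<open>Functions supported inside one edge\<close>

definition edge_fun :: "'e \<Rightarrow> (real \<Rightarrow> real) \<Rightarrow> ('v, 'e) gpoint \<Rightarrow> real" where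
  "edge_fun e0 q p = (case p of Vx v \<Rightarrow> 0 | Ed e t \<Rightarrow> if e = e0 then q t else 0)"

context
  fixes e0 :: 'e and q q' q'' :: "real \<Rightarrow> real" and \<alpha> \<beta> :: real
  assumes \<alpha>: "0 < \<alpha>" and \<beta>: "\<beta> < len G e0" and supp: "t \<notin> {\<alpha>..\<beta>} \<Longrightarrow> q t = 0"
    and q': "(q has_real_derivative q' t) (at t)" and q'': "(q' has_real_derivative q'' t) (at t)"
    and q''_cont: "continuous_on UNIV q''"
begin

lemma edge_fun_nonzeroD:
  assumes "p \<in> gpoints G" "edge_fun e0 q p \<noteq> 0"
  obtains s where "p = Ed e0 s" "\<alpha> \<le> s" "s \<le> \<beta>" "0 < s" "s < len G e0"
proof (cases p)
  case (Vx v)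
  then show ?thesis using assms unfolding edge_fun_def by simp
next
  case (Ed e s)
  then have "e = e0" "q s \<noteq> 0" using assms(2) unfolding edge_fun_def by (auto split: if_splits)
  then show ?thesis using that Ed supp[of s] \<alpha> \<beta> by auto
qed

lemma rep_edge_fun: "rep G (edge_fun e0 q) = (\<lambda>e t. if e = e0 then q t else 0)"
proof (intro ext)
  fix e t
  show "rep G (edge_fun e0 q) e t = (if e = e0 then q t else 0)"
    using supp[of 0] supp[of "len G e0"] \<alpha> \<beta> unfolding rep_def gpt_def edge_fun_def by auto
qed

lemma q'_zero: "t \<notin> {\<alpha>..\<beta>} \<Longrightarrow> q' t = 0"
proof -
  assume t: "t \<notin> {\<alpha>..\<beta>}"
  have "((\<lambda>_. 0) has_real_derivative q' t) (at t)"
    by (rule has_field_derivative_transform_within_open[OF q', of "- {\<alpha>..\<beta>}"]) (use t supp in auto)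
  then show ?thesis using DERIV_unique DERIV_const by blast
qed

lemma d1_edge_fun:
  assumes "t \<in> {0..len G e}"
  shows "d1 G (rep G (edge_fun e0 q)) e t = (if e = e0 then q' t else 0)"
  by (rule d1_local[where g = "\<lambda>t. if e = e0 then q t else 0" and r = 1])
    (use assms q' in \<open>auto simp: rep_edge_fun\<close>)

lemma d2_edge_fun:
  assumes "t \<in> {0..len G e}"
  shows "d2 G (rep G (edge_fun e0 q)) e t = (if e = e0 then q'' t else 0)"
  unfolding d2_def
  by (rule d1_local[where g = "\<lambda>t. if e = e0 then q' t else 0" and r = 1])
    (use assms q'' d1_edge_fun in auto)

text \<open>On \<open>e0\<close> continuity is that of \<open>q\<close>. Any other point is at
  distance at least \<open>min \<alpha> (len G e0 - \<beta>)\<close> from the support, since a path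
  from there must pass an end of \<open>e0\<close>.\<close>

lemma edge_fun_gcont: "gcont_on G (gpoints G) (edge_fun e0 q)"
  unfolding gcont_on_def
proof (intro ballI allI impI)
  fix p and \<epsilon> :: real assume p: "p \<in> gpoints G" and \<epsilon>: "\<epsilon> > 0"
  show "\<exists>\<eta>>0. \<forall>y\<in>gpoints G. gdist G p y < \<eta> \<longrightarrow> \<bar>edge_fun e0 q y - edge_fun e0 q p\<bar> < \<epsilon>"
  proof (cases "\<exists>t. p = Ed e0 t")
    case True
    then obtain t where t: "p = Ed e0 t" by blast
    then have t0: "0 < t" "t < len G e0" using p unfolding gpoints_def by auto
    have "isCont q t" using q' by (rule DERIV_isCont)
    then obtain d where d: "d > 0" "\<And>s. \<bar>s - t\<bar> < d \<Longrightarrow> \<bar>q s - q t\<bar> < \<epsilon>"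
      using \<epsilon> unfolding continuous_at_eps_delta dist_real_def by blast
    define \<eta> where "\<eta> = min d (min t (len G e0 - t))"
    have \<eta>: "\<eta> \<le> t" "\<eta> \<le> len G e0 - t" unfolding \<eta>_def by auto
    have "\<bar>edge_fun e0 q y - edge_fun e0 q p\<bar> < \<epsilon>" if y: "y \<in> gpoints G" "gdist G p y < \<eta>" for y
    proof -
      obtain s where "y = Ed e0 s" "\<bar>t - s\<bar> < \<eta>"
        using gdist_edge_lessD[OF t0 y(1) y(2)[unfolded t] \<eta>] by blast
      then show ?thesis using d(2)[of s] unfolding t edge_fun_def \<eta>_def by (simp add: abs_minus_commute)
    qed
    moreover have "\<eta> > 0" unfolding \<eta>_def using d t0 by simp
    ultimately show ?thesis by blast
  next
    case False
    then have p0: "edge_fun e0 q p = 0" unfolding edge_fun_def by (auto split: gpoint.splits)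
    have "edge_fun e0 q y = 0" if y: "y \<in> gpoints G" "gdist G p y < min \<alpha> (len G e0 - \<beta>)" for y
    proof (rule ccontr)
      assume "edge_fun e0 q y \<noteq> 0"
      then obtain s where s: "y = Ed e0 s" "\<alpha> \<le> s" "s \<le> \<beta>" "0 < s" "s < len G e0"
        using edge_fun_nonzeroD[OF y(1)] by blast
      \<comment> \<open>Symmetry of \<open>gdist\<close> is read off from the metric of the
        completion.\<close>
      have near: "gdist G (Ed e0 s) p < min \<alpha> (len G e0 - \<beta>)"
        using y(2) dist_eq_gdist[OF p y(1)] dist_eq_gdist[OF y(1) p] s(1) by (simp add: dist_commute)
      have "min \<alpha> (len G e0 - \<beta>) \<le> s" "min \<alpha> (len G e0 - \<beta>) \<le> len G e0 - s"
        using s(2,3) by linarith+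
      then obtain s' where "p = Ed e0 s'" using gdist_edge_lessD[OF s(4,5) p near] by blast
      then show False using False by blast
    qed
    moreover have "min \<alpha> (len G e0 - \<beta>) > 0" using \<alpha> \<beta> by simp
    ultimately show ?thesis using p0 \<epsilon> by (intro exI[of _ "min \<alpha> (len G e0 - \<beta>)"]) auto
  qed
qed

lemma edge_fun_Dmax: "edge_fun e0 q \<in> Dmax G"
  unfolding Dmax_def
proof (intro CollectI conjI allI ballI impI edge_fun_gcont)
  show "rep G (edge_fun e0 q) e differentiable (at t within {0..len G e})" for e t
  proof -
    have "(rep G (edge_fun e0 q) e has_real_derivative (if e = e0 then q' t else 0)) (at t)"
      unfolding rep_edge_fun using q' by (cases "e = e0") auto
    then show ?thesis using real_differentiable_def differentiable_at_withinI by blast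
  qed
  have q'_cont: "continuous_on S q'" "continuous_on S q" for S
    using q' q'' by (auto intro!: continuous_at_imp_continuous_on dest: DERIV_isCont)
  show "abs_continuous_on {0..len G e} (d1 G (rep G (edge_fun e0 q)) e)" for e
  proof (rule abs_continuous_on_cong)
    show "abs_continuous_on {0..len G e} (\<lambda>t. if e = e0 then q' t else 0)"
      by (rule abs_continuous_on_C1[where f' = "\<lambda>t. if e = e0 then q'' t else 0"])
        (cases "e = e0"; use q'' in \<open>auto intro: has_field_derivative_at_within continuous_on_subset[OF q''_cont]\<close>)+
  qed (simp add: d1_edge_fun)
  show "L2 G (rep G (edge_fun e0 q))"
    unfolding rep_edge_fun by (rule L2_single_edge[OF q'_cont(2)])
  have "L2 G (\<lambda>e t. if e = e0 then q'' t else 0)"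
    by (rule L2_single_edge[OF continuous_on_subset[OF q''_cont]]) simp
  then show "L2 G (d2 G (rep G (edge_fun e0 q)))"
    by (rule L2_cong[THEN iffD1, rotated]) (simp add: d2_edge_fun)
  show "kirch G (rep G (edge_fun e0 q)) v = 0" for v
  proof -
    have "0 \<in> {0..len G e}" "len G e \<in> {0..len G e}" for e using len_pos[of e] by auto
    then have "d1 G (rep G (edge_fun e0 q)) e 0 = 0" "d1 G (rep G (edge_fun e0 q)) e (len G e) = 0" for e
      using d1_edge_fun q'_zero \<alpha> \<beta> by auto
    then show ?thesis unfolding kirch_def by simp
  qed
qed

text \<open>A point of the completion this close to the support lies in the image of the interior of
  the graph, so it is not a boundary point.\<close>

lemma edge_fun_zero_near_bnd:
  assumes "p \<in> gpoints G" "\<iota> p \<in> Nbh (min \<alpha> (len G e0 - \<beta>)) (bnd G \<iota>)"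
  shows "edge_fun e0 q p = 0"
proof (rule ccontr)
  assume "edge_fun e0 q p \<noteq> 0"
  then obtain s where s: "p = Ed e0 s" "\<alpha> \<le> s" "s \<le> \<beta>" "0 < s" "s < len G e0"
    using edge_fun_nonzeroD[OF assms(1)] by blast
  obtain x where x: "x \<in> bnd G \<iota>" "dist x (\<iota> p) < min \<alpha> (len G e0 - \<beta>)"
    using assms(2) unfolding Nbh_def by auto
  have "x \<in> \<iota> ` gint G"
    by (rule interior_far_from_bnd[OF s(4,5), where r = "min \<alpha> (len G e0 - \<beta>)"])
      (use x(2) s in \<open>auto simp: dist_commute\<close>)
  then show False using x(1) unfolding bnd_def by blast
qed

end

end

section \<open>Refinement of the partitions and its effect on the domains\<close>

lemma Nbh_mono: "\<epsilon> \<le> \<epsilon>' \<Longrightarrow> S \<subseteq> S' \<Longrightarrow> Nbh \<epsilon> S \<subseteq> Nbh \<epsilon>' S'"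
  unfolding Nbh_def by force

lemma Gpart_mono: "S \<subseteq> S' \<Longrightarrow> Gpart G \<iota> S \<subseteq> Gpart G \<iota> S'"
  unfolding Gpart_def by blast

locale boundary_data = completed_graph G \<iota>
  for G :: "('v, 'e) mgraph" and \<iota> :: "('v, 'e) gpoint \<Rightarrow> 'm::metric_space" +
  fixes N :: nat and E :: "nat \<Rightarrow> 'm set" and \<delta> :: real and h :: "nat \<Rightarrow> ('v, 'e) gpoint \<Rightarrow> real"
  assumes cpt: "compact (UNIV :: 'm set)"
    and E_ne: "n \<le> N \<Longrightarrow> E n \<noteq> {}"
    and E_disj: "n \<le> N \<Longrightarrow> m \<le> N \<Longrightarrow> n \<noteq> m \<Longrightarrow> E n \<inter> E m = {}"
    and E_cover: "(\<Union>n\<le>N. E n) = bnd G \<iota>"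
    and \<delta>_pos: "0 < \<delta>"
    and h_harm: "n \<in> {1..N} \<Longrightarrow> harmonic_on G (Gpart G \<iota> (Nbh \<delta> (E n))) (h n)"
    and h0: "h 0 = (\<lambda>_. 0)"
begin

text \<open>The invariant of the refinement. Since the sets \<open>E n\<close> are disjoint and the
  pieces nonempty, each piece determines its \<open>n\<close> and thereby the attached
  function.\<close>

definition admissible :: "'m set set \<Rightarrow> bool" where
  "admissible P \<longleftrightarrow> \<Union>P = bnd G \<iota> \<and> (\<forall>F\<in>P. F \<noteq> {} \<and> (\<exists>n\<le>N. F \<subseteq> E n))"

abbreviation Dj :: "'m set set \<Rightarrow> (('v, 'e) gpoint \<Rightarrow> real) set" where
  "Dj P \<equiv> Dpart G \<iota> \<delta> N E h P"

lemma admissible_initial: "admissible (E ` {0..N})"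
  unfolding admissible_def using E_ne E_cover by (auto simp: atLeast0AtMost)

lemma admissible_refine:
  assumes P: "admissible P" and r: "refine_step (bnd G \<iota>) P Q"
  shows "admissible Q" and "\<And>F. F \<in> Q \<Longrightarrow> \<exists>F'\<in>P. F \<subseteq> F'"
proof -
  obtain \<sigma> where \<sigma>: "Q = \<Union>(\<sigma> ` P)" "\<And>F. F \<in> P \<Longrightarrow> if splittable (bnd G \<iota>) F
      then (\<exists>A B. \<sigma> F = {A, B} \<and> A \<noteq> {} \<and> B \<noteq> {} \<and> A \<inter> B = {} \<and> A \<union> B = F
                 \<and> clopen_in (bnd G \<iota>) A \<and> clopen_in (bnd G \<iota>) B)
      else \<sigma> F = {F}"
    using r unfolding refine_step_def by blast
  have U: "\<Union>(\<sigma> F) = F" if "F \<in> P" for F using \<sigma>(2)[OF that] by (auto split: if_splits)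
  have ne: "\<forall>A\<in>\<sigma> F. A \<noteq> {}" if "F \<in> P" for F
    using \<sigma>(2)[OF that] P that unfolding admissible_def by (auto split: if_splits)
  show sub: "\<exists>F'\<in>P. F \<subseteq> F'" if "F \<in> Q" for F
    using that U unfolding \<sigma>(1) by blast
  have "\<Union>Q = (\<Union>F\<in>P. \<Union>(\<sigma> F))" unfolding \<sigma>(1) by blast
  then have "\<Union>Q = \<Union>P" using U by simp
  then show "admissible Q"
    using P ne sub unfolding admissible_def \<sigma>(1) by (auto dest: subset_trans) (meson UN_I order_trans)
qed

text \<open>Each piece takes over the constant of a piece of \<open>P\<close> containing it, and its
  neighbourhood only shrinks. The attached function is unchanged, as a nonempty piece lies in only
  one \<open>E n\<close>.\<close>

lemma Dj_mono:
  assumes P: "admissible P" and Q: "admissible Q" and sub: "\<And>F. F \<in> Q \<Longrightarrow> \<exists>F'\<in>P. F \<subseteq> F'"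
  shows "Dj P \<subseteq> Dj Q"
proof
  fix \<phi> assume "\<phi> \<in> Dj P"
  then obtain \<epsilon> c where \<phi>: "\<phi> \<in> Dmax G" "0 < \<epsilon>" "\<epsilon> < \<delta>"
    and c: "\<forall>F\<in>P. \<forall>n\<le>N. F \<subseteq> E n \<longrightarrow> (\<forall>p\<in>Gpart G \<iota> (Nbh \<epsilon> F). \<phi> p = c F * h n p)"
    unfolding Dpart_def by blast
  define parent where "parent F = (SOME F'. F' \<in> P \<and> F \<subseteq> F')" for F
  have parent: "parent F \<in> P" "F \<subseteq> parent F" if "F \<in> Q" for F
    using someI_ex[of "\<lambda>F'. F' \<in> P \<and> F \<subseteq> F'"] sub[OF that] unfolding parent_def by blast+
  have "\<phi> p = c (parent F) * h n p"
    if F: "F \<in> Q" "n \<le> N" "F \<subseteq> E n" and p: "p \<in> Gpart G \<iota> (Nbh \<epsilon> F)" for F n p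
  proof -
    obtain m where m: "m \<le> N" "parent F \<subseteq> E m" using P parent[OF F(1)] unfolding admissible_def by blast
    have "F \<noteq> {}" using Q F(1) unfolding admissible_def by blast
    then have "E n \<inter> E m \<noteq> {}" using F(3) m(2) parent(2)[OF F(1)] by blast
    then have "n = m" using E_disj F(2) m(1) by blast
    moreover have "p \<in> Gpart G \<iota> (Nbh \<epsilon> (parent F))"
      using p Gpart_mono[OF Nbh_mono[OF order_refl parent(2)[OF F(1)]]] by blast
    ultimately show ?thesis using c parent(1)[OF F(1)] m by blast
  qed
  then have "\<exists>c. \<forall>F\<in>Q. \<forall>n\<le>N. F \<subseteq> E n \<longrightarrow> (\<forall>p\<in>Gpart G \<iota> (Nbh \<epsilon> F). \<phi> p = c F * h n p)"
    by (intro exI[of _ "\<lambda>F. c (parent F)"]) blast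
  then show "\<phi> \<in> Dj Q" unfolding Dpart_def using \<phi> by blast
qed

lemma Dj_two:
  assumes "\<phi> \<in> Dj P" "\<psi> \<in> Dj P"
  obtains \<epsilon> c c' where "0 < \<epsilon>" "\<epsilon> < \<delta>"
    "\<forall>F\<in>P. \<forall>n\<le>N. F \<subseteq> E n \<longrightarrow> (\<forall>p\<in>Gpart G \<iota> (Nbh \<epsilon> F). \<phi> p = c F * h n p \<and> \<psi> p = c' F * h n p)"
proof -
  obtain \<epsilon>1 c where 1: "0 < \<epsilon>1" "\<epsilon>1 < \<delta>"
    "\<forall>F\<in>P. \<forall>n\<le>N. F \<subseteq> E n \<longrightarrow> (\<forall>p\<in>Gpart G \<iota> (Nbh \<epsilon>1 F). \<phi> p = c F * h n p)"
    using assms(1) unfolding Dpart_def by blast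
  obtain \<epsilon>2 c' where 2: "0 < \<epsilon>2" "\<epsilon>2 < \<delta>"
    "\<forall>F\<in>P. \<forall>n\<le>N. F \<subseteq> E n \<longrightarrow> (\<forall>p\<in>Gpart G \<iota> (Nbh \<epsilon>2 F). \<psi> p = c' F * h n p)"
    using assms(2) unfolding Dpart_def by blast
  have "Gpart G \<iota> (Nbh (min \<epsilon>1 \<epsilon>2) F) \<subseteq> Gpart G \<iota> (Nbh \<epsilon>1 F)"
    "Gpart G \<iota> (Nbh (min \<epsilon>1 \<epsilon>2) F) \<subseteq> Gpart G \<iota> (Nbh \<epsilon>2 F)" for F
    by (intro Gpart_mono Nbh_mono; simp)+
  then have "\<forall>F\<in>P. \<forall>n\<le>N. F \<subseteq> E n \<longrightarrow>
      (\<forall>p\<in>Gpart G \<iota> (Nbh (min \<epsilon>1 \<epsilon>2) F). \<phi> p = c F * h n p \<and> \<psi> p = c' F * h n p)"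
    using 1(3) 2(3) by (meson subsetD)
  then show thesis using that[of "min \<epsilon>1 \<epsilon>2" c c'] 1 2 by simp
qed

lemma Dj_lincomb:
  assumes "\<phi> \<in> Dj P" "\<psi> \<in> Dj P"
  shows "(\<lambda>p. a * \<phi> p + b * \<psi> p) \<in> Dj P"
proof -
  obtain \<epsilon> c c' where \<epsilon>: "0 < \<epsilon>" "\<epsilon> < \<delta>" and
    c: "\<forall>F\<in>P. \<forall>n\<le>N. F \<subseteq> E n \<longrightarrow> (\<forall>p\<in>Gpart G \<iota> (Nbh \<epsilon> F). \<phi> p = c F * h n p \<and> \<psi> p = c' F * h n p)"
    by (rule Dj_two[OF assms])
  have "(\<lambda>p. a * \<phi> p + b * \<psi> p) \<in> Dmax G"
    using assms by (intro Dmax_lincomb) (auto simp: Dpart_def)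
  moreover have "\<forall>F\<in>P. \<forall>n\<le>N. F \<subseteq> E n \<longrightarrow>
      (\<forall>p\<in>Gpart G \<iota> (Nbh \<epsilon> F). a * \<phi> p + b * \<psi> p = (a * c F + b * c' F) * h n p)"
    using c by (simp add: algebra_simps)
  ultimately show ?thesis unfolding Dpart_def using \<epsilon>
    by (intro CollectI conjI exI[of _ \<epsilon>] exI[of _ "\<lambda>F. a * c F + b * c' F"]) auto
qed

text \<open>A test function vanishes near the whole boundary, so it meets the condition on every
  piece with constant 0.\<close>

lemma Dj_test:
  assumes P: "admissible P" and q: "q \<in> test_fns (len G e0)"
  shows "(\<lambda>e t. if e = e0 then q t else 0) \<in> rep G ` Dj P"
proof -
  obtain q' q'' \<alpha> \<beta> where q: "0 < \<alpha>" "\<beta> < len G e0" "\<And>t. t \<notin> {\<alpha>..\<beta>} \<Longrightarrow> q t = 0"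
     "\<And>t. (q has_real_derivative q' t) (at t)" "\<And>t. (q' has_real_derivative q'' t) (at t)" "continuous_on UNIV q''"
    using q unfolding test_fns_def by blast
  \<comment> \<open>\<open>\<delta> / 2\<close> serves the strict bound
    \<open>\<epsilon> < \<delta>\<close>; the other two are the distances of the support from the
    ends of the edge.\<close>
  define \<epsilon> where "\<epsilon> = min (\<delta> / 2) (min \<alpha> (len G e0 - \<beta>))"
  have \<epsilon>: "0 < \<epsilon>" "\<epsilon> < \<delta>" unfolding \<epsilon>_def using q(1,2) \<delta>_pos by auto
  have "edge_fun e0 q p = 0 * h n p" if "F \<in> P" "p \<in> Gpart G \<iota> (Nbh \<epsilon> F)" for F n p
  proof -
    have "Nbh \<epsilon> F \<subseteq> Nbh (min \<alpha> (len G e0 - \<beta>)) (bnd G \<iota>)"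
      using P that(1) unfolding \<epsilon>_def admissible_def by (intro Nbh_mono) auto
    then show ?thesis using edge_fun_zero_near_bnd[OF q, of p] that(2) unfolding Gpart_def by auto
  qed
  then have "edge_fun e0 q \<in> Dj P"
    unfolding Dpart_def using \<epsilon> edge_fun_Dmax[OF q]
    by (intro CollectI conjI exI[of _ \<epsilon>] exI[of _ "\<lambda>_. 0"]) auto
  moreover have "rep G (edge_fun e0 q) = (\<lambda>e t. if e = e0 then q t else 0)" by (rule rep_edge_fun[OF q])
  ultimately show ?thesis by (metis imageI)
qed

text \<open>A point close to the boundary is close to some piece \<open>F\<close>, near which both
  functions are multiples of the same \<open>h n\<close>. This is linear along edge segments by
  harmonicity, or zero when \<open>n = 0\<close>.\<close>

lemma Dj_flat:
  assumes P: "admissible P" and "\<phi> \<in> Dj P" "\<psi> \<in> Dj P"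
  shows "\<exists>\<epsilon>>0. \<forall>e. \<forall>t\<in>{0..len G e}. \<iota> (gpt G e t) \<in> Nbh \<epsilon> (bnd G \<iota>) \<longrightarrow>
      wronskian \<phi> \<psi> e t = 0 \<and> d2 G (rep G \<phi>) e t = 0 \<and> d2 G (rep G \<psi>) e t = 0"
proof -
  obtain \<epsilon> c c' where \<epsilon>: "0 < \<epsilon>" "\<epsilon> < \<delta>" and
    c: "\<forall>F\<in>P. \<forall>n\<le>N. F \<subseteq> E n \<longrightarrow> (\<forall>p\<in>Gpart G \<iota> (Nbh \<epsilon> F). \<phi> p = c F * h n p \<and> \<psi> p = c' F * h n p)"
    by (rule Dj_two[OF assms(2,3)])
  have "wronskian \<phi> \<psi> e t = 0 \<and> d2 G (rep G \<phi>) e t = 0 \<and> d2 G (rep G \<psi>) e t = 0"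
    if t: "t \<in> {0..len G e}" and near: "\<iota> (gpt G e t) \<in> Nbh \<epsilon> (bnd G \<iota>)" for e t
  proof -
    obtain x where x: "x \<in> bnd G \<iota>" "\<iota> (gpt G e t) \<in> ball x \<epsilon>" using near unfolding Nbh_def by blast
    then obtain F where F: "F \<in> P" "x \<in> F" using P unfolding admissible_def by blast
    then obtain n where n: "n \<le> N" "F \<subseteq> E n" using P unfolding admissible_def by blast
    have lin: "\<exists>\<alpha> \<beta>. \<forall>t\<in>{a..b}. h n (gpt G e t) = \<alpha> + \<beta> * t"
      if "0 \<le> a" "a \<le> b" "b \<le> len G e" "gpt G e ` {a..b} \<subseteq> Gpart G \<iota> (Nbh \<epsilon> F)" for a b
    proof (cases "n = 0")
      case True
      then show ?thesis using h0 by (intro exI[of _ 0]) simp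
    next
      case False
      then have "harmonic_on G (Gpart G \<iota> (Nbh \<delta> (E n))) (h n)" using n(1) by (intro h_harm) simp
      moreover have "gpt G e ` {a..b} \<subseteq> Gpart G \<iota> (Nbh \<delta> (E n))"
        using that(4) Gpart_mono[OF Nbh_mono[of \<epsilon> \<delta> F "E n"]] \<epsilon> n(2) by fastforce
      ultimately show ?thesis using that(1-3) unfolding harmonic_on_def by blast
    qed
    show ?thesis
    proof (rule flat_near[OF t open_Nbh[of \<epsilon> F] _ lin])
      show "\<iota> (gpt G e t) \<in> Nbh \<epsilon> F" using x F(2) unfolding Nbh_def by blast
      show "\<phi> p = c F * h n p" "\<psi> p = c' F * h n p" if "p \<in> Gpart G \<iota> (Nbh \<epsilon> F)" for p
        using c F(1) n that by blast+
    qed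
  qed
  then show ?thesis using \<epsilon>(1) by blast
qed

lemma symmetric_op_Dj:
  assumes "admissible P"
  shows "symmetric_op G (rep G ` Dj P) (negD2 G)"
proof (rule symmetric_op_negD2[OF cpt])
  show "Dj P \<subseteq> Dmax G" unfolding Dpart_def by blast
qed (use Dj_lincomb Dj_test[OF assms] Dj_flat[OF assms] in blast)+

text \<open>The domains increase, so any two functions of the union already share one domain, and
  each condition of the criterion is inherited from there.\<close>

lemma symmetric_op_Union_Dj:
  assumes adm: "\<And>j. admissible (P j)" and mono: "\<And>i j. i \<le> j \<Longrightarrow> Dj (P i) \<subseteq> Dj (P j)"
  shows "symmetric_op G (rep G ` (\<Union>j::nat. Dj (P j))) (negD2 G)"
proof (rule symmetric_op_negD2[OF cpt])
  have common: "\<exists>j. \<phi> \<in> Dj (P j) \<and> \<psi> \<in> Dj (P j)" if "\<phi> \<in> (\<Union>j. Dj (P j))" "\<psi> \<in> (\<Union>j. Dj (P j))" for \<phi> \<psi>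
  proof -
    obtain i j where "\<phi> \<in> Dj (P i)" "\<psi> \<in> Dj (P j)" using \<open>\<phi> \<in> _\<close> \<open>\<psi> \<in> _\<close> by blast
    then show ?thesis using mono[of i "max i j"] mono[of j "max i j"] by (intro exI[of _ "max i j"]) auto
  qed
  show "(\<Union>j. Dj (P j)) \<subseteq> Dmax G" unfolding Dpart_def by blast
  show "(\<lambda>p. a * \<phi> p + b * \<psi> p) \<in> (\<Union>j. Dj (P j))"
    if "\<phi> \<in> (\<Union>j. Dj (P j))" "\<psi> \<in> (\<Union>j. Dj (P j))" for \<phi> \<psi> a b
    using common[OF that] Dj_lincomb by blast
  show "(\<lambda>e t. if e = e0 then q t else 0) \<in> rep G ` (\<Union>j. Dj (P j))" if "q \<in> test_fns (len G e0)" for e0 q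
    using Dj_test[OF adm[of 0] that] by blast
  show "\<exists>\<epsilon>>0. \<forall>e. \<forall>t\<in>{0..len G e}. \<iota> (gpt G e t) \<in> Nbh \<epsilon> (bnd G \<iota>) \<longrightarrow>
      wronskian \<phi> \<psi> e t = 0 \<and> d2 G (rep G \<phi>) e t = 0 \<and> d2 G (rep G \<psi>) e t = 0"
    if "\<phi> \<in> (\<Union>j. Dj (P j))" "\<psi> \<in> (\<Union>j. Dj (P j))" for \<phi> \<psi>
    using common[OF that] Dj_flat[OF adm] by blast
qed

end

theorem theorem4p2:
  fixes G :: "('v::countable, 'e::countable) mgraph"
    and \<iota> :: "('v, 'e) gpoint \<Rightarrow> 'm::metric_space"
    and N :: nat and E :: "nat \<Rightarrow> 'm set" and \<delta> :: real
    and h :: "nat \<Rightarrow> ('v, 'e) gpoint \<Rightarrow> real"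
    and \<E> :: "nat \<Rightarrow> 'm set set"
  assumes graph: "metric_graph G"
    and compl: "is_completion G \<iota>"
    and cpt: "compact (UNIV :: 'm set)"
    and td: "totally_disconnected (bnd G \<iota>)"
    and E_clopen: "\<forall>n\<le>N. E n \<noteq> {} \<and> clopen_in (bnd G \<iota>) (E n)"
    and E_disj: "\<forall>n\<le>N. \<forall>m\<le>N. n \<noteq> m \<longrightarrow> E n \<inter> E m = {}"
    and E_cover: "(\<Union>n\<le>N. E n) = bnd G \<iota>"
    and \<delta>_pos: "0 < \<delta>"
    and Nbh_disj: "\<forall>n\<le>N. \<forall>m\<le>N. n \<noteq> m \<longrightarrow> Nbh \<delta> (E n) \<inter> Nbh \<delta> (E m) = {}"
    and Nbh_vol: "\<forall>n\<in>{1..N}. volume G \<iota> (Nbh \<delta> (E n)) < \<infinity>"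
    and h_harm: "\<forall>n\<in>{1..N}. harmonic_on G (Gpart G \<iota> (Nbh \<delta> (E n))) (h n)"
    and h_L2: "\<forall>n\<in>{1..N}. L2on G (Gpart G \<iota> (Nbh \<delta> (E n))) (h n)"
    and h0: "h 0 = (\<lambda>_. 0)"
    and \<E>0: "\<E> 0 = E ` {0..N}"
    and \<E>step: "\<forall>j. refine_step (bnd G \<iota>) (\<E> j) (\<E> (Suc j))"
  shows "(\<forall>j. symmetric_op G (rep G ` Dpart G \<iota> \<delta> N E h (\<E> j)) (negD2 G)
             \<and> has_self_adjoint_ext G (rep G ` Dpart G \<iota> \<delta> N E h (\<E> j)) (negD2 G))
         \<and> symmetric_op G (rep G ` (\<Union>j. Dpart G \<iota> \<delta> N E h (\<E> j))) (negD2 G)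
         \<and> has_self_adjoint_ext G (rep G ` (\<Union>j. Dpart G \<iota> \<delta> N E h (\<E> j))) (negD2 G)"
proof -
  interpret boundary_data G \<iota> N E \<delta> h
    by standard (use assms in auto)
  have adm: "admissible (\<E> j)" for j
    by (induction j) (use \<E>0 \<E>step admissible_initial admissible_refine(1) in auto)
  have "Dj (\<E> j) \<subseteq> Dj (\<E> (Suc j))" for j
    using \<E>step admissible_refine(2)[OF adm] by (intro Dj_mono adm) blast
  then have mono: "Dj (\<E> i) \<subseteq> Dj (\<E> j)" if "i \<le> j" for i j
    using that by (rule lift_Suc_mono_le)
  have "symmetric_op G (rep G ` Dj (\<E> j)) (negD2 G)" for j by (rule symmetric_op_Dj[OF adm])
  moreover have "symmetric_op G (rep G ` (\<Union>j. Dj (\<E> j))) (negD2 G)"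
    by (rule symmetric_op_Union_Dj[OF adm mono])
  ultimately show ?thesis using symmetric_op_has_self_adjoint_ext by blast
qed

end
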